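(* Let $n\ge1$, $q>1$, and let $\mu\in\mathcal P_1(\mathbb R^n)$ satisfy $\int y\,\mathrm d\mu(y)=0$ and not be supported on a hyperplane. Let $\overline\varrho\in\mathcal P_1(\mathbb R^n)$ be a minimizer of $\mathcal J(\varrho)=\mathcal F(\varrho)+\mathcal T(\varrho,\mu)$ over $\mathcal P_1(\mathbb R^n)$, and let $\overline u$ be a solution of $$\inf\Big\{\int_{\mathbb R^n}u\,\mathrm d\overline\varrho+\int_{\mathbb R^n}u^*\,\mathrm d\mu\ :\ u:\mathbb R^n\to\mathbb R\cup\{+\infty\}\ \text{convex and l.s.c.}\Big\}.$$ Then there exists a constant $c$ such that $\overline u\ge c$ and $$\overline u+f'(\overline\varrho^{\rm ac})=c\ \text{ a.e. on }\{\overline\varrho^{\rm ac}>0\},\qquad \overline u+f'(\overline\varrho^{\rm ac})\ge c\ \text{ a.e. on }\{\overline\varrho^{\rm ac}=0\},$$ and $\overline\varrho^{\rm sing}$ is concentrated on $\{\overline u=c\}$. Moreover, the set $\{\overline u=c\}$ is empty, and thus $\overline\varrho^{\rm sing}=0$: the optimal $\overline\varrho$ is absolutely continuous, with bounded density given by $$\overline\varrho=\overline\varrho^{\rm ac}=\frac1{(\overline u-c)^{n+q}}.$$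
   Context: $\mathcal P_1(\mathbb R^n)$ is the set of Borel probability measures $\varrho$ on $\mathbb R^n$ with $\int|x|\,\mathrm d\varrho(x)<+\infty$. "Not supported on a hyperplane" means $\mu(H)<1$ for every affine hyperplane $H\subset\mathbb R^n$. Set $\alpha=1-\frac1{n+q}\in(0,1)$ and $f(t)=-\frac1\alpha t^\alpha$ for $t\ge0$, so $f'(t)=-t^{\alpha-1}$ for $t>0$ and $f'(0)=-\infty$. For a probability measure $\varrho$ with Radon-Nikodym decomposition $\varrho=\varrho^{\rm ac}(x)\,\mathrm dx+\varrho^{\rm sing}$ with respect to Lebesgue measure, $\mathcal F(\varrho):=\int_{\mathbb R^n}f(\varrho^{\rm ac}(x))\,\mathrm dx$. $\mathcal T(\varrho,\mu):=\sup\{\int x\cdot y\,\mathrm d\gamma(x,y)\}\in[0,+\infty]$ (for $\mu$ as in the claim), the supremum being over all probability measures $\gamma$ on $\mathbb R^n\times\mathbb R^n$ with marginals $\varrho$ and $\mu$ for which the integral is meaningful in $[-\infty,+\infty]$. $u^*(y)=\sup_x\{x\cdot y-u(x)\}$ is the Legendre transform; functions $u$ are understood to be not identically $+\infty$. Conventions: $(+\infty)+(-\infty)=+\infty$ in the expression $\overline u+f'(\overline\varrho^{\rm ac})$, and $(+\infty)^{-(n+q)}=0$. "A.e." refers to Lebesgue measure. *)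

theory Defs
  imports "HOL-Analysis.Analysis" "HOL-Probability.Probability_Measure"
begin

section \<open>Probability measures with finite first moment\<close>

definition P1 :: "'a::euclidean_space measure set" where
  "P1 = {\<rho>. prob_space \<rho> \<and> sets \<rho> = sets borel \<and> integrable \<rho> norm}"

definition supported_on_hyperplane :: "'a::euclidean_space measure \<Rightarrow> bool" where
  "supported_on_hyperplane \<mu> \<longleftrightarrow>
     (\<exists>a b. a \<noteq> 0 \<and> \<not> measure \<mu> {y. a \<bullet> y = b} < 1)"

section \<open>Integrals of extended-real functions\<close>

text \<open>The composition with \<^const>\<open>e2ennreal\<close> is the positive part: it sends negative values
  to \<open>0\<close>.\<close>

definition ext_integral :: "'a measure \<Rightarrow> ('a \<Rightarrow> ereal) \<Rightarrow> ereal" where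
  "ext_integral M g =
     enn2ereal (\<integral>\<^sup>+x. e2ennreal (g x) \<partial>M) - enn2ereal (\<integral>\<^sup>+x. e2ennreal (- g x) \<partial>M)"

definition ext_integral_meaningful :: "'a measure \<Rightarrow> ('a \<Rightarrow> ereal) \<Rightarrow> bool" where
  "ext_integral_meaningful M g \<longleftrightarrow> g \<in> borel_measurable M \<and>
     ((\<integral>\<^sup>+x. e2ennreal (g x) \<partial>M) < \<infinity> \<or> (\<integral>\<^sup>+x. e2ennreal (- g x) \<partial>M) < \<infinity>)"

section \<open>Lebesgue decomposition with respect to Lebesgue measure\<close>

definition lebesgue_decomposition ::
  "'a::euclidean_space measure \<Rightarrow> ('a \<Rightarrow> real) \<Rightarrow> 'a measure \<Rightarrow> bool" where
  "lebesgue_decomposition \<rho> g \<nu> \<longleftrightarrow>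
     g \<in> borel_measurable borel \<and> (\<forall>x. 0 \<le> g x) \<and> sets \<nu> = sets borel \<and>
     (\<exists>N\<in>null_sets lborel. emeasure \<nu> (- N) = 0) \<and>
     (\<forall>A\<in>sets borel. emeasure \<rho> A = (\<integral>\<^sup>+x\<in>A. ennreal (g x) \<partial>lborel) + emeasure \<nu> A)"

text \<open>The density is only determined up to a Lebesgue null set; a representative is chosen.\<close>

definition ac_density :: "'a::euclidean_space measure \<Rightarrow> 'a \<Rightarrow> real" where
  "ac_density \<rho> = (SOME g. \<exists>\<nu>. lebesgue_decomposition \<rho> g \<nu>)"

definition sing_part :: "'a::euclidean_space measure \<Rightarrow> 'a measure" where
  "sing_part \<rho> = (SOME \<nu>. lebesgue_decomposition \<rho> (ac_density \<rho>) \<nu>)"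

lemma lebesgue_decomposition_exists:
  fixes \<rho> :: "'a::euclidean_space measure"
  assumes fin: "finite_measure \<rho>" and [measurable_cong, simp]: "sets \<rho> = sets borel"
  shows "\<exists>g \<nu>. lebesgue_decomposition \<rho> g \<nu>"
proof -
  interpret finite_measure \<rho> by (rule fin)
  define s where "s = (SUP N\<in>null_sets (lborel :: 'a measure). emeasure \<rho> N)"
  have "\<exists>F :: nat \<Rightarrow> ennreal. range F \<subseteq> emeasure \<rho> ` null_sets lborel \<and> s = (SUP i. F i)"
    unfolding s_def using ennreal_Sup_countable_SUP[of "emeasure \<rho> ` null_sets lborel"]
    by blast
  then obtain F :: "nat \<Rightarrow> ennreal"
    where F: "range F \<subseteq> emeasure \<rho> ` null_sets lborel" "s = (SUP i. F i)"
    by blast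
  then have "\<forall>i. \<exists>N\<in>null_sets lborel. F i = emeasure \<rho> N" by blast
  then obtain N' where N': "\<And>i. N' i \<in> null_sets lborel" "\<And>i. F i = emeasure \<rho> (N' i)"
    by metis
  define N where "N = (\<Union>i::nat. N' i)"
  have N: "N \<in> null_sets lborel" unfolding N_def using N' by (intro null_sets_UN)
  then have [measurable]: "N \<in> sets borel" by (auto simp: null_sets_def)
  have "s \<le> emeasure \<rho> N"
    unfolding F(2)
  proof (rule SUP_least)
    fix i show "F i \<le> emeasure \<rho> N"
      unfolding N' by (rule emeasure_mono) (auto simp: N_def[symmetric], auto simp: N_def)
  qed
  define \<rho>a where "\<rho>a = density \<rho> (indicator (- N))"
  define \<nu> where "\<nu> = density \<rho> (indicator N)"
  have ea: "emeasure \<rho>a A = emeasure \<rho> (A - N)" if [measurable]: "A \<in> sets borel" for A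
    unfolding \<rho>a_def by (simp add: emeasure_restricted Int_commute Diff_eq)
  have es: "emeasure \<nu> A = emeasure \<rho> (A \<inter> N)" if [measurable]: "A \<in> sets borel" for A
    unfolding \<nu>_def by (simp add: emeasure_restricted Int_commute)
  have "absolutely_continuous lborel \<rho>a"
    unfolding absolutely_continuous_def
  proof
    fix A assume A: "A \<in> null_sets (lborel :: 'a measure)"
    then have [measurable]: "A \<in> sets borel" by (auto simp: null_sets_def)
    have "emeasure \<rho> N + emeasure \<rho> (A - N) = emeasure \<rho> (A \<union> N)"
      by (subst plus_emeasure) (auto intro!: arg_cong[where f="emeasure \<rho>"])
    also have "\<dots> \<le> s" unfolding s_def using A N by (intro SUP_upper) auto
    also have "\<dots> \<le> emeasure \<rho> N" by fact
    finally have "emeasure \<rho> (A - N) = 0"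
      using emeasure_finite[of N] by (cases "emeasure \<rho> N"; cases "emeasure \<rho> (A - N)")
        (auto simp flip: ennreal_plus)
    then show "A \<in> null_sets \<rho>a" by (intro null_setsI) (auto simp: ea, simp add: \<rho>a_def)
  qed
  moreover have "sets \<rho>a = sets lborel" by (simp add: \<rho>a_def)
  ultimately obtain f where f[measurable]: "f \<in> borel_measurable borel"
      and fd: "density lborel f = \<rho>a"
    using sigma_finite_measure.Radon_Nikodym[OF sigma_finite_lborel, of \<rho>a] by auto
  have "(\<integral>\<^sup>+x. f x \<partial>lborel) = emeasure \<rho>a UNIV"
    by (simp add: fd[symmetric] emeasure_density)
  also have "\<dots> \<noteq> \<infinity>" by (simp add: ea)
  finally have "AE x in lborel. f x \<noteq> \<infinity>" by (intro nn_integral_PInf_AE) auto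
  then have fe: "AE x in lborel. ennreal (enn2real (f x)) = f x"
    by eventually_elim (simp add: less_top)
  have "lebesgue_decomposition \<rho> (\<lambda>x. enn2real (f x)) \<nu>"
    unfolding lebesgue_decomposition_def
  proof (intro conjI ballI)
    fix A :: "'a set" assume A[measurable]: "A \<in> sets borel"
    have "(\<integral>\<^sup>+x\<in>A. ennreal (enn2real (f x)) \<partial>lborel) = (\<integral>\<^sup>+x\<in>A. f x \<partial>lborel)"
      using fe by (intro nn_integral_cong_AE) auto
    also have "\<dots> = emeasure \<rho> (A - N)"
      using A by (simp add: ea[symmetric] fd[symmetric] emeasure_density)
    finally have *: "(\<integral>\<^sup>+x\<in>A. ennreal (enn2real (f x)) \<partial>lborel) = emeasure \<rho> (A - N)" .
    show "emeasure \<rho> A = (\<integral>\<^sup>+x\<in>A. ennreal (enn2real (f x)) \<partial>lborel) + emeasure \<nu> A"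
      unfolding * es[OF A] by (subst plus_emeasure) (auto intro!: arg_cong[where f="emeasure \<rho>"])
  next
    have "emeasure \<nu> (- N) = 0" by (subst es) auto
    then show "\<exists>N\<in>null_sets lborel. emeasure \<nu> (- N) = 0" using N by blast
  qed (auto simp: \<nu>_def)
  then show ?thesis by blast
qed

lemma lebesgue_decomposition_ac_sing:
  assumes "finite_measure \<rho>" "sets \<rho> = sets borel"
  shows "lebesgue_decomposition \<rho> (ac_density \<rho>) (sing_part \<rho>)"
proof -
  have "\<exists>g. \<exists>\<nu>. lebesgue_decomposition \<rho> g \<nu>"
    using lebesgue_decomposition_exists[OF assms] by blast
  then have "\<exists>\<nu>. lebesgue_decomposition \<rho> (ac_density \<rho>) \<nu>"
    unfolding ac_density_def by (rule someI_ex)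
  then show ?thesis unfolding sing_part_def by (rule someI_ex)
qed

section \<open>The functionals\<close>

definition alpha :: "nat \<Rightarrow> real \<Rightarrow> real" where
  "alpha n q = 1 - 1 / (real n + q)"

definition ent :: "real \<Rightarrow> real \<Rightarrow> real" where
  "ent \<alpha> t = - (1 / \<alpha>) * t powr \<alpha>"

text \<open>The derivative of \<^term>\<open>ent \<alpha>\<close> on \<open>[0, \<infinity>)\<close>, including its value at \<open>0\<close>.
  When it is added to an extended real, \<^typ>\<open>ereal\<close> addition gives
  \<open>\<infinity> + (- \<infinity>) = \<infinity>\<close>.\<close>

definition ent_deriv :: "real \<Rightarrow> real \<Rightarrow> ereal" where
  "ent_deriv \<alpha> t = (if t = 0 then - \<infinity> else ereal (- (t powr (\<alpha> - 1))))"

definition energy :: "real \<Rightarrow> 'a::euclidean_space measure \<Rightarrow> ereal" where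
  "energy \<alpha> \<rho> = ext_integral lborel (\<lambda>x. ereal (ent \<alpha> (ac_density \<rho> x)))"

definition couplings ::
  "'a::euclidean_space measure \<Rightarrow> 'a measure \<Rightarrow> ('a \<times> 'a) measure set" where
  "couplings \<rho> \<mu> = {\<gamma>. prob_space \<gamma> \<and> sets \<gamma> = sets borel \<and>
     distr \<gamma> borel fst = \<rho> \<and> distr \<gamma> borel snd = \<mu>}"

definition transport :: "'a::euclidean_space measure \<Rightarrow> 'a measure \<Rightarrow> ereal" where
  "transport \<rho> \<mu> =
     (SUP \<gamma>\<in>{\<gamma> \<in> couplings \<rho> \<mu>. ext_integral_meaningful \<gamma> (\<lambda>(x, y). ereal (x \<bullet> y))}.
        ext_integral \<gamma> (\<lambda>(x, y). ereal (x \<bullet> y)))"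

definition J_functional :: "real \<Rightarrow> 'a::euclidean_space measure \<Rightarrow> 'a measure \<Rightarrow> ereal" where
  "J_functional \<alpha> \<mu> \<rho> = energy \<alpha> \<rho> + transport \<rho> \<mu>"

section \<open>The dual problem\<close>

definition legendre :: "('a::euclidean_space \<Rightarrow> ereal) \<Rightarrow> 'a \<Rightarrow> ereal" where
  "legendre u y = (SUP x. ereal (x \<bullet> y) - u x)"

definition convex_ereal :: "('a::real_vector \<Rightarrow> ereal) \<Rightarrow> bool" where
  "convex_ereal u \<longleftrightarrow> (\<forall>x y t. 0 < t \<and> t < 1 \<longrightarrow>
     u ((1 - t) *\<^sub>R x + t *\<^sub>R y) \<le> ereal (1 - t) * u x + ereal t * u y)"

definition lsc :: "('a::topological_space \<Rightarrow> ereal) \<Rightarrow> bool" where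
  "lsc u \<longleftrightarrow> (\<forall>x. u x \<le> Liminf (at x) u)"

definition admissible :: "('a::euclidean_space \<Rightarrow> ereal) \<Rightarrow> bool" where
  "admissible u \<longleftrightarrow>
     (\<forall>x. u x \<noteq> - \<infinity>) \<and> (\<exists>x. u x \<noteq> \<infinity>) \<and> convex_ereal u \<and> lsc u"

text \<open>For admissible \<^term>\<open>u\<close> and measures in \<^const>\<open>P1\<close>, both integrals lie in
  \<open>(-\<infinity>, \<infinity>]\<close>, since \<^term>\<open>u\<close> and \<^term>\<open>legendre u\<close> have affine minorants.\<close>

definition dual_cost ::
  "'a::euclidean_space measure \<Rightarrow> 'a measure \<Rightarrow> ('a \<Rightarrow> ereal) \<Rightarrow> ereal" where
  "dual_cost \<rho> \<mu> u = ext_integral \<rho> u + ext_integral \<mu> (legendre u)"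

text \<open>\<open>t\<^bsup>-p\<^esup>\<close> for \<open>t \<in> (0, \<infinity>]\<close>, with \<open>\<infinity>\<^bsup>-p\<^esup> = 0\<close>.
  Caution: \<^const>\<open>powr\<close> also gives the value \<open>0\<close> at \<open>t = 0\<close>.\<close>

definition neg_power :: "ereal \<Rightarrow> real \<Rightarrow> real" where
  "neg_power t p = (if t = \<infinity> then 0 else real_of_ereal t powr (- p))"

end

theory Submission
  imports Defs "HOL-Probability.Probability_Mass_Function"
begin

text \<open>
  Strong Kantorovich duality only needs a cyclically monotone coupling. For finitely supported marginals an optimal plan exists by
  compactness, and shifting mass along cycles shows that its support is cyclically monotone. Coding
  points by the members of a countable base that contain them, a subsequence of such plans
  converges on all cells of the code; the limiting cell masses define a coupling of \<open>\<rho>\<close> and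
  \<open>\<mu>\<close> which is concentrated on a cyclically monotone set. Its Rockafellar potential has dual cost
  at most \<open>transport \<rho> \<mu>\<close>, because \<open>x \<bullet> y\<close> splits as \<open>w x + w\<^sup>* y\<close> on that set. No optimality of this
  coupling is needed.

  By duality \<open>\<rho>\<close> minimises \<open>\<rho>' \<mapsto> F \<rho>' + \<integral> u d\<rho>'\<close>. Moving a small fraction of the mass of \<open>\<rho>\<close> to the
  uniform distribution on a set gives \<open>u - g\<^bsup>\<alpha> - 1\<^esup> \<ge> c := \<integral> u d\<rho> - \<integral> g\<^sup>\<alpha>\<close> almost everywhere on
  \<open>{u < \<infinity>}\<close>, where \<open>g\<close> is the density of \<open>\<rho>\<close>. Convexity upgrades this to \<open>u \<ge> c\<close> everywhere, and
  integrating against \<open>\<rho>\<close> forces equality \<open>\<rho>\<close>-almost everywhere. Finally \<open>u\<close> stays away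
  from \<open>c\<close>, since otherwise \<open>g = (u - c)\<^bsup>- (n + q)\<^esup>\<close> would have infinite mass on a cone of segments.
\<close>

section \<open>Rockafellar potentials and weak duality\<close>

text \<open>With first moments only, \<open>x \<bullet> y\<close> need not be integrable under a
  coupling, so a maximising plan cannot simply be taken. Cyclical monotonicity concerns finitely
  many points at a time, so it survives limits of discretised plans and still yields a potential.
  Integrability is recovered afterwards by subtracting affine minorants, which first moments do
  control. Two signs keep the problem finite and nondegenerate: centring of \<open>\<mu>\<close>
  gives a nonnegative transport term through the product coupling, and the uniform distribution on a
  ball of suitable radius has negative \<open>J_functional\<close>. Hence the minimiser has finite
  transport cost and a density that is not almost everywhere zero, so its potential is finite on a
  set of positive volume, and convexity carries information along segments between that set and any
  other point. The condition q > 1 enters through integrability of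
  \<open>(1 + norm x) powr (- (n + q - 1))\<close>, which makes every energy finite. The power n + q
  of the result arises because f' is minus the power
  \<open>\<alpha> - 1 = - 1 / (n + q)\<close>.\<close>

definition cyclically_monotone :: "('a::real_inner \<times> 'a) set \<Rightarrow> bool" where
  "cyclically_monotone S \<longleftrightarrow> (\<forall>N z. (\<forall>i\<le>N. z i \<in> S) \<longrightarrow>
     (\<Sum>i\<le>N. snd (z i) \<bullet> (fst (z (if i = N then 0 else Suc i)) - fst (z i))) \<le> 0)"

lemma convex_ereal_SUP_affine:
  fixes a :: "'i \<Rightarrow> 'a::euclidean_space"
  shows "convex_ereal (\<lambda>x. SUP i\<in>I. ereal (a i \<bullet> x + b i))"
  unfolding convex_ereal_def
proof (intro allI impI)
  fix x y :: 'a and t :: real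
  assume t: "0 < t \<and> t < 1"
  show "(SUP i\<in>I. ereal (a i \<bullet> ((1 - t) *\<^sub>R x + t *\<^sub>R y) + b i)) \<le>
     ereal (1 - t) * (SUP i\<in>I. ereal (a i \<bullet> x + b i)) + ereal t * (SUP i\<in>I. ereal (a i \<bullet> y + b i))"
  proof (rule SUP_least)
    fix i assume i: "i \<in> I"
    have "ereal (a i \<bullet> ((1 - t) *\<^sub>R x + t *\<^sub>R y) + b i) =
        ereal (1 - t) * ereal (a i \<bullet> x + b i) + ereal t * ereal (a i \<bullet> y + b i)"
      by (simp add: inner_add_right algebra_simps)
    also have "\<dots> \<le> ereal (1 - t) * (SUP i\<in>I. ereal (a i \<bullet> x + b i)) + ereal t * (SUP i\<in>I. ereal (a i \<bullet> y + b i))"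
      using t i by (intro add_mono ereal_mult_left_mono SUP_upper) auto
    finally show "ereal (a i \<bullet> ((1 - t) *\<^sub>R x + t *\<^sub>R y) + b i) \<le> \<dots>" .
  qed
qed

lemma lsc_SUP:
  assumes "\<And>i. i \<in> I \<Longrightarrow> continuous_on UNIV (f i)"
  shows "lsc (\<lambda>x. SUP i\<in>I. (f i x :: ereal))"
  unfolding lsc_def
proof (intro allI SUP_least)
  fix x i assume i: "i \<in> I"
  show "f i x \<le> Liminf (at x) (\<lambda>x. SUP i\<in>I. f i x)"
  proof (cases "at x = bot")
    case True then show ?thesis by (simp add: Liminf_bot)
  next
    case False
    have "(f i \<longlongrightarrow> f i x) (at x)"
      using assms[OF i] by (simp add: continuous_on_def)
    then have "f i x = Liminf (at x) (f i)"
      using lim_imp_Liminf[OF False] by metis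
    also have "\<dots> \<le> Liminf (at x) (\<lambda>x. SUP i\<in>I. f i x)"
      using i by (intro Liminf_mono always_eventually allI SUP_upper)
    finally show ?thesis .
  qed
qed

lemma closed_lsc_sublevel:
  fixes u :: "'a::metric_space \<Rightarrow> ereal"
  assumes "lsc u"
  shows "closed {x. u x \<le> a}"
proof -
  have "open {x. a < u x}"
    unfolding open_dist
  proof safe
    fix x assume "a < u x"
    then have "a < Liminf (at x) u" using assms unfolding lsc_def by (meson less_le_trans)
    then have "\<forall>\<^sub>F y in at x. a < u y" by (rule less_LiminfD)
    then obtain e where "e > 0" "\<forall>y. y \<noteq> x \<and> dist y x < e \<longrightarrow> a < u y"
      unfolding eventually_at by auto
    then show "\<exists>e>0. \<forall>y. dist y x < e \<longrightarrow> y \<in> {x. a < u x}"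
      using \<open>a < u x\<close> by (intro exI[of _ e]) (metis mem_Collect_eq)
  qed
  then have "closed (- {x. a < u x})" by (simp add: closed_def)
  then show ?thesis by (simp add: Compl_eq not_less)
qed

lemma borel_measurable_lsc:
  fixes u :: "'a::metric_space \<Rightarrow> ereal"
  assumes "lsc u"
  shows "u \<in> borel_measurable borel"
  using closed_lsc_sublevel[OF assms]
  by (intro borel_measurableI_le) (auto intro: borel_closed)

text \<open>Points with \<open>u x = \<infinity>\<close> contribute only
  \<open>- \<infinity>\<close>. Dropping them leaves continuous affine functions of
  \<open>y\<close>, so that \<open>legendre u\<close> is lower semicontinuous and hence
  Borel.\<close>

lemma legendre_eq_SUP:
  "legendre u y = (SUP x\<in>{x. u x \<noteq> \<infinity>}. ereal (x \<bullet> y) - u x)"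
proof (rule antisym)
  show "legendre u y \<le> (SUP x\<in>{x. u x \<noteq> \<infinity>}. ereal (x \<bullet> y) - u x)"
    unfolding legendre_def
  proof (rule SUP_least)
    fix x
    show "ereal (x \<bullet> y) - u x \<le> (SUP x\<in>{x. u x \<noteq> \<infinity>}. ereal (x \<bullet> y) - u x)"
    proof (cases "u x = \<infinity>")
      case True then show ?thesis by simp
    next
      case False then show ?thesis by (intro SUP_upper) auto
    qed
  qed
qed (auto simp: legendre_def intro: SUP_mono)

lemma borel_measurable_legendre:
  fixes u :: "'a::euclidean_space \<Rightarrow> ereal"
  assumes "\<And>x. u x \<noteq> - \<infinity>"
  shows "legendre u \<in> borel_measurable borel"
proof (rule borel_measurable_lsc)
  have "lsc (\<lambda>y. SUP x\<in>{x. u x \<noteq> \<infinity>}. ereal (x \<bullet> y) - u x)"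
  proof (rule lsc_SUP)
    fix x assume "x \<in> {x. u x \<noteq> \<infinity>}"
    then obtain r where "u x = ereal r" using assms[of x] by (cases "u x") auto
    then show "continuous_on UNIV (\<lambda>y. ereal (x \<bullet> y) - u x)"
      by (auto intro!: continuous_intros)
  qed
  then show "lsc (legendre u)" by (subst legendre_eq_SUP[abs_def])
qed

lemma legendre_ge: "ereal (x \<bullet> y) - u x \<le> legendre u y"
  unfolding legendre_def by (rule SUP_upper) simp

text \<open>Rockafellar's construction: the potential is the supremum over all chains in \<open>S\<close> that
  start at a fixed point.\<close>

lemma rockafellar_potential:
  fixes S :: "('a::euclidean_space \<times> 'a) set"
  assumes cm: "cyclically_monotone S" and ne: "S \<noteq> {}"
  obtains u where "admissible u"
    "\<And>x y. (x, y) \<in> S \<Longrightarrow> \<bar>u x\<bar> \<noteq> \<infinity> \<and> legendre u y = ereal (x \<bullet> y) - u x"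
proof -
  obtain x0 y0 where z0: "(x0, y0) \<in> S" using ne by auto
  define chains where "chains = {(N, z). z 0 = (x0, y0) \<and> (\<forall>i\<le>N::nat. z i \<in> S)}"
  define val where "val N z x = (\<Sum>i<N. snd (z i) \<bullet> (fst (z (Suc i)) - fst (z i)))
      + snd (z N) \<bullet> (x - fst (z N))" for N and z :: "nat \<Rightarrow> 'a \<times> 'a" and x
  define u where "u x = (SUP (N, z)\<in>chains. ereal (val N z x))" for x
  have u_alt: "u = (\<lambda>x. SUP c\<in>chains. ereal (snd (snd c (fst c)) \<bullet> x +
      ((\<Sum>i<fst c. snd (snd c i) \<bullet> (fst (snd c (Suc i)) - fst (snd c i)))
       - snd (snd c (fst c)) \<bullet> fst (snd c (fst c)))))"
    unfolding u_def val_def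
    by (intro ext SUP_cong) (auto simp: inner_diff_right algebra_simps)
  have val_le: "ereal (val N z x) \<le> u x" if "z 0 = (x0, y0)" "\<And>i. i \<le> N \<Longrightarrow> z i \<in> S" for N z x
    unfolding u_def by (rule SUP_upper2[of "(N, z)"]) (use that in \<open>auto simp: chains_def\<close>)
  have u_ge: "ereal (y0 \<bullet> (x - x0)) \<le> u x" for x
    using val_le[of "\<lambda>_. (x0, y0)" 0 x] z0 by (simp add: val_def)
  \<comment> \<open>A chain starting at \<open>x0\<close> and evaluated at \<open>x0\<close> closes
    up to a cycle.\<close>
  have u_x0: "u x0 \<le> 0"
    unfolding u_def
  proof (rule SUP_least, clarsimp simp: chains_def)
    fix N and z :: "nat \<Rightarrow> 'a \<times> 'a" assume z: "z 0 = (x0, y0)" "\<forall>i\<le>N. z i \<in> S"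
    have "val N z x0 = (\<Sum>i\<le>N. snd (z i) \<bullet> (fst (z (if i = N then 0 else Suc i)) - fst (z i)))"
      unfolding val_def lessThan_Suc_atMost[symmetric] by (simp add: z(1))
    also have "\<dots> \<le> 0" using cm z unfolding cyclically_monotone_def by blast
    finally show "val N z x0 \<le> 0" .
  qed
  \<comment> \<open>\<open>y\<close> is a subgradient of \<open>u\<close> at \<open>x\<close>:
    appending \<open>(x, y)\<close> to a chain evaluated at \<open>x\<close> gives a chain that may
    be evaluated at \<open>x'\<close>.\<close>
  have sub: "u x + ereal (y \<bullet> (x' - x)) \<le> u x'" if xy: "(x, y) \<in> S" for x y x'
  proof -
    have "u x \<le> u x' - ereal (y \<bullet> (x' - x))"
      unfolding u_def[of x]
    proof (rule SUP_least, clarsimp simp: chains_def)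
      fix N and z :: "nat \<Rightarrow> 'a \<times> 'a" assume z: "z 0 = (x0, y0)" "\<forall>i\<le>N. z i \<in> S"
      define z' where "z' = z(Suc N := (x, y))"
      have "val (Suc N) z' x' = val N z x + y \<bullet> (x' - x)"
        unfolding val_def by (simp add: z'_def)
      moreover have "ereal (val (Suc N) z' x') \<le> u x'"
        by (rule val_le) (use z xy in \<open>auto simp: z'_def le_Suc_eq\<close>)
      ultimately show "ereal (val N z x) \<le> u x' - ereal (y \<bullet> (x' - x))"
        by (cases "u x'") auto
    qed
    then show ?thesis by (cases "u x"; cases "u x'") auto
  qed
  have adm: "admissible u"
    unfolding admissible_def
  proof (intro conjI allI)
    show "u x \<noteq> - \<infinity>" for x using u_ge[of x] by auto
    show "\<exists>x. u x \<noteq> \<infinity>" using u_x0 by (intro exI[of _ x0]) auto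
    show "convex_ereal u" unfolding u_alt by (rule convex_ereal_SUP_affine)
    show "lsc u" unfolding u_alt by (intro lsc_SUP continuous_intros)
  qed
  show thesis
  proof (rule that[OF adm])
    fix x y assume xy: "(x, y) \<in> S"
    \<comment> \<open>The subgradient inequality towards \<open>x0\<close>, where \<open>u\<close>
      is at most 0, bounds \<open>u x\<close> from above.\<close>
    have fin: "\<bar>u x\<bar> \<noteq> \<infinity>"
      using sub[OF xy, of x0] u_x0 u_ge[of x] by (cases "u x") auto
    then obtain r where r: "u x = ereal r" by auto
    have "legendre u y \<le> ereal (x \<bullet> y) - u x"
      unfolding legendre_def
    proof (rule SUP_least)
      fix x'
      show "ereal (x' \<bullet> y) - u x' \<le> ereal (x \<bullet> y) - u x"
        using sub[OF xy, of x'] by (cases "u x'") (auto simp: r inner_diff_right inner_commute)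
    qed
    then show "\<bar>u x\<bar> \<noteq> \<infinity> \<and> legendre u y = ereal (x \<bullet> y) - u x"
      using fin legendre_ge[of x y u] by auto
  qed
qed

section \<open>Integrals of extended-real functions, couplings, and the two halves of
  duality\<close>

lemma ext_integral_real:
  assumes "integrable M f" "AE x in M. g x = ereal (f x)"
  shows "ext_integral M g = ereal (\<integral>x. f x \<partial>M)"
proof -
  have 1: "(\<integral>\<^sup>+x. e2ennreal (g x) \<partial>M) = (\<integral>\<^sup>+x. ennreal (f x) \<partial>M)"
    using assms(2) by (intro nn_integral_cong_AE) (auto simp: ennreal.rep_eq)
  have 2: "(\<integral>\<^sup>+x. e2ennreal (- g x) \<partial>M) = (\<integral>\<^sup>+x. ennreal (- f x) \<partial>M)"
    using assms(2) by (intro nn_integral_cong_AE) auto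
  have f: "(\<integral>\<^sup>+x. ennreal (f x) \<partial>M) < \<infinity>" "(\<integral>\<^sup>+x. ennreal (- f x) \<partial>M) < \<infinity>"
    using assms(1) by (auto simp: real_integrable_def less_top)
  show ?thesis
    unfolding ext_integral_def 1 2 real_lebesgue_integral_def[OF assms(1)]
    using f by (cases "(\<integral>\<^sup>+x. ennreal (f x) \<partial>M)"; cases "(\<integral>\<^sup>+x. ennreal (- f x) \<partial>M)") auto
qed

text \<open>The integrable minorant makes the negative part finite, so a difference below
  \<open>\<infinity>\<close> forces the positive part to be finite as well.\<close>

lemma integrable_of_ext_integral:
  fixes g :: "'a \<Rightarrow> ereal"
  assumes "g \<in> borel_measurable M" "ext_integral M g < \<infinity>"
    and "integrable M h" "AE x in M. ereal (h x) \<le> g x"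
  shows "integrable M (\<lambda>x. real_of_ereal (g x))" "AE x in M. g x = ereal (real_of_ereal (g x))"
proof -
  note [measurable] = assms(1) borel_measurable_integrable[OF assms(3)]
  have "(\<integral>\<^sup>+x. e2ennreal (- g x) \<partial>M) \<le> (\<integral>\<^sup>+x. ennreal (- h x) \<partial>M)"
  proof (intro nn_integral_mono_AE, use assms(4) in eventually_elim)
    case (elim x)
    then have "- g x \<le> ereal (- h x)" by (cases "g x") auto
    from e2ennreal_mono[OF this] show ?case by simp
  qed
  also have "\<dots> < \<infinity>" using assms(3) by (auto simp: real_integrable_def less_top)
  finally have neg: "(\<integral>\<^sup>+x. e2ennreal (- g x) \<partial>M) < \<infinity>" .
  have pos: "(\<integral>\<^sup>+x. e2ennreal (g x) \<partial>M) < \<infinity>"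
    using assms(2) neg unfolding ext_integral_def
    by (cases "\<integral>\<^sup>+x. e2ennreal (g x) \<partial>M"; cases "\<integral>\<^sup>+x. e2ennreal (- g x) \<partial>M") auto
  have "AE x in M. e2ennreal (g x) \<noteq> \<infinity>"
    using pos by (intro nn_integral_PInf_AE) auto
  then show ae: "AE x in M. g x = ereal (real_of_ereal (g x))"
    using assms(4)
  proof eventually_elim
    case (elim x)
    then show ?case by (cases "g x") auto
  qed
  have "(\<integral>\<^sup>+x. ennreal (real_of_ereal (g x)) \<partial>M) = (\<integral>\<^sup>+x. e2ennreal (g x) \<partial>M)"
    by (intro nn_integral_cong_AE, use ae in eventually_elim) (metis e2ennreal_ereal)
  moreover have "(\<integral>\<^sup>+x. ennreal (- real_of_ereal (g x)) \<partial>M) = (\<integral>\<^sup>+x. e2ennreal (- g x) \<partial>M)"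
    by (intro nn_integral_cong_AE, use ae in eventually_elim) (metis e2ennreal_ereal uminus_ereal.simps(1))
  ultimately show "integrable M (\<lambda>x. real_of_ereal (g x))"
    using pos neg by (auto simp: real_integrable_def)
qed


lemma P1D:
  assumes "\<rho> \<in> P1"
  shows "prob_space \<rho>" "sets \<rho> = sets borel" "integrable \<rho> norm"
  using assms by (auto simp: P1_def)

lemma integrable_affine_P1:
  assumes "\<rho> \<in> P1"
  shows "integrable \<rho> (\<lambda>x. a \<bullet> x + b)"
proof -
  interpret prob_space \<rho> using P1D[OF assms] by simp
  note [measurable_cong] = P1D(2)[OF assms]
  have "integrable \<rho> (\<lambda>x. a \<bullet> x)"
    by (rule Bochner_Integration.integrable_bound[where f="\<lambda>x. norm a * norm x"])
      (use P1D(3)[OF assms] in \<open>auto simp: Cauchy_Schwarz_ineq2\<close>)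
  then show ?thesis by simp
qed

lemma couplingsD:
  assumes "\<gamma> \<in> couplings \<rho> \<mu>"
  shows "prob_space \<gamma>" "sets \<gamma> = sets borel" "distr \<gamma> borel fst = \<rho>" "distr \<gamma> borel snd = \<mu>"
  using assms by (auto simp: couplings_def)

lemma measurable_fst_snd_borel:
  fixes M :: "('a::topological_space \<times> 'a) measure"
  assumes "sets M = sets borel"
  shows "fst \<in> borel_measurable M" "snd \<in> borel_measurable M"
proof -
  have "(fst :: 'a \<times> 'a \<Rightarrow> 'a) \<in> borel_measurable borel" "(snd :: 'a \<times> 'a \<Rightarrow> 'a) \<in> borel_measurable borel"
    by (intro borel_measurable_continuous_onI continuous_intros)+
  then show "fst \<in> borel_measurable M" "snd \<in> borel_measurable M"
    by (simp_all cong: measurable_cong_sets add: assms)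
qed

lemma coupling_integral_fst:
  fixes f :: "'a::euclidean_space \<Rightarrow> real"
  assumes \<gamma>: "\<gamma> \<in> couplings \<rho> \<mu>" and [measurable]: "f \<in> borel_measurable borel"
  shows "integrable \<gamma> (\<lambda>z. f (fst z)) \<longleftrightarrow> integrable \<rho> f"
    "(\<integral>z. f (fst z) \<partial>\<gamma>) = (\<integral>x. f x \<partial>\<rho>)"
proof -
  have [measurable]: "fst \<in> measurable \<gamma> borel"
    by (rule measurable_fst_snd_borel[OF couplingsD(2)[OF \<gamma>]])
  show "integrable \<gamma> (\<lambda>z. f (fst z)) \<longleftrightarrow> integrable \<rho> f"
    "(\<integral>z. f (fst z) \<partial>\<gamma>) = (\<integral>x. f x \<partial>\<rho>)"
    by (auto simp: couplingsD(3)[OF \<gamma>, symmetric] integrable_distr_eq integral_distr)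
qed

lemma coupling_integral_snd:
  fixes f :: "'a::euclidean_space \<Rightarrow> real"
  assumes \<gamma>: "\<gamma> \<in> couplings \<rho> \<mu>" and [measurable]: "f \<in> borel_measurable borel"
  shows "integrable \<gamma> (\<lambda>z. f (snd z)) \<longleftrightarrow> integrable \<mu> f"
    "(\<integral>z. f (snd z) \<partial>\<gamma>) = (\<integral>x. f x \<partial>\<mu>)"
proof -
  have [measurable]: "snd \<in> measurable \<gamma> borel"
    by (rule measurable_fst_snd_borel[OF couplingsD(2)[OF \<gamma>]])
  show "integrable \<gamma> (\<lambda>z. f (snd z)) \<longleftrightarrow> integrable \<mu> f"
    "(\<integral>z. f (snd z) \<partial>\<gamma>) = (\<integral>x. f x \<partial>\<mu>)"
    by (auto simp: couplingsD(4)[OF \<gamma>, symmetric] integrable_distr_eq integral_distr)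
qed

lemma coupling_AE:
  assumes \<gamma>: "\<gamma> \<in> couplings \<rho> \<mu>"
  shows "(AE x in \<rho>. P x) \<Longrightarrow> AE z in \<gamma>. P (fst z)" "(AE y in \<mu>. Q y) \<Longrightarrow> AE z in \<gamma>. Q (snd z)"
proof -
  note [measurable_cong] = couplingsD(2)[OF \<gamma>]
  have m: "fst \<in> measurable \<gamma> borel" "snd \<in> measurable \<gamma> borel"
    by (rule measurable_fst_snd_borel[OF couplingsD(2)[OF \<gamma>]])+
  show "(AE x in \<rho>. P x) \<Longrightarrow> AE z in \<gamma>. P (fst z)"
    using AE_distrD[OF m(1), of P] unfolding couplingsD(3)[OF \<gamma>] .
  show "(AE y in \<mu>. Q y) \<Longrightarrow> AE z in \<gamma>. Q (snd z)"
    using AE_distrD[OF m(2), of Q] unfolding couplingsD(4)[OF \<gamma>] .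
qed

lemma inner_measurable_coupling:
  assumes \<gamma>: "\<gamma> \<in> couplings \<rho> \<mu>"
  shows "(\<lambda>z. fst z \<bullet> snd z) \<in> borel_measurable \<gamma>"
proof -
  have "(\<lambda>z::'a \<times> 'a. fst z \<bullet> snd z) \<in> borel_measurable borel"
    by (intro borel_measurable_continuous_onI continuous_intros)
  then show ?thesis by (simp cong: measurable_cong_sets add: couplingsD(2)[OF \<gamma>])
qed

text \<open>On \<open>S\<close> the product \<open>x \<bullet> y\<close> equals
  \<open>w x + legendre w y\<close>, so integrating against \<open>\<gamma>\<close> gives the dual
  cost. The delicate point is to split the integral: this needs integrability of each summand,
  obtained from that of the sum and from affine minorants. An infinite \<open>transport\<close>
  makes the claim trivial.\<close>

lemma monotone_coupling_dual:
  fixes \<rho> \<mu> :: "'a::euclidean_space measure"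
  assumes \<rho>: "\<rho> \<in> P1" and \<mu>: "\<mu> \<in> P1" and \<gamma>: "\<gamma> \<in> couplings \<rho> \<mu>"
    and S: "cyclically_monotone S" "AE z in \<gamma>. z \<in> S"
  shows "\<exists>w. admissible w \<and> dual_cost \<rho> \<mu> w \<le> transport \<rho> \<mu>"
proof -
  interpret \<gamma>: prob_space \<gamma> using couplingsD[OF \<gamma>] by simp
  have "S \<noteq> {}"
  proof
    assume "S = {}"
    with S(2) show False by simp
  qed
  then obtain w where w: "admissible w"
    and wS: "\<And>x y. (x, y) \<in> S \<Longrightarrow> \<bar>w x\<bar> \<noteq> \<infinity> \<and> legendre w y = ereal (x \<bullet> y) - w x"
    using rockafellar_potential[OF S(1)] by blast
  have [measurable]: "w \<in> borel_measurable borel" "legendre w \<in> borel_measurable borel"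
    using w by (auto simp: admissible_def intro: borel_measurable_lsc borel_measurable_legendre)
  obtain x0 y0 where z0: "(x0, y0) \<in> S" using \<open>S \<noteq> {}\<close> by auto
  then obtain r s where r: "w x0 = ereal r" and s: "legendre w y0 = ereal s"
    using wS[OF z0] by (cases "w x0") auto
  define h1 where "h1 = (\<lambda>x. y0 \<bullet> x + - s)"
  define h2 where "h2 = (\<lambda>y. x0 \<bullet> y + - r)"
  have [measurable]: "h1 \<in> borel_measurable borel" "h2 \<in> borel_measurable borel"
    unfolding h1_def h2_def by measurable
  have h: "integrable \<rho> h1" "integrable \<mu> h2"
    unfolding h1_def h2_def by (rule integrable_affine_P1[OF \<rho>] integrable_affine_P1[OF \<mu>])+
  have h1: "ereal (h1 x) \<le> w x" for x
    using legendre_ge[of x y0 w] w unfolding h1_def s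
    by (cases "w x") (auto simp: admissible_def inner_commute)
  have h2: "ereal (h2 y) \<le> legendre w y" for y
    using legendre_ge[of x0 y w] unfolding h2_def r by auto
  have h1int: "integrable \<gamma> (\<lambda>z. h1 (fst z))"
    using h coupling_integral_fst(1)[OF \<gamma>, of h1] by simp
  have hint: "integrable \<gamma> (\<lambda>z. h1 (fst z) + h2 (snd z))"
    using h h1int coupling_integral_snd(1)[OF \<gamma>, of h2] by simp
  have sum: "fst z \<bullet> snd z = real_of_ereal (w (fst z)) + real_of_ereal (legendre w (snd z))"
     "w (fst z) = ereal (real_of_ereal (w (fst z)))"
     "legendre w (snd z) = ereal (real_of_ereal (legendre w (snd z)))" if "z \<in> S" for z
  proof -
    have z: "(fst z, snd z) \<in> S" using that by simp
    define a where "a = real_of_ereal (w (fst z))"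
    have a: "w (fst z) = ereal a" unfolding a_def using wS[OF z] ereal_real' by metis
    have l: "legendre w (snd z) = ereal (fst z \<bullet> snd z - a)"
      using wS[OF z, THEN conjunct2] unfolding a by simp
    show "fst z \<bullet> snd z = real_of_ereal (w (fst z)) + real_of_ereal (legendre w (snd z))"
      unfolding a l by simp
    show "w (fst z) = ereal (real_of_ereal (w (fst z)))"
      unfolding a by simp
    show "legendre w (snd z) = ereal (real_of_ereal (legendre w (snd z)))"
      unfolding l by simp
  qed
  have ge: "AE z in \<gamma>. ereal (h1 (fst z) + h2 (snd z)) \<le> ereal (fst z \<bullet> snd z)"
    using S(2)
  proof eventually_elim
    case (elim z)
    then show ?case
      using sum[of z] h1[of "fst z"] h2[of "snd z"]
      by (metis add_mono ereal_less_eq(3))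
  qed
  show ?thesis
  proof (cases "transport \<rho> \<mu> = \<infinity>")
    case True
    then show ?thesis using w by auto
  next
    case False
    have im[measurable]: "(\<lambda>z. fst z \<bullet> snd z) \<in> borel_measurable \<gamma>"
      by (rule inner_measurable_coupling[OF \<gamma>])
    have "(\<integral>\<^sup>+z. e2ennreal (- ereal (fst z \<bullet> snd z)) \<partial>\<gamma>) \<le> (\<integral>\<^sup>+z. ennreal (- (h1 (fst z) + h2 (snd z))) \<partial>\<gamma>)"
      by (intro nn_integral_mono_AE, use ge in eventually_elim) (auto intro!: ennreal_leI)
    also have "\<dots> < \<infinity>"
      using hint by (simp add: real_integrable_def less_top)
    finally have mf: "ext_integral_meaningful \<gamma> (\<lambda>z. ereal (fst z \<bullet> snd z))"
      unfolding ext_integral_meaningful_def by simp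
    then have le: "ext_integral \<gamma> (\<lambda>z. ereal (fst z \<bullet> snd z)) \<le> transport \<rho> \<mu>"
      unfolding transport_def case_prod_beta using \<gamma> by (intro SUP_upper) auto
    with False have "integrable \<gamma> (\<lambda>z. real_of_ereal (ereal (fst z \<bullet> snd z)))"
      by (intro integrable_of_ext_integral(1)[OF _ _ hint ge]) (auto simp: less_top[symmetric])
    then have int: "integrable \<gamma> (\<lambda>z. fst z \<bullet> snd z)" by simp
    have ib: "integrable \<gamma> (\<lambda>z. fst z \<bullet> snd z - (h1 (fst z) + h2 (snd z)))"
      using int hint by (rule Bochner_Integration.integrable_diff)
    have [measurable_cong]: "sets \<gamma> = sets (borel \<Otimes>\<^sub>M borel)"
      unfolding borel_prod by (rule couplingsD(2)[OF \<gamma>])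
    \<comment> \<open>On \<open>S\<close>, \<open>w - h1\<close> is nonnegative and at most
      \<open>x \<bullet> y - (h1 + h2)\<close>, because \<open>legendre w - h2\<close> is
      nonnegative too.\<close>
    have "integrable \<gamma> (\<lambda>z. real_of_ereal (w (fst z)) - h1 (fst z))"
    proof (rule Bochner_Integration.integrable_bound[OF ib])
      show "AE z in \<gamma>. norm (real_of_ereal (w (fst z)) - h1 (fst z)) \<le> norm (fst z \<bullet> snd z - (h1 (fst z) + h2 (snd z)))"
        using S(2)
      proof eventually_elim
        case (elim z)
        have "h1 (fst z) \<le> real_of_ereal (w (fst z))" "h2 (snd z) \<le> real_of_ereal (legendre w (snd z))"
          using sum(2,3)[OF elim] h1[of "fst z"] h2[of "snd z"]
          by (metis ereal_less_eq(3))+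
        then show ?case using sum(1)[OF elim] by simp
      qed
    qed measurable
    from this h1int have "integrable \<gamma> (\<lambda>z. (real_of_ereal (w (fst z)) - h1 (fst z)) + h1 (fst z))"
      by (rule Bochner_Integration.integrable_add)
    then have ia: "integrable \<gamma> (\<lambda>z. real_of_ereal (w (fst z)))" by simp
    have "integrable \<gamma> (\<lambda>z. fst z \<bullet> snd z - real_of_ereal (w (fst z)))"
      using int ia by simp
    then have ib: "integrable \<gamma> (\<lambda>z. real_of_ereal (legendre w (snd z)))"
    proof (rule integrable_cong_AE_imp)
      show "AE z in \<gamma>. fst z \<bullet> snd z - real_of_ereal (w (fst z)) = real_of_ereal (legendre w (snd z))"
        using S(2) by eventually_elim (simp add: sum(1))
    qed measurable
    have ia': "integrable \<rho> (\<lambda>x. real_of_ereal (w x))"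
      using ia coupling_integral_fst(1)[OF \<gamma>, of "\<lambda>x. real_of_ereal (w x)"] by simp
    have ib': "integrable \<mu> (\<lambda>x. real_of_ereal (legendre w x))"
      using ib coupling_integral_snd(1)[OF \<gamma>, of "\<lambda>x. real_of_ereal (legendre w x)"] by simp
    have m: "fst \<in> measurable \<gamma> borel" "snd \<in> measurable \<gamma> borel" by auto
    have "AE x in distr \<gamma> borel fst. w x = ereal (real_of_ereal (w x))"
      by (subst AE_distr_iff[OF m(1)], measurable, use S(2) in eventually_elim) (rule sum(2))
    then have Aa: "AE x in \<rho>. w x = ereal (real_of_ereal (w x))"
      unfolding couplingsD(3)[OF \<gamma>] .
    have "AE x in distr \<gamma> borel snd. legendre w x = ereal (real_of_ereal (legendre w x))"
      by (subst AE_distr_iff[OF m(2)], measurable, use S(2) in eventually_elim) (rule sum(3))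
    then have Ab: "AE x in \<mu>. legendre w x = ereal (real_of_ereal (legendre w x))"
      unfolding couplingsD(4)[OF \<gamma>] .
    have "dual_cost \<rho> \<mu> w = ereal ((\<integral>x. real_of_ereal (w x) \<partial>\<rho>) + (\<integral>x. real_of_ereal (legendre w x) \<partial>\<mu>))"
      unfolding dual_cost_def ext_integral_real[OF ia' Aa] ext_integral_real[OF ib' Ab] by simp
    also have "(\<integral>x. real_of_ereal (w x) \<partial>\<rho>) + (\<integral>x. real_of_ereal (legendre w x) \<partial>\<mu>)
       = (\<integral>z. real_of_ereal (w (fst z)) \<partial>\<gamma>) + (\<integral>z. real_of_ereal (legendre w (snd z)) \<partial>\<gamma>)"
      using coupling_integral_fst(2)[OF \<gamma>, of "\<lambda>x. real_of_ereal (w x)"]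
        coupling_integral_snd(2)[OF \<gamma>, of "\<lambda>x. real_of_ereal (legendre w x)"] by simp
    also have "\<dots> = (\<integral>z. real_of_ereal (w (fst z)) + real_of_ereal (legendre w (snd z)) \<partial>\<gamma>)"
      using ia ib by simp
    also have "\<dots> = (\<integral>z. fst z \<bullet> snd z \<partial>\<gamma>)"
      by (intro integral_cong_AE, measurable, use S(2) in eventually_elim) (simp add: sum(1))
    also have "ereal \<dots> = ext_integral \<gamma> (\<lambda>z. ereal (fst z \<bullet> snd z))"
      by (rule ext_integral_real[symmetric, OF int]) simp
    finally show ?thesis using le w by auto
  qed
qed

text \<open>Weak duality for real functions \<open>a\<close> and \<open>b\<close>. The inequality is
  asked only on sets of full measure, since \<open>u\<close> and \<open>legendre u\<close> are
  real-valued only almost everywhere.\<close>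

lemma transport_le:
  fixes \<rho> \<mu> :: "'a::euclidean_space measure"
  assumes \<rho>: "sets \<rho> = sets borel" and \<mu>: "sets \<mu> = sets borel"
    and a: "integrable \<rho> a" and b: "integrable \<mu> b"
    and A: "AE x in \<rho>. x \<in> X" and B: "AE y in \<mu>. y \<in> Y"
    and le: "\<And>x y. x \<in> X \<Longrightarrow> y \<in> Y \<Longrightarrow> x \<bullet> y \<le> a x + b y"
  shows "transport \<rho> \<mu> \<le> ereal ((\<integral>x. a x \<partial>\<rho>) + (\<integral>y. b y \<partial>\<mu>))"
  unfolding transport_def case_prod_beta
proof (rule SUP_least, safe)
  fix \<gamma> assume \<gamma>: "\<gamma> \<in> couplings \<rho> \<mu>"
  have [measurable]: "a \<in> borel_measurable borel" "b \<in> borel_measurable borel"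
    using a b \<rho> \<mu> by (auto dest!: borel_measurable_integrable cong: measurable_cong_sets)
  have i: "integrable \<gamma> (\<lambda>z. a (fst z))" "integrable \<gamma> (\<lambda>z. b (snd z))"
    using a b coupling_integral_fst(1)[OF \<gamma>, of a] coupling_integral_snd(1)[OF \<gamma>, of b] by simp_all
  have "AE z in \<gamma>. fst z \<bullet> snd z \<le> a (fst z) + b (snd z)"
    using coupling_AE(1)[OF \<gamma> A] coupling_AE(2)[OF \<gamma> B] by eventually_elim (rule le)
  \<comment> \<open>Comparing positive and negative parts separately also covers infinite integrals
    of \<open>x \<bullet> y\<close>.\<close>
  then have le: "(\<integral>\<^sup>+z. e2ennreal (ereal (fst z \<bullet> snd z)) \<partial>\<gamma>) \<le> (\<integral>\<^sup>+z. e2ennreal (ereal (a (fst z) + b (snd z))) \<partial>\<gamma>)"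
     "(\<integral>\<^sup>+z. e2ennreal (- ereal (a (fst z) + b (snd z))) \<partial>\<gamma>) \<le> (\<integral>\<^sup>+z. e2ennreal (- ereal (fst z \<bullet> snd z)) \<partial>\<gamma>)"
    by (auto intro!: nn_integral_mono_AE ennreal_leI elim!: eventually_mono)
  have "ext_integral \<gamma> (\<lambda>z. ereal (fst z \<bullet> snd z)) \<le> ext_integral \<gamma> (\<lambda>z. ereal (a (fst z) + b (snd z)))"
    unfolding ext_integral_def using le by (intro ereal_minus_mono) (auto simp: less_eq_ennreal.rep_eq)
  also have "\<dots> = ereal (\<integral>z. a (fst z) + b (snd z) \<partial>\<gamma>)"
    using i by (intro ext_integral_real) auto
  also have "\<dots> = ereal ((\<integral>x. a x \<partial>\<rho>) + (\<integral>y. b y \<partial>\<mu>))"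
    using i coupling_integral_fst(2)[OF \<gamma>, of a] coupling_integral_snd(2)[OF \<gamma>, of b] by simp
  finally show "ext_integral \<gamma> (\<lambda>z. ereal (fst z \<bullet> snd z)) \<le> ereal ((\<integral>x. a x \<partial>\<rho>) + (\<integral>y. b y \<partial>\<mu>))" .
qed

text \<open>The order matters. A point where \<open>u\<close> is finite gives an affine minorant of
  \<open>legendre u\<close>, which is therefore finite \<open>\<mu>\<close>-almost everywhere; a
  point where it is finite then gives an affine minorant of \<open>u\<close>. As
  \<open>\<infinity> + (- \<infinity>) = \<infinity>\<close>, neither integral can be hidden by the
  other.\<close>

lemma dual_cost_finite:
  fixes \<rho> \<mu> :: "'a::euclidean_space measure"
  assumes \<rho>: "\<rho> \<in> P1" and \<mu>: "\<mu> \<in> P1" and u: "admissible u" and fin: "dual_cost \<rho> \<mu> u < \<infinity>"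
  shows "integrable \<rho> (\<lambda>x. real_of_ereal (u x))" "AE x in \<rho>. u x = ereal (real_of_ereal (u x))"
    "integrable \<mu> (\<lambda>y. real_of_ereal (legendre u y))" "AE y in \<mu>. legendre u y = ereal (real_of_ereal (legendre u y))"
    "dual_cost \<rho> \<mu> u = ereal ((\<integral>x. real_of_ereal (u x) \<partial>\<rho>) + (\<integral>y. real_of_ereal (legendre u y) \<partial>\<mu>))"
proof -
  interpret \<mu>: prob_space \<mu> using P1D[OF \<mu>] by simp
  note [measurable_cong] = P1D(2)[OF \<rho>] P1D(2)[OF \<mu>]
  have [measurable]: "u \<in> borel_measurable borel" "legendre u \<in> borel_measurable borel"
    using u by (auto simp: admissible_def intro: borel_measurable_lsc borel_measurable_legendre)
  obtain x0 r where r: "u x0 = ereal r"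
    using u unfolding admissible_def by (metis ereal_cases)
  have le2: "ereal (x0 \<bullet> y + - r) \<le> legendre u y" for y
    using legendre_ge[of x0 y u] by (simp add: r)
  have "ext_integral \<mu> (legendre u) < \<infinity>"
    using fin unfolding dual_cost_def by (cases "ext_integral \<mu> (legendre u)") auto
  note I2 = integrable_of_ext_integral[OF _ this integrable_affine_P1[OF \<mu>] AE_I2, OF _ le2]
  show b: "integrable \<mu> (\<lambda>y. real_of_ereal (legendre u y))" "AE y in \<mu>. legendre u y = ereal (real_of_ereal (legendre u y))"
    by (rule I2; measurable)+
  have e2: "ext_integral \<mu> (legendre u) = ereal (\<integral>y. real_of_ereal (legendre u y) \<partial>\<mu>)"
    by (rule ext_integral_real[OF b])
  have "\<exists>y. legendre u y = ereal (real_of_ereal (legendre u y))"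
  proof (rule ccontr)
    assume "\<not> ?thesis"
    then show False using b(2) by simp
  qed
  then obtain y0 s where s: "legendre u y0 = ereal s" by metis
  have le1: "ereal (y0 \<bullet> x + - s) \<le> u x" for x
    using legendre_ge[of x y0 u] u unfolding s
    by (cases "u x") (auto simp: admissible_def inner_commute)
  have "ext_integral \<rho> u < \<infinity>"
    using fin unfolding dual_cost_def e2 by (cases "ext_integral \<rho> u") auto
  note I1 = integrable_of_ext_integral[OF _ this integrable_affine_P1[OF \<rho>] AE_I2, OF _ le1]
  show a: "integrable \<rho> (\<lambda>x. real_of_ereal (u x))" "AE x in \<rho>. u x = ereal (real_of_ereal (u x))"
    by (rule I1; measurable)+
  show "dual_cost \<rho> \<mu> u = ereal ((\<integral>x. real_of_ereal (u x) \<partial>\<rho>) + (\<integral>y. real_of_ereal (legendre u y) \<partial>\<mu>))"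
    unfolding dual_cost_def e2 ext_integral_real[OF a] by simp
qed

section \<open>Existence of a cyclically monotone coupling\<close>

text \<open>Tychonoff's theorem, used twice: for plans between finitely supported laws, and, over
  the countable index set of bit lists, for a convergent subsequence of cell masses.\<close>

lemma compact_PiE_unit: "compact {a :: 'i \<Rightarrow> real. \<forall>z. a z \<in> {0..1}}"
proof -
  have "compactin (product_topology (\<lambda>i::'i. euclideanreal) UNIV) (PiE UNIV (\<lambda>_. {0..1}))"
    by (subst compactin_PiE) auto
  moreover have "PiE UNIV (\<lambda>_::'i. {0..1::real}) = {a. \<forall>z. a z \<in> {0..1}}"
    by (auto simp: PiE_def Pi_def)
  ultimately show ?thesis by (simp add: euclidean_product_topology)
qed

lemma sum_rotate:
  fixes f :: "nat \<Rightarrow> 'b::comm_monoid_add"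
  shows "(\<Sum>i\<le>N. f (if i = N then 0 else Suc i)) = (\<Sum>i\<le>N. f i)"
  by (rule sum.reindex_bij_witness[where i="\<lambda>i. if i = 0 then N else i - 1" and j="\<lambda>i. if i = N then 0 else Suc i"])
    auto

lemma sum_of_bool_inner:
  fixes f :: "'z \<Rightarrow> real"
  assumes "finite Z" "\<And>i. i \<in> I \<Longrightarrow> g i \<in> Z"
  shows "(\<Sum>z\<in>Z. (\<Sum>i\<in>I. of_bool (g i = z)) * f z) = (\<Sum>i\<in>I. f (g i))"
proof -
  have "(\<Sum>z\<in>Z. (\<Sum>i\<in>I. of_bool (g i = z)) * f z) = (\<Sum>i\<in>I. \<Sum>z\<in>Z. of_bool (g i = z) * f z)"
    by (subst sum.swap) (simp add: sum_distrib_right)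
  also have "\<dots> = (\<Sum>i\<in>I. f (g i))"
  proof (rule sum.cong[OF refl])
    fix i assume "i \<in> I"
    then have "g i \<in> Z" by (rule assms)
    have "(\<Sum>z\<in>Z. of_bool (g i = z) * f z) = (\<Sum>z\<in>Z. if g i = z then f z else 0)"
      by (intro sum.cong) auto
    then show "(\<Sum>z\<in>Z. of_bool (g i = z) * f z) = f (g i)"
      using \<open>g i \<in> Z\<close> assms(1) by simp
  qed
  finally show ?thesis .
qed

text \<open>Take a plan maximising the total of \<open>x \<bullet> y\<close> over the compact set of
  nonnegative matrices with the prescribed marginals. If a cycle in its support violated the
  inequality, moving a little mass from each pair to the pair with the next first coordinate would
  keep the marginals and raise the objective.\<close>

lemma cyclically_monotone_pmf_coupling:
  fixes p q :: "'a::real_inner pmf"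
  assumes fp: "finite (set_pmf p)" and fq: "finite (set_pmf q)"
  shows "\<exists>w. map_pmf fst w = p \<and> map_pmf snd w = q \<and> cyclically_monotone (set_pmf w)"
proof -
  define X where "X = set_pmf p"
  define Y where "Y = set_pmf q"
  have [simp]: "finite X" "finite Y" using fp fq by (auto simp: X_def Y_def)
  define K where "K = {a :: 'a \<times> 'a \<Rightarrow> real. (\<forall>z. 0 \<le> a z) \<and> (\<forall>z. z \<notin> X \<times> Y \<longrightarrow> a z = 0) \<and>
     (\<forall>x. (\<Sum>y\<in>Y. a (x, y)) = pmf p x) \<and> (\<forall>y. (\<Sum>x\<in>X. a (x, y)) = pmf q y)}"
  have cont: "continuous_on UNIV (\<lambda>a::'a \<times> 'a \<Rightarrow> real. a z)" for z
    by simp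
  have "closed K"
    unfolding K_def by (intro closed_Collect_conj closed_Collect_all closed_Collect_imp closed_Collect_le closed_Collect_eq
      continuous_intros cont open_Collect_const)
  moreover have "K \<subseteq> {a. \<forall>z. a z \<in> {0..1}}"
  proof safe
    fix a z assume a: "a \<in> K"
    show "a z \<in> {0..1}"
    proof (cases "z \<in> X \<times> Y")
      case True
      then have "a z \<le> (\<Sum>y\<in>Y. a (fst z, y))"
        using a member_le_sum[of "snd z" Y "\<lambda>y. a (fst z, y)"] by (auto simp: K_def)
      also have "\<dots> \<le> 1" using a by (simp add: K_def pmf_le_1)
      finally show ?thesis using a by (cases z) (simp add: K_def)
    next
      case False
      then show ?thesis using a by (cases z) (auto simp: K_def)
    qed
  qed
  ultimately have "compact K"
    using compact_Int_closed[OF compact_PiE_unit, of K] by (simp add: Int_absorb1)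
  moreover have "(\<lambda>z. pmf p (fst z) * pmf q (snd z)) \<in> K"
    unfolding K_def using sum_pmf_eq_1[OF \<open>finite X\<close>, of p] sum_pmf_eq_1[OF \<open>finite Y\<close>, of q]
    by (auto simp: X_def Y_def set_pmf_iff sum_distrib_left[symmetric] sum_distrib_right[symmetric])
  then have "K \<noteq> {}" by auto
  moreover define obj where "obj a = (\<Sum>z\<in>X \<times> Y. a z * (fst z \<bullet> snd z))" for a :: "'a \<times> 'a \<Rightarrow> real"
  have "continuous_on K obj"
    unfolding obj_def by (intro continuous_intros continuous_on_subset[OF cont]) auto
  ultimately obtain a where aK: "a \<in> K" and opt: "\<And>b. b \<in> K \<Longrightarrow> obj b \<le> obj a"
    using continuous_attains_sup by metis
  have a: "\<And>z. 0 \<le> a z" "\<And>z. z \<notin> X \<times> Y \<Longrightarrow> a z = 0"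
      "\<And>x. (\<Sum>y\<in>Y. a (x, y)) = pmf p x" "\<And>y. (\<Sum>x\<in>X. a (x, y)) = pmf q y"
    using aK by (auto simp: K_def)
  have "(\<integral>\<^sup>+z. ennreal (a z) \<partial>count_space UNIV) = (\<integral>\<^sup>+z. ennreal (a z) \<partial>count_space (X \<times> Y))"
    using a by (intro nn_integral_count_space_eq) auto
  also have "\<dots> = (\<Sum>z\<in>X \<times> Y. ennreal (a z))"
    by (simp add: nn_integral_count_space_finite)
  also have "\<dots> = ennreal (\<Sum>z\<in>X \<times> Y. a z)"
    using a by (intro sum_ennreal) auto
  also have "(\<Sum>z\<in>X \<times> Y. a z) = (\<Sum>x\<in>X. \<Sum>y\<in>Y. a (x, y))"
    by (simp add: sum.cartesian_product)
  also have "\<dots> = 1" using sum_pmf_eq_1[OF \<open>finite X\<close>, of p] by (simp add: a X_def)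
  finally have tot: "(\<integral>\<^sup>+z. ennreal (a z) \<partial>count_space UNIV) = 1" by simp
  have an: "x \<in> X" "y \<in> Y" if "a (x, y) \<noteq> 0" for x y
    using a(2)[of "(x, y)"] that by auto
  define w where "w = embed_pmf a"
  have pw: "pmf w z = a z" for z
    unfolding w_def using a(1) tot by (rule pmf_embed_pmf)
  have sw: "set_pmf w \<subseteq> X \<times> Y"
    using a(2) by (metis pw set_pmf_iff subsetI)
  have meas: "measure w A = (\<Sum>z\<in>A \<inter> X \<times> Y. a z)" for A
  proof -
    have "measure w A = measure w (A \<inter> X \<times> Y)"
      using sw by (metis Int_absorb1 Int_assoc inf_commute measure_Int_set_pmf)
    then show ?thesis by (simp add: measure_measure_pmf_finite pw)
  qed
  have "map_pmf fst w = p"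
  proof (rule pmf_eqI)
    fix x
    have "pmf (map_pmf fst w) x = (\<Sum>z\<in>fst -` {x} \<inter> X \<times> Y. a z)"
      by (simp add: pmf_map meas)
    also have "\<dots> = (\<Sum>z\<in>{x} \<times> Y. a z)"
      by (intro sum.mono_neutral_left) (auto dest: an)
    also have "\<dots> = (\<Sum>y\<in>Y. a (x, y))"
      using sum.cartesian_product[of "\<lambda>x y. a (x, y)" Y "{x}"] by simp
    finally show "pmf (map_pmf fst w) x = pmf p x" by (simp add: a)
  qed
  moreover have "map_pmf snd w = q"
  proof (rule pmf_eqI)
    fix y
    have "pmf (map_pmf snd w) y = (\<Sum>z\<in>snd -` {y} \<inter> X \<times> Y. a z)"
      by (simp add: pmf_map meas)
    also have "\<dots> = (\<Sum>z\<in>X \<times> {y}. a z)"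
      by (intro sum.mono_neutral_left) (auto dest: an)
    also have "\<dots> = (\<Sum>x\<in>X. a (x, y))"
      using sum.cartesian_product[of "\<lambda>x y. a (x, y)" "{y}" X] by simp
    finally show "pmf (map_pmf snd w) y = pmf q y" by (simp add: a)
  qed
  moreover have "cyclically_monotone (set_pmf w)"
    unfolding cyclically_monotone_def
  proof (intro allI impI)
    fix N and z :: "nat \<Rightarrow> 'a \<times> 'a"
    assume z: "\<forall>i\<le>N. z i \<in> set_pmf w"
    define s where "s i = (if i = N then 0 else Suc i)" for i
    define z' where "z' i = (fst (z (s i)), snd (z i))" for i
    have s: "s i \<le> N" if "i \<le> N" for i using that by (auto simp: s_def)
    have zXY: "z i \<in> X \<times> Y" if "i \<le> N" for i using z that sw by auto
    have z'XY: "z' i \<in> X \<times> Y" if "i \<le> N" for i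
      using zXY[OF that] zXY[OF s[OF that]] by (auto simp: z'_def mem_Times_iff)
    \<comment> \<open>A cycle may visit the same pair up to \<open>N + 1\<close> times; the divisor
      keeps the total removed mass below the mass present.\<close>
    define \<epsilon> where "\<epsilon> = Min ((\<lambda>i. a (z i)) ` {..N}) / (real N + 1)"
    have "Min ((\<lambda>i. a (z i)) ` {..N}) > 0"
      using z a(1) by (subst Min_gr_iff) (auto simp: set_pmf_iff pw less_le)
    then have \<epsilon>: "\<epsilon> > 0" by (simp add: \<epsilon>_def)
    have \<epsilon>le: "\<epsilon> * (real N + 1) \<le> a (z i)" if "i \<le> N" for i
      using that by (simp add: \<epsilon>_def)
    \<comment> \<open>\<open>c\<close> counts how often the cycle removes mass at a pair and
      \<open>d\<close> how often it adds mass there.\<close>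
    define c where "c v = (\<Sum>i\<le>N. of_bool (z i = v) :: real)" for v
    define d where "d v = (\<Sum>i\<le>N. of_bool (z' i = v) :: real)" for v
    define b where "b v = a v - \<epsilon> * c v + \<epsilon> * d v" for v
    have d0: "0 \<le> d v" for v unfolding d_def by (intro sum_nonneg) auto
    have ca: "\<epsilon> * c v \<le> a v" for v
    proof (cases "\<exists>i\<le>N. z i = v")
      case True
      then obtain i where i: "i \<le> N" "z i = v" by auto
      have "c v \<le> (\<Sum>i\<le>N. 1)" unfolding c_def by (intro sum_mono) auto
      then have "\<epsilon> * c v \<le> \<epsilon> * (real N + 1)"
        using \<epsilon> by (intro mult_left_mono) (auto simp: algebra_simps)
      then show ?thesis using \<epsilon>le[OF i(1)] i(2) by simp
    next
      case False
      then have "c v = 0" by (auto simp: c_def)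
      then show ?thesis using a by simp
    qed
    have "b \<in> K"
      unfolding K_def
    proof (intro CollectI conjI allI impI)
      fix v show "0 \<le> b v" using ca[of v] d0[of v] \<epsilon> by (simp add: b_def)
    next
      fix v assume v: "v \<notin> X \<times> Y"
      then have "c v = 0" "d v = 0"
        unfolding c_def d_def using zXY z'XY by (auto intro!: sum.neutral)
      then show "b v = 0" using a(2)[OF v] by (simp add: b_def)
    next
      fix x :: 'a
      have inner: "(\<Sum>y\<in>Y. of_bool (g = (x, y))) = (of_bool (fst g = x) :: real)" if "snd g \<in> Y" for g
      proof -
        have "(\<Sum>y\<in>Y. of_bool (g = (x, y))) = (\<Sum>y\<in>Y. if snd g = y then of_bool (fst g = x) else (0::real))"
          by (intro sum.cong) (auto simp: prod_eq_iff)
        then show ?thesis using that by simp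
      qed
      \<comment> \<open>The shift only permutes first coordinates cyclically and leaves second
        coordinates alone, so removed and added mass agree in every row and column.\<close>
      have "(\<Sum>y\<in>Y. c (x, y)) = (\<Sum>i\<le>N. of_bool (fst (z i) = x))"
        unfolding c_def by (subst sum.swap, rule sum.cong[OF refl], rule inner) (use zXY in \<open>auto simp: mem_Times_iff\<close>)
      also have "\<dots> = (\<Sum>i\<le>N. of_bool (fst (z (s i)) = x))"
        unfolding s_def by (rule sum_rotate[of "\<lambda>i. of_bool (fst (z i) = x)", symmetric])
      also have "\<dots> = (\<Sum>i\<le>N. of_bool (fst (z' i) = x))" by (simp add: z'_def)
      also have "\<dots> = (\<Sum>y\<in>Y. d (x, y))"
        unfolding d_def by (subst sum.swap, rule sum.cong[OF refl], rule inner[symmetric]) (use z'XY in \<open>auto simp: mem_Times_iff\<close>)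
      finally show "(\<Sum>y\<in>Y. b (x, y)) = pmf p x"
        by (simp add: b_def sum.distrib sum_subtractf a sum_distrib_left[symmetric])
    next
      fix y :: 'a
      have inner: "(\<Sum>x\<in>X. of_bool (g = (x, y))) = (of_bool (snd g = y) :: real)" if "fst g \<in> X" for g
      proof -
        have "(\<Sum>x\<in>X. of_bool (g = (x, y))) = (\<Sum>x\<in>X. if fst g = x then of_bool (snd g = y) else (0::real))"
          by (intro sum.cong) (auto simp: prod_eq_iff)
        then show ?thesis using that by simp
      qed
      have "(\<Sum>x\<in>X. c (x, y)) = (\<Sum>i\<le>N. of_bool (snd (z i) = y))"
        unfolding c_def by (subst sum.swap, rule sum.cong[OF refl], rule inner) (use zXY in \<open>auto simp: mem_Times_iff\<close>)
      also have "\<dots> = (\<Sum>i\<le>N. of_bool (snd (z' i) = y))" by (simp add: z'_def)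
      also have "\<dots> = (\<Sum>x\<in>X. d (x, y))"
        unfolding d_def by (subst sum.swap, rule sum.cong[OF refl], rule inner[symmetric]) (use z'XY in \<open>auto simp: mem_Times_iff\<close>)
      finally show "(\<Sum>x\<in>X. b (x, y)) = pmf q y"
        by (simp add: b_def sum.distrib sum_subtractf a sum_distrib_left[symmetric])
    qed
    then have 1: "obj b \<le> obj a" by (rule opt)
    have 2: "obj b = obj a - \<epsilon> * (\<Sum>v\<in>X \<times> Y. c v * (fst v \<bullet> snd v)) + \<epsilon> * (\<Sum>v\<in>X \<times> Y. d v * (fst v \<bullet> snd v))"
      unfolding obj_def b_def by (simp add: algebra_simps sum.distrib sum_subtractf sum_distrib_left)
    have 3: "(\<Sum>v\<in>X \<times> Y. c v * (fst v \<bullet> snd v)) = (\<Sum>i\<le>N. fst (z i) \<bullet> snd (z i))"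
      unfolding c_def by (rule sum_of_bool_inner) (use zXY in auto)
    have 4: "(\<Sum>v\<in>X \<times> Y. d v * (fst v \<bullet> snd v)) = (\<Sum>i\<le>N. fst (z' i) \<bullet> snd (z' i))"
      unfolding d_def by (rule sum_of_bool_inner) (use z'XY in auto)
    have "\<epsilon> * (\<Sum>i\<le>N. fst (z' i) \<bullet> snd (z' i)) \<le> \<epsilon> * (\<Sum>i\<le>N. fst (z i) \<bullet> snd (z i))"
      using 1 unfolding 2 3 4 by linarith
    then have "(\<Sum>i\<le>N. fst (z' i) \<bullet> snd (z' i)) \<le> (\<Sum>i\<le>N. fst (z i) \<bullet> snd (z i))"
      using \<epsilon> by simp
    then show "(\<Sum>i\<le>N. snd (z i) \<bullet> (fst (z (if i = N then 0 else Suc i)) - fst (z i))) \<le> 0"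
      by (simp add: z'_def s_def inner_diff_right sum_subtractf inner_commute)
  qed
  ultimately show ?thesis by blast
qed

text \<open>A consistent family of weights on the binary tree is realised on \<open>[0, 1)\<close> with Lebesgue
  measure: every node \<open>l\<close> owns a half-open interval of length \<open>m l\<close>, and the bits of \<open>t\<close> are read
  off from the branch of intervals containing \<open>t\<close>.\<close>

lemma binary_tree_realisation:
  fixes m :: "bool list \<Rightarrow> real"
  assumes m0: "\<And>l. 0 \<le> m l" and m1: "m [] = 1"
    and madd: "\<And>l. m l = m (l @ [False]) + m (l @ [True])"
  shows "\<exists>b :: real \<Rightarrow> nat \<Rightarrow> bool. \<forall>l. {t \<in> {0..<1}. map (b t) [0..<length l] = l} \<in> sets borel \<and>
    emeasure lborel {t \<in> {0..<1}. map (b t) [0..<length l] = l} = ennreal (m l)"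
proof -
  \<comment> \<open>Left endpoint of the interval of \<open>l\<close>: each right turn along
    \<open>l\<close> skips the interval of the left sibling.\<close>
  define s where "s l = (\<Sum>i<length l. if l ! i then m (take i l @ [False]) else 0)" for l
  have s_snoc: "s (l @ [c]) = s l + (if c then m (l @ [False]) else 0)" for l c
    unfolding s_def by (auto simp: nth_append intro!: sum.cong)
  \<comment> \<open>\<open>P t n\<close> is the branch followed by \<open>t\<close> through the
    first \<open>n\<close> levels: at each node, turn left exactly when \<open>t\<close> lies before
    the end of the left child's interval.\<close>
  define P :: "real \<Rightarrow> nat \<Rightarrow> bool list"
    where "P t = rec_nat [] (\<lambda>_ l. l @ [\<not> t < s l + m (l @ [False])])" for t
  have P0: "P t 0 = []" and PS: "P t (Suc n) = P t n @ [\<not> t < s (P t n) + m (P t n @ [False])]" for t n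
    unfolding P_def by simp_all
  have len: "length (P t n) = n" for t n
    by (induction n) (simp_all add: P0 PS)
  have iff: "P t (length l) = l \<longleftrightarrow> s l \<le> t \<and> t < s l + m l" if t: "t \<in> {0..<1}" for t l
  proof (induction l rule: rev_induct)
    case Nil
    then show ?case using t by (simp add: P0 s_def m1)
  next
    case (snoc c l)
    have "P t (length (l @ [c])) = l @ [c] \<longleftrightarrow> P t (length l) = l \<and> c = (\<not> t < s l + m (l @ [False]))"
      by (auto simp: PS)
    also have "\<dots> \<longleftrightarrow> s (l @ [c]) \<le> t \<and> t < s (l @ [c]) + m (l @ [c])"
      unfolding snoc s_snoc using madd[of l] m0[of "l @ [False]"] m0[of "l @ [True]"]
      by (cases c) auto
    finally show ?case .
  qed
  have "s l \<ge> 0 \<and> s l + m l \<le> 1" for l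
  proof (induction l rule: rev_induct)
    case Nil
    then show ?case by (simp add: s_def m1)
  next
    case (snoc c l)
    then show ?case
      unfolding s_snoc using madd[of l] m0[of "l @ [False]"] m0[of "l @ [True]"] by (cases c) auto
  qed
  then have s01: "s l \<ge> 0" "s l + m l \<le> 1" for l by auto
  define b where "b t i = P t (Suc i) ! i" for t i
  have b: "map (b t) [0..<n] = P t n" for t n
  proof (induction n)
    case 0
    then show ?case by (simp add: P0)
  next
    case (Suc n)
    then show ?case by (simp add: b_def PS len nth_append)
  qed
  have set: "{t \<in> {0..<1}. map (b t) [0..<length l] = l} = {s l..<s l + m l}" for l
    using iff[of _ l] s01[of l] by (auto simp: b)
  show ?thesis
    by (intro exI[of _ b] allI conjI, unfold set) (use m0 in auto)
qed

section \<open>Coding points by bit sequences\<close>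

lemma measurable_map_upt:
  assumes "\<And>i. f i \<in> measurable M (count_space (UNIV :: bool set))"
  shows "(\<lambda>x. map (\<lambda>i. f i x) [0..<n]) \<in> measurable M (count_space UNIV)"
proof (induction n)
  case (Suc n)
  have "(\<lambda>x. map (\<lambda>i. f i x) [0..<n] @ [f n x]) \<in> measurable M (count_space UNIV)"
    by (rule measurable_compose_countable[OF _ Suc.IH, where f="\<lambda>l x. l @ [f n x]"])
      (rule measurable_compose[OF assms], simp)
  then show ?case by simp
qed simp

lemma countable_base_sequence:
  obtains B :: "nat \<Rightarrow> 'a::second_countable_topology set"
  where "\<And>i. open (B i)" "\<And>U x. open U \<Longrightarrow> x \<in> U \<Longrightarrow> \<exists>i. x \<in> B i \<and> B i \<subseteq> U"
proof -
  obtain \<B> :: "'a set set" where \<B>: "countable \<B>" "topological_basis \<B>"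
    using ex_countable_basis by blast
  have ne: "\<B> \<noteq> {}"
    using topological_basisE[OF \<B>(2) open_UNIV UNIV_I] by blast
  show thesis
  proof (rule that)
    show "open (from_nat_into \<B> i)" for i
      using from_nat_into[OF ne] \<B>(2) topological_basis_open by blast
    fix U :: "'a set" and x assume "open U" "x \<in> U"
    from topological_basisE[OF \<B>(2) this] obtain V where "V \<in> \<B>" "x \<in> V" "V \<subseteq> U" by blast
    then show "\<exists>i. x \<in> from_nat_into \<B> i \<and> from_nat_into \<B> i \<subseteq> U"
      using from_nat_into_surj[OF \<B>(1)] by metis
  qed
qed

text \<open>A point is coded by the base sets that contain it. \<open>rep l\<close> picks a point whose code
  starts with \<open>l\<close> (an arbitrary point if there is none).\<close>

locale base_coding =
  fixes B :: "nat \<Rightarrow> 'a::euclidean_space set"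
  assumes open_B: "\<And>i. open (B i)"
    and base: "\<And>U x. open U \<Longrightarrow> x \<in> U \<Longrightarrow> \<exists>i. x \<in> B i \<and> B i \<subseteq> U"
begin

definition code :: "'a \<Rightarrow> nat \<Rightarrow> bool" where
  "code x i \<longleftrightarrow> x \<in> B i"

definition rep :: "bool list \<Rightarrow> 'a" where
  "rep l = (SOME x. map (code x) [0..<length l] = l)"

text \<open>A left inverse of \<open>code\<close>, defined on all sequences so that it can be
  composed with random bits. On sequences that are not codes the value is arbitrary, but
  measurability still holds.\<close>

definition decode :: "(nat \<Rightarrow> bool) \<Rightarrow> 'a" where
  "decode s = lim (\<lambda>n. rep (map s [0..<n]))"

lemma map_upt_eqD: "map f [0..<n] = map g [0..<n] \<Longrightarrow> i < n \<Longrightarrow> f i = g i"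
  by (metis add_cancel_left_left diff_zero length_upt nth_map nth_upt)

lemma rep_code: "map (code (rep (map (code x) [0..<n]))) [0..<n] = map (code x) [0..<n]"
proof -
  have "\<exists>y. map (code y) [0..<length (map (code x) [0..<n])] = map (code x) [0..<n]"
    by (intro exI[of _ x]) simp
  from someI_ex[OF this] show ?thesis unfolding rep_def by simp
qed

text \<open>Every neighbourhood of \<open>x\<close> contains some \<open>B i\<close> around
  \<open>x\<close>, and agreement of bit \<open>i\<close> puts \<open>f n\<close> into that
  \<open>B i\<close> from \<open>n > i\<close> on.\<close>

lemma tendsto_of_codes:
  assumes "\<And>n i. i < n \<Longrightarrow> code (f n) i = code x i"
  shows "f \<longlonglongrightarrow> x"
proof (rule topological_tendstoI)
  fix U assume "open U" "x \<in> U"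
  then obtain i where i: "x \<in> B i" "B i \<subseteq> U" using base by blast
  have "f n \<in> U" if "n > i" for n
    using assms[OF that] i by (auto simp: code_def)
  then show "\<forall>\<^sub>F n in sequentially. f n \<in> U"
    by (rule eventually_mono[OF eventually_gt_at_top[of i]])
qed

lemma decode_code: "decode (code x) = x"
  unfolding decode_def
  by (intro limI tendsto_of_codes map_upt_eqD[OF rep_code])

lemma measurable_code [measurable]: "(\<lambda>x. code x i) \<in> measurable borel (count_space UNIV)"
  unfolding code_def using open_B[of i] by (simp add: pred_def)

lemma measurable_code_list: "(\<lambda>x. map (code x) [0..<n]) \<in> measurable borel (count_space UNIV)"
  using measurable_map_upt[of "\<lambda>i x. code x i" borel n] by simp

lemma measurable_code_PiM: "code \<in> measurable borel (PiM UNIV (\<lambda>_. count_space UNIV))"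
proof -
  have "(\<lambda>x i. code x i) \<in> measurable borel (PiM UNIV (\<lambda>_. count_space UNIV))"
    by (rule measurable_PiM_single') auto
  then show ?thesis by simp
qed

lemma measurable_decode: "decode \<in> borel_measurable (PiM UNIV (\<lambda>_. count_space UNIV))"
proof -
  have "(\<lambda>s. map s [0..<n]) \<in> measurable (PiM UNIV (\<lambda>_::nat. count_space (UNIV::bool set))) (count_space UNIV)" for n
    using measurable_map_upt[of "\<lambda>i s. s i" "PiM UNIV (\<lambda>_::nat. count_space (UNIV::bool set))" n] by simp
  then have "(\<lambda>s. rep (map s [0..<n])) \<in> borel_measurable (PiM UNIV (\<lambda>_. count_space UNIV))" for n
    by (rule measurable_compose) simp
  then have "(\<lambda>s. lim (\<lambda>n. rep (map s [0..<n]))) \<in> borel_measurable (PiM UNIV (\<lambda>_. count_space UNIV))"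
    by (rule borel_measurable_lim_metric)
  then show ?thesis by (simp add: decode_def[abs_def])
qed

text \<open>A cylinder over a finite \<open>J\<close> depends only on the bits below some
  \<open>n\<close>, and the law of the length-\<open>n\<close> prefix lives on a countable space,
  where equality may be tested on single lists.\<close>

lemma distr_sequence_eqI:
  fixes f :: "'b \<Rightarrow> nat \<Rightarrow> bool" and g :: "'c \<Rightarrow> nat \<Rightarrow> bool"
  assumes "prob_space M"
    and f: "f \<in> measurable M (PiM UNIV (\<lambda>_. count_space UNIV))"
    and g: "g \<in> measurable N (PiM UNIV (\<lambda>_. count_space UNIV))"
    and eq: "\<And>l. emeasure M {x\<in>space M. map (f x) [0..<length l] = l} =
      emeasure N {x\<in>space N. map (g x) [0..<length l] = l}"
  shows "distr M (PiM UNIV (\<lambda>_. count_space UNIV)) f = distr N (PiM UNIV (\<lambda>_. count_space UNIV)) g"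
proof (rule measure_eqI_PiM_infinite)
  interpret prob_space M by fact
  show "finite_measure (distr M (PiM UNIV (\<lambda>_. count_space UNIV)) f)"
    using f prob_space.finite_measure prob_space_distr by blast
  fix A :: "nat \<Rightarrow> bool set" and J :: "nat set" assume J: "finite J"
  \<comment> \<open>Inserting 0 keeps \<open>Max\<close> meaningful when \<open>J\<close> is
    empty.\<close>
  define n where "n = Suc (Max (insert 0 J))"
  have n: "j < n" if "j \<in> J" for j
    using J that by (auto simp: n_def less_Suc_eq_le)
  define \<Omega> where "\<Omega> = {l. length l = n \<and> (\<forall>j\<in>J. l ! j \<in> A j)}"
  have emb: "prod_emb UNIV (\<lambda>_. count_space UNIV) J (Pi\<^sub>E J A) = {s. map s [0..<n] \<in> \<Omega>}"
    using n by (auto simp: prod_emb_def \<Omega>_def PiE_iff)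
  have law: "distr M (count_space UNIV) (\<lambda>x. map (f x) [0..<n]) = distr N (count_space UNIV) (\<lambda>x. map (g x) [0..<n])"
    (is "?L = ?R")
  proof (rule measure_eqI_countable)
    fix l :: "bool list"
    have mf: "(\<lambda>x. map (f x) [0..<n]) \<in> measurable M (count_space UNIV)"
      by (rule measurable_map_upt[of "\<lambda>i x. f x i"]) (use f in measurable)
    have mg: "(\<lambda>x. map (g x) [0..<n]) \<in> measurable N (count_space UNIV)"
      by (rule measurable_map_upt[of "\<lambda>i x. g x i"]) (use g in measurable)
    show "emeasure ?L {l} = emeasure ?R {l}"
    proof (cases "length l = n")
      case True
      then show ?thesis
        using eq[of l] by (simp add: emeasure_distr[OF mf] emeasure_distr[OF mg] vimage_def Int_def conj_commute)
    next
      case False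
      then have "(\<lambda>x. map (f x) [0..<n]) -` {l} = {}" "(\<lambda>x. map (g x) [0..<n]) -` {l} = {}" by auto
      then show ?thesis by (simp add: emeasure_distr[OF mf] emeasure_distr[OF mg])
    qed
  qed auto
  have mf: "(\<lambda>x. map (f x) [0..<n]) \<in> measurable M (count_space UNIV)"
    by (rule measurable_map_upt[of "\<lambda>i x. f x i"]) (use f in measurable)
  have mg: "(\<lambda>x. map (g x) [0..<n]) \<in> measurable N (count_space UNIV)"
    by (rule measurable_map_upt[of "\<lambda>i x. g x i"]) (use g in measurable)
  have ms: "{s. map s [0..<n] \<in> \<Omega>} \<in> sets (PiM UNIV (\<lambda>_. count_space UNIV))"
    unfolding emb[symmetric] using J by (intro sets_PiM_I) auto
  show "emeasure (distr M (PiM UNIV (\<lambda>_. count_space UNIV)) f) (prod_emb UNIV (\<lambda>_. count_space UNIV) J (Pi\<^sub>E J A)) =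
    emeasure (distr N (PiM UNIV (\<lambda>_. count_space UNIV)) g) (prod_emb UNIV (\<lambda>_. count_space UNIV) J (Pi\<^sub>E J A))"
    using arg_cong[OF law, of "\<lambda>M. emeasure M \<Omega>"] unfolding emb
    by (simp add: emeasure_distr[OF f ms] emeasure_distr[OF g ms] emeasure_distr[OF mf] emeasure_distr[OF mg] vimage_def)
qed auto

end

lemma measurable_from_borel:
  assumes "sets M = sets borel" "f \<in> measurable borel N"
  shows "f \<in> measurable M N"
  using assms measurable_cong_sets by blast

text \<open>Rounding each point to the representative of its depth-\<open>n\<close> cell pushes
  \<open>\<rho>\<close> to a law with finitely many atoms, which the finite optimal transport result
  can handle.\<close>

lemma (in base_coding) rep_law:
  assumes "prob_space \<rho>" and s: "sets \<rho> = sets borel"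
  shows "\<exists>p. finite (set_pmf p) \<and> (\<forall>D. measure p D = measure \<rho> {x. rep (map (code x) [0..<n]) \<in> D})"
proof -
  interpret prob_space \<rho> by fact
  have sp: "space \<rho> = UNIV" using sets_eq_imp_space_eq[OF s] by simp
  define f where "f x = rep (map (code x) [0..<n])" for x
  have f[measurable]: "f \<in> measurable \<rho> (count_space UNIV)"
    unfolding f_def
    by (rule measurable_compose[OF measurable_from_borel[OF s measurable_code_list]]) simp
  define D0 where "D0 = rep ` {l. length l = n}"
  have fin: "finite D0"
    unfolding D0_def using finite_lists_length_eq[of "UNIV :: bool set" n] by simp
  have fD0: "f x \<in> D0" for x
    unfolding f_def D0_def by (intro imageI) simp
  define M where "M = distr \<rho> (count_space UNIV) f"
  have Mm: "measure M D = measure \<rho> {x. f x \<in> D}" for D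
    unfolding M_def by (simp add: measure_distr[OF f] vimage_def sp)
  interpret M: prob_space M unfolding M_def by (rule prob_space_distr[OF f])
  \<comment> \<open>The invariant of type \<open>pmf\<close>: almost every point is an atom. It
    holds because \<open>f\<close> has finite range.\<close>
  have "AE x in \<rho>. \<forall>y\<in>D0. measure M {y} = 0 \<longrightarrow> f x \<noteq> y"
  proof (rule AE_finite_allI[OF fin])
    fix y
    show "AE x in \<rho>. measure M {y} = 0 \<longrightarrow> f x \<noteq> y"
    proof (cases "measure M {y} = 0")
      case True
      then have "emeasure \<rho> {x. f x = y} = 0"
        by (simp add: Mm emeasure_eq_measure)
      moreover have "{x. f x = y} \<in> sets \<rho>"
        using measurable_sets[OF f, of "{y}"] by (simp add: vimage_def sp)
      ultimately show ?thesis
        by (intro AE_I'[of "{x. f x = y}"]) (auto simp: null_sets_def)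
    qed simp
  qed
  then have "AE x in \<rho>. measure M {f x} \<noteq> 0"
    by eventually_elim (use fD0 in auto)
  then have "AE x in distr \<rho> (count_space UNIV) f. measure M {x} \<noteq> 0"
    by (subst AE_distr_iff[OF f]) auto
  then have "AE x in M. measure M {x} \<noteq> 0"
    unfolding M_def .
  moreover have "sets M = UNIV" by (simp add: M_def)
  ultimately have "M \<in> {M. prob_space M \<and> sets M = UNIV \<and> (AE x in M. measure M {x} \<noteq> 0)}"
    using M.prob_space_axioms by blast
  then have p: "measure_pmf (Abs_pmf M) = M"
    by (rule Abs_pmf_inverse)
  have "set_pmf (Abs_pmf M) \<subseteq> D0"
  proof
    fix y assume "y \<in> set_pmf (Abs_pmf M)"
    then have "measure M {y} \<noteq> 0"
      by (simp add: set_pmf.rep_eq p)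
    then have "\<exists>x. f x = y" unfolding Mm by (rule contrapos_np) simp
    then show "y \<in> D0" using fD0 by auto
  qed
  then show ?thesis
    using fin by (intro exI[of _ "Abs_pmf M"]) (auto simp: p Mm f_def intro: finite_subset)
qed

text \<open>Convergence is asked only for the masses of countably many code cells. Additivity over
  subcells passes to the limit, so the limiting masses are the law of a random bit sequence, which
  is decoded into a pair of points. The marginals come out exactly, since rounding at depth
  \<open>k\<close> does not alter the first \<open>k\<close> bits.\<close>

theorem monotone_coupling_exists:
  fixes \<rho> \<mu> :: "'a::euclidean_space measure"
  assumes \<rho>: "prob_space \<rho>" "sets \<rho> = sets borel" and \<mu>: "prob_space \<mu>" "sets \<mu> = sets borel"
  shows "\<exists>\<gamma> S. \<gamma> \<in> couplings \<rho> \<mu> \<and> cyclically_monotone S \<and> (AE z in \<gamma>. z \<in> S)"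
proof -
  obtain B :: "nat \<Rightarrow> 'a set" where B: "\<And>i. open (B i)" "\<And>U x. open U \<Longrightarrow> x \<in> U \<Longrightarrow> \<exists>i. x \<in> B i \<and> B i \<subseteq> U"
    using countable_base_sequence by blast
  interpret base_coding B by standard (use B in auto)
  have sp: "space \<rho> = UNIV" "space \<mu> = UNIV"
    using sets_eq_imp_space_eq[OF \<rho>(2)] sets_eq_imp_space_eq[OF \<mu>(2)] by simp_all
  have "\<forall>k. \<exists>p. finite (set_pmf p) \<and> (\<forall>D. measure p D = measure \<rho> {x. rep (map (code x) [0..<k]) \<in> D})"
    using rep_law[OF \<rho>] by blast
  then obtain p where p: "\<And>k. finite (set_pmf (p k))"
    "\<And>k D. measure (p k) D = measure \<rho> {x. rep (map (code x) [0..<k]) \<in> D}" by metis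
  have "\<forall>k. \<exists>p. finite (set_pmf p) \<and> (\<forall>D. measure p D = measure \<mu> {x. rep (map (code x) [0..<k]) \<in> D})"
    using rep_law[OF \<mu>] by blast
  then obtain q where q: "\<And>k. finite (set_pmf (q k))"
    "\<And>k D. measure (q k) D = measure \<mu> {x. rep (map (code x) [0..<k]) \<in> D}" by metis
  have "\<forall>k. \<exists>w. map_pmf fst w = p k \<and> map_pmf snd w = q k \<and> cyclically_monotone (set_pmf w)"
    using cyclically_monotone_pmf_coupling p(1) q(1) by blast
  then obtain w where w: "\<And>k. map_pmf fst (w k) = p k" "\<And>k. map_pmf snd (w k) = q k"
    "\<And>k. cyclically_monotone (set_pmf (w k))" by metis
  have wfst: "measure (w k) {z. fst z \<in> D} = measure \<rho> {x. rep (map (code x) [0..<k]) \<in> D}" for k D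
    unfolding p(2)[symmetric] w(1)[symmetric] by (simp add: vimage_def)
  have wsnd: "measure (w k) {z. snd z \<in> D} = measure \<mu> {x. rep (map (code x) [0..<k]) \<in> D}" for k D
    unfolding q(2)[symmetric] w(2)[symmetric] by (simp add: vimage_def)
  \<comment> \<open>The codes of both coordinates are interleaved, even positions for the first and
    odd ones for the second, so that a single binary tree describes pairs.\<close>
  define cc where "cc z i = (if even i then code (fst z) (i div 2) else code (snd z) (i div 2))" for z :: "'a \<times> 'a" and i :: nat
  have cc0: "cc z (2 * i) = code (fst z) i" and cc1: "cc z (2 * i + 1) = code (snd z) i" for z i
    by (simp_all add: cc_def)
  define Mk where "Mk k l = measure (w k) {z. map (cc z) [0..<length l] = l}" for k l
  have "seq_compact {a :: bool list \<Rightarrow> real. \<forall>z. a z \<in> {0..1}}"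
    by (rule compact_imp_seq_compact[OF compact_PiE_unit])
  moreover have "\<forall>k. Mk k \<in> {a :: bool list \<Rightarrow> real. \<forall>z. a z \<in> {0..1}}"
    by (simp add: Mk_def)
  ultimately obtain m \<phi> where m01: "\<And>l. m l \<in> {0..1}" and \<phi>: "strict_mono (\<phi> :: nat \<Rightarrow> nat)" and "(Mk \<circ> \<phi>) \<longlonglongrightarrow> m"
    by (elim seq_compactE) auto
  have lim: "(\<lambda>k. Mk (\<phi> k) l) \<longlonglongrightarrow> m l" for l
  proof -
    have cont: "continuous_on UNIV (\<lambda>a :: bool list \<Rightarrow> real. a l)" by simp
    have "isCont (\<lambda>a :: bool list \<Rightarrow> real. a l) m"
      using cont unfolding continuous_on_eq_continuous_at[OF open_UNIV] by blast
    from isCont_tendsto_compose[OF this \<open>(Mk \<circ> \<phi>) \<longlonglongrightarrow> m\<close>] show ?thesis by simp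
  qed
  have m1: "m [] = 1"
    using lim[of "[]"] by (simp add: Mk_def LIMSEQ_const_iff)
  have madd: "m l = m (l @ [False]) + m (l @ [True])" for l
  proof (rule LIMSEQ_unique[OF lim])
    have "Mk k l = Mk k (l @ [False]) + Mk k (l @ [True])" for k
    proof -
      have "{z. map (cc z) [0..<length l] = l} = {z. map (cc z) [0..<length (l @ [False])] = l @ [False]}
        \<union> {z. map (cc z) [0..<length (l @ [True])] = l @ [True]}" by auto
      then show ?thesis
        unfolding Mk_def by (simp only:, intro measure_pmf.finite_measure_Union) auto
    qed
    then show "(\<lambda>k. Mk (\<phi> k) l) \<longlonglongrightarrow> m (l @ [False]) + m (l @ [True])"
      using tendsto_add[OF lim lim] by simp
  qed
  have m0: "0 \<le> m l" for l using m01[of l] by simp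
  obtain b where b: "\<And>l. {t \<in> {0..<1}. map (b t) [0..<length l] = l} \<in> sets borel"
    "\<And>l. emeasure lborel {t \<in> {0..<1::real}. map (b t) [0..<length l] = l} = ennreal (m l)"
    using binary_tree_realisation[of m, OF m0 m1 madd] by blast
  define U where "U = restrict_space lborel {0..<1::real}"
  have spU: "space U = {0..<1}" by (simp add: U_def space_restrict_space)
  interpret U: prob_space U
    by standard (simp add: U_def emeasure_restrict_space space_restrict_space)
  have bU: "{t \<in> space U. map (b t) [0..<length l] = l} \<in> sets U"
     "emeasure U {t \<in> space U. map (b t) [0..<length l] = l} = ennreal (m l)" for l
  proof -
    show "{t \<in> space U. map (b t) [0..<length l] = l} \<in> sets U"
      unfolding spU using b(1)[of l] by (auto simp: U_def sets_restrict_space_iff)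
    show "emeasure U {t \<in> space U. map (b t) [0..<length l] = l} = ennreal (m l)"
      unfolding spU U_def using b(2)[of l] by (subst emeasure_restrict_space) auto
  qed
  have mlist: "(\<lambda>t. map (b t) [0..<n]) \<in> measurable U (count_space UNIV)" for n
  proof (subst measurable_count_space_eq2_countable, safe)
    fix l :: "bool list"
    show "(\<lambda>t. map (b t) [0..<n]) -` {l} \<inter> space U \<in> sets U"
    proof (cases "length l = n")
      case True
      then show ?thesis using bU(1)[of l] by (simp add: vimage_def Int_def conj_commute)
    next
      case False
      then have "(\<lambda>t. map (b t) [0..<n]) -` {l} = {}" by auto
      then show ?thesis by simp
    qed
  qed auto
  have mb: "(\<lambda>t. b t i) \<in> measurable U (count_space UNIV)" for i
  proof -
    have "(\<lambda>t. map (b t) [0..<Suc i] ! i) \<in> measurable U (count_space UNIV)"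
      by (rule measurable_compose[OF mlist]) simp
    moreover have "(\<lambda>t. map (b t) [0..<Suc i] ! i) = (\<lambda>t. b t i)"
      by (simp del: upt_Suc)
    ultimately show ?thesis by simp
  qed
  let ?Seq = "PiM UNIV (\<lambda>_::nat. count_space (UNIV :: bool set))"
  have mseq: "(\<lambda>t i. b t (2 * i + e)) \<in> measurable U ?Seq" for e
    by (rule measurable_PiM_single') (use mb in auto)
  have law: "distr U ?Seq (\<lambda>t i. b t (2 * i + e)) = distr \<sigma> ?Seq code"
    \<comment> \<open>One argument for both marginals: the offset \<open>e\<close> is 0 for the
      first coordinate and 1 for the second.\<close>
    if \<sigma>: "prob_space \<sigma>" "sets \<sigma> = sets borel" and e: "e < 2" and g: "\<And>z i. cc z (2 * i + e) = code (g z) i"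
      and wg: "\<And>k D. measure (w k) {z. g z \<in> D} = measure \<sigma> {x. rep (map (code x) [0..<k]) \<in> D}" for \<sigma> g e
  proof (rule distr_sequence_eqI[OF U.prob_space_axioms mseq])
    interpret \<sigma>: prob_space \<sigma> by fact
    have sp\<sigma>: "space \<sigma> = UNIV" using sets_eq_imp_space_eq[OF \<sigma>(2)] by simp
    show "code \<in> measurable \<sigma> ?Seq"
      by (rule measurable_from_borel[OF \<sigma>(2) measurable_code_PiM])
    fix s :: "bool list"
    define L where "L = length s"
    \<comment> \<open>Long enough for the first \<open>L\<close> bits of either coordinate, whose
      last position is at most \<open>2 * L - 1\<close>.\<close>
    define n where "n = 2 * L + 2"
    define \<Omega> where "\<Omega> = {l :: bool list. length l = n \<and> map (\<lambda>i. l ! (2 * i + e)) [0..<L] = s}"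
    have "finite \<Omega>"
      by (rule finite_subset[OF _ finite_lists_length_eq[of "UNIV :: bool set" n]]) (auto simp: \<Omega>_def)
    have in\<Omega>: "map f [0..<n] \<in> \<Omega> \<longleftrightarrow> map (\<lambda>i. f (2 * i + e)) [0..<L] = s" for f
    proof -
      have "map (\<lambda>i. map f [0..<n] ! (2 * i + e)) [0..<L] = map (\<lambda>i. f (2 * i + e)) [0..<L]"
        using e by (intro map_cong) (auto simp: n_def nth_append simp del: upt_Suc)
      then show ?thesis by (simp add: \<Omega>_def del: map_eq_conv)
    qed
    have "{t \<in> space U. map (\<lambda>i. b t (2 * i + e)) [0..<L] = s} = (\<Union>l\<in>\<Omega>. {t \<in> space U. map (b t) [0..<length l] = l})"
      unfolding in\<Omega>[symmetric] by (auto simp: \<Omega>_def)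
    then have "emeasure U {t \<in> space U. map (\<lambda>i. b t (2 * i + e)) [0..<L] = s} =
        (\<Sum>l\<in>\<Omega>. emeasure U {t \<in> space U. map (b t) [0..<length l] = l})"
      using \<open>finite \<Omega>\<close> bU(1)
      by (simp only:, intro sum_emeasure[symmetric]) (auto simp: disjoint_family_on_def \<Omega>_def)
    also have "\<dots> = ennreal (\<Sum>l\<in>\<Omega>. m l)"
      unfolding bU(2) using m0 by (intro sum_ennreal) auto
    finally have 1: "emeasure U {t \<in> space U. map (\<lambda>i. b t (2 * i + e)) [0..<L] = s} = ennreal (\<Sum>l\<in>\<Omega>. m l)" .
    \<comment> \<open>Once \<open>k \<ge> L\<close>, a point and its depth-\<open>k\<close>
      representative share their first \<open>L\<close> bits, so the discrete marginal is already
      exact on these cells.\<close>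
    have 2: "(\<Sum>l\<in>\<Omega>. Mk k l) = measure \<sigma> {x. map (code x) [0..<L] = s}" if "k \<ge> L" for k
    proof -
      have "(\<Sum>l\<in>\<Omega>. Mk k l) = measure (w k) (\<Union>l\<in>\<Omega>. {z. map (cc z) [0..<length l] = l})"
        unfolding Mk_def using \<open>finite \<Omega>\<close>
        by (intro measure_pmf.finite_measure_finite_Union[symmetric]) (auto simp: disjoint_family_on_def \<Omega>_def)
      also have "(\<Union>l\<in>\<Omega>. {z. map (cc z) [0..<length l] = l}) = {z. map (cc z) [0..<n] \<in> \<Omega>}"
        by (auto simp: \<Omega>_def)
      also have "\<dots> = {z. g z \<in> {x. map (code x) [0..<L] = s}}"
        unfolding in\<Omega> g by simp
      also have "measure (w k) \<dots> = measure \<sigma> {x. rep (map (code x) [0..<k]) \<in> {x. map (code x) [0..<L] = s}}"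
        by (rule wg)
      also have "map (code (rep (map (code x) [0..<k]))) [0..<L] = map (code x) [0..<L]" for x
        using map_upt_eqD[OF rep_code[of x k]] that by (intro map_cong) auto
      then have "{x. rep (map (code x) [0..<k]) \<in> {x. map (code x) [0..<L] = s}} = {x. map (code x) [0..<L] = s}"
        by (simp only: mem_Collect_eq)
      finally show ?thesis .
    qed
    have "(\<lambda>k. \<Sum>l\<in>\<Omega>. Mk (\<phi> k) l) \<longlonglongrightarrow> (\<Sum>l\<in>\<Omega>. m l)"
      by (intro tendsto_sum lim)
    moreover have "(\<lambda>k. \<Sum>l\<in>\<Omega>. Mk (\<phi> k) l) \<longlonglongrightarrow> measure \<sigma> {x. map (code x) [0..<L] = s}"
    proof (rule tendsto_eventually)
      show "\<forall>\<^sub>F k in sequentially. (\<Sum>l\<in>\<Omega>. Mk (\<phi> k) l) = measure \<sigma> {x. map (code x) [0..<L] = s}"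
        using eventually_ge_at_top[of L]
        by eventually_elim (rule 2, use seq_suble[OF \<phi>] order_trans in blast)
    qed
    ultimately have "(\<Sum>l\<in>\<Omega>. m l) = measure \<sigma> {x. map (code x) [0..<L] = s}"
      by (rule LIMSEQ_unique)
    then show "emeasure U {t \<in> space U. map (\<lambda>i. b t (2 * i + e)) [0..<length s] = s} =
      emeasure \<sigma> {x \<in> space \<sigma>. map (code x) [0..<length s] = s}"
      using 1 by (simp add: L_def sp\<sigma> \<sigma>.emeasure_eq_measure)
  qed
  have decode_law: "distr U borel (\<lambda>t. decode (\<lambda>i. b t (2 * i + e))) = \<sigma>"
    "AE t in U. \<forall>i. code (decode (\<lambda>i. b t (2 * i + e))) i = b t (2 * i + e)"
    if \<sigma>: "prob_space \<sigma>" "sets \<sigma> = sets borel" and l: "distr U ?Seq (\<lambda>t i. b t (2 * i + e)) = distr \<sigma> ?Seq code" for \<sigma> e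
  proof -
    have mc: "code \<in> measurable \<sigma> ?Seq"
      by (rule measurable_from_borel[OF \<sigma>(2) measurable_code_PiM])
    have "distr U borel (\<lambda>t. decode (\<lambda>i. b t (2 * i + e))) = distr (distr U ?Seq (\<lambda>t i. b t (2 * i + e))) borel decode"
      by (subst distr_distr[OF measurable_decode mseq]) (simp add: comp_def)
    also have "\<dots> = distr \<sigma> borel (\<lambda>x. x)"
      unfolding l by (subst distr_distr[OF measurable_decode mc]) (simp add: comp_def decode_code)
    also have "\<dots> = \<sigma>"
      using \<sigma>(2) by (rule distr_id2[OF sym])
    finally show "distr U borel (\<lambda>t. decode (\<lambda>i. b t (2 * i + e))) = \<sigma>" .
    have ms: "{s \<in> space ?Seq. \<forall>i. code (decode s) i = s i} \<in> sets ?Seq"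
    proof -
      note [measurable] = measurable_decode
      show ?thesis by measurable
    qed
    \<comment> \<open>Being a genuine code is a measurable event of full probability under the law
      of codes, so it is inherited by the random bits, whose law is the same.\<close>
    have "AE s in distr \<sigma> ?Seq code. \<forall>i. code (decode s) i = s i"
      by (subst AE_distr_iff[OF mc ms]) (simp add: decode_code)
    then have "AE s in distr U ?Seq (\<lambda>t i. b t (2 * i + e)). \<forall>i. code (decode s) i = s i"
      unfolding l .
    then show "AE t in U. \<forall>i. code (decode (\<lambda>i. b t (2 * i + e))) i = b t (2 * i + e)"
      by (subst (asm) AE_distr_iff[OF mseq ms])
  qed
  define X where "X t = decode (\<lambda>i. b t (2 * i + 0))" for t
  define Y where "Y t = decode (\<lambda>i. b t (2 * i + 1))" for t
  have lawX: "distr U ?Seq (\<lambda>t i. b t (2 * i + 0)) = distr \<rho> ?Seq code"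
    by (rule law[OF \<rho>, of _ fst]) (use cc0 wfst in auto)
  have lawY: "distr U ?Seq (\<lambda>t i. b t (2 * i + 1)) = distr \<mu> ?Seq code"
    by (rule law[OF \<mu>, of _ snd]) (use cc1 wsnd in auto)
  have X: "distr U borel X = \<rho>" "AE t in U. \<forall>i. code (X t) i = b t (2 * i)"
    using decode_law[OF \<rho> lawX] by (simp_all add: X_def[abs_def])
  have Y: "distr U borel Y = \<mu>" "AE t in U. \<forall>i. code (Y t) i = b t (2 * i + 1)"
    using decode_law[OF \<mu> lawY] by (simp_all add: Y_def[abs_def])
  have mX[measurable]: "X \<in> borel_measurable U" "Y \<in> borel_measurable U"
    unfolding X_def Y_def by (rule measurable_compose[OF mseq measurable_decode])+
  \<comment> \<open>The pairs whose cells all have positive limiting mass, a substitute for the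
    support. The coupling is concentrated there because only countably many cells have mass
    zero.\<close>
  define S where "S = {z. \<forall>n. m (map (cc z) [0..<n]) > 0}"
  define \<gamma> where "\<gamma> = distr U borel (\<lambda>t. (X t, Y t))"
  have mXY: "(\<lambda>t. (X t, Y t)) \<in> borel_measurable U"
    by measurable
  have "AE t in U. \<forall>l. m l = 0 \<longrightarrow> map (b t) [0..<length l] \<noteq> l"
  proof (subst AE_all_countable, safe)
    fix l
    show "AE t in U. m l = 0 \<longrightarrow> map (b t) [0..<length l] \<noteq> l"
    proof (cases "m l = 0")
      case True
      then show ?thesis
        using bU[of l] by (intro AE_I'[of "{t \<in> space U. map (b t) [0..<length l] = l}"]) (auto simp: null_sets_def)
    qed simp
  qed
  then have AES: "AE t in U. (X t, Y t) \<in> S"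
    using X(2) Y(2)
  proof eventually_elim
    case (elim t)
    have "cc (X t, Y t) i = b t i" for i
      using elim(2,3) by (auto simp: cc_def elim!: oddE evenE)
    then have "map (cc (X t, Y t)) [0..<n] = map (b t) [0..<n]" for n
      by simp
    then have "m (map (cc (X t, Y t)) [0..<n]) \<noteq> 0" for n
      using elim(1) by (metis diff_zero length_map length_upt)
    then show ?case unfolding S_def using m0 by (simp add: less_le)
  qed
  have mcc: "(\<lambda>z. cc z i) \<in> measurable borel (count_space UNIV)" for i
  proof -
    have "fst \<in> borel_measurable (borel :: ('a \<times> 'a) measure)" "snd \<in> borel_measurable (borel :: ('a \<times> 'a) measure)"
      by (rule measurable_fst_snd_borel[OF refl])+
    then show ?thesis
      unfolding cc_def by (cases "even i") (auto intro: measurable_compose[OF _ measurable_code])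
  qed
  have "S \<in> sets borel"
  proof -
    have "(\<lambda>z. m (map (\<lambda>i. cc z i) [0..<n])) \<in> borel_measurable borel" for n
      by (rule measurable_compose[OF measurable_map_upt[OF mcc]]) simp
    then have "{z \<in> space borel. \<forall>n. m (map (\<lambda>i. cc z i) [0..<n]) > 0} \<in> sets borel"
      by measurable
    then show ?thesis by (simp add: S_def)
  qed
  then have "AE z in \<gamma>. z \<in> S"
    unfolding \<gamma>_def by (subst AE_distr_iff[OF mXY]) (use AES in auto)
  moreover have "\<gamma> \<in> couplings \<rho> \<mu>"
  proof -
    have f: "fst \<in> borel_measurable (borel :: ('a \<times> 'a) measure)" "snd \<in> borel_measurable (borel :: ('a \<times> 'a) measure)"
      by (rule measurable_fst_snd_borel[OF refl])+
    have "distr \<gamma> borel fst = \<rho>" "distr \<gamma> borel snd = \<mu>"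
      unfolding \<gamma>_def distr_distr[OF f(1) mXY] distr_distr[OF f(2) mXY] comp_def fst_conv snd_conv
      using X(1) Y(1) by auto
    moreover have "prob_space \<gamma>" unfolding \<gamma>_def by (rule U.prob_space_distr[OF mXY])
    ultimately show ?thesis by (simp add: couplings_def \<gamma>_def)
  qed
  moreover have "cyclically_monotone S"
    unfolding cyclically_monotone_def
  proof (intro allI impI)
    fix N and z :: "nat \<Rightarrow> 'a \<times> 'a"
    assume z: "\<forall>i\<le>N. z i \<in> S"
    \<comment> \<open>For fixed \<open>n\<close>, a far enough discrete plan charges the cells of
      all \<open>z i\<close> simultaneously. Support points chosen in those cells satisfy the cyclic
      inequality, and converge to the \<open>z i\<close> as \<open>n\<close> grows.\<close>
    have ex: "\<exists>z'. (\<forall>i\<le>N. map (cc (z' i)) [0..<n] = map (cc (z i)) [0..<n]) \<and>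
      (\<Sum>i\<le>N. snd (z' i) \<bullet> (fst (z' (if i = N then 0 else Suc i)) - fst (z' i))) \<le> 0" for n
    proof -
      have "\<forall>\<^sub>F k in sequentially. \<forall>i\<in>{..N}. Mk (\<phi> k) (map (cc (z i)) [0..<n]) > 0"
      proof (rule eventually_ball_finite)
        show "\<forall>i\<in>{..N}. \<forall>\<^sub>F k in sequentially. Mk (\<phi> k) (map (cc (z i)) [0..<n]) > 0"
          using z by (auto intro!: order_tendstoD(1)[OF lim] simp: S_def)
      qed simp
      then obtain k where k: "\<And>i. i \<le> N \<Longrightarrow> Mk (\<phi> k) (map (cc (z i)) [0..<n]) > 0"
        by (auto simp: eventually_sequentially)
      have "\<exists>y\<in>set_pmf (w (\<phi> k)). map (cc y) [0..<n] = map (cc (z i)) [0..<n]" if "i \<le> N" for i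
      proof -
        have "measure (w (\<phi> k)) {y. map (cc y) [0..<n] = map (cc (z i)) [0..<n]} \<noteq> 0"
          using k[OF that] by (simp add: Mk_def)
        then have "set_pmf (w (\<phi> k)) \<inter> {y. map (cc y) [0..<n] = map (cc (z i)) [0..<n]} \<noteq> {}"
          unfolding measure_pmf_zero_iff .
        then show ?thesis by blast
      qed
      then have "\<forall>i. \<exists>y. i \<le> N \<longrightarrow> y \<in> set_pmf (w (\<phi> k)) \<and> map (cc y) [0..<n] = map (cc (z i)) [0..<n]"
        by blast
      from choice[OF this] obtain z' where z': "\<And>i. i \<le> N \<Longrightarrow> z' i \<in> set_pmf (w (\<phi> k))"
          "\<And>i. i \<le> N \<Longrightarrow> map (cc (z' i)) [0..<n] = map (cc (z i)) [0..<n]"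
        by blast
      then show ?thesis
        using w(3)[of "\<phi> k"] unfolding cyclically_monotone_def by blast
    qed
    have "\<forall>n. \<exists>z'. (\<forall>i\<le>N. map (cc (z' i)) [0..<n] = map (cc (z i)) [0..<n]) \<and>
      (\<Sum>i\<le>N. snd (z' i) \<bullet> (fst (z' (if i = N then 0 else Suc i)) - fst (z' i))) \<le> 0"
      using ex by (rule allI)
    from choice[OF this]
    obtain z' where z': "\<And>n i. i \<le> N \<Longrightarrow> map (cc (z' n i)) [0..<n] = map (cc (z i)) [0..<n]"
      "\<And>n. (\<Sum>i\<le>N. snd (z' n i) \<bullet> (fst (z' n (if i = N then 0 else Suc i)) - fst (z' n i))) \<le> 0"
      by blast
    have conv: "(\<lambda>n. fst (z' n i)) \<longlonglongrightarrow> fst (z i)" "(\<lambda>n. snd (z' n i)) \<longlonglongrightarrow> snd (z i)" if "i \<le> N" for i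
    proof -
      have c: "cc (z' n i) j = cc (z i) j" if "j < n" for n j
        using map_upt_eqD[OF z'(1)[OF \<open>i \<le> N\<close>] that] .
      show "(\<lambda>n. fst (z' n i)) \<longlonglongrightarrow> fst (z i)"
      proof (rule topological_tendstoI)
        fix V assume "open V" "fst (z i) \<in> V"
        then obtain j where j: "fst (z i) \<in> B j" "B j \<subseteq> V" using B by blast
        have "fst (z' n i) \<in> V" if "n > 2 * j" for n
          using c[OF that] j unfolding cc0 by (auto simp: code_def)
        then show "\<forall>\<^sub>F n in sequentially. fst (z' n i) \<in> V"
          using eventually_gt_at_top[of "2 * j"] by (rule eventually_mono[rotated])
      qed
      show "(\<lambda>n. snd (z' n i)) \<longlonglongrightarrow> snd (z i)"
      proof (rule topological_tendstoI)
        fix V assume "open V" "snd (z i) \<in> V"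
        then obtain j where j: "snd (z i) \<in> B j" "B j \<subseteq> V" using B by blast
        have "snd (z' n i) \<in> V" if "n > 2 * j + 1" for n
          using c[OF that] j unfolding cc1 by (auto simp: code_def)
        then show "\<forall>\<^sub>F n in sequentially. snd (z' n i) \<in> V"
          using eventually_gt_at_top[of "2 * j + 1"] by (rule eventually_mono[rotated])
      qed
    qed
    have "(\<lambda>n. \<Sum>i\<le>N. snd (z' n i) \<bullet> (fst (z' n (if i = N then 0 else Suc i)) - fst (z' n i)))
       \<longlonglongrightarrow> (\<Sum>i\<le>N. snd (z i) \<bullet> (fst (z (if i = N then 0 else Suc i)) - fst (z i)))"
      by (intro tendsto_sum tendsto_inner tendsto_diff conv) auto
    then show "(\<Sum>i\<le>N. snd (z i) \<bullet> (fst (z (if i = N then 0 else Suc i)) - fst (z i))) \<le> 0"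
      by (rule LIMSEQ_le_const2) (use z'(2) in auto)
  qed
  ultimately show ?thesis by blast
qed

section \<open>Densities and finiteness of the energy\<close>

text \<open>The hard half of duality. An optimal \<open>u\<close> has dual cost at most that of
  \<open>w\<close>, hence at most \<open>transport\<close>, which allows the transport term at the
  minimiser to be replaced by integrals of \<open>u\<close> and its transform.\<close>

theorem kantorovich_duality:
  fixes \<rho> \<mu> :: "'a::euclidean_space measure"
  assumes "\<rho> \<in> P1" "\<mu> \<in> P1"
  shows "\<exists>w. admissible w \<and> dual_cost \<rho> \<mu> w \<le> transport \<rho> \<mu>"
  using monotone_coupling_exists[OF P1D(1,2)[OF assms(1)] P1D(1,2)[OF assms(2)]]
    monotone_coupling_dual[OF assms] by blast

text \<open>One null set \<open>N\<close> carrying \<open>\<nu>\<close> separates the parts: off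
  \<open>N\<close> the measure \<open>\<nu>\<close> vanishes, and on \<open>N\<close> the density
  integrates to zero.\<close>

lemma lebesgue_decompositionE:
  fixes \<rho> :: "'a::euclidean_space measure"
  assumes d: "lebesgue_decomposition \<rho> g \<nu>" and s: "sets \<rho> = sets borel"
  obtains N where "N \<in> null_sets lborel" "N \<in> sets borel"
    "density \<rho> (indicator (- N)) = density lborel (\<lambda>x. ennreal (g x))"
    "\<And>A. A \<in> sets borel \<Longrightarrow> emeasure \<nu> A = emeasure \<rho> (A \<inter> N)"
proof -
  note [measurable_cong] = s
  from d have [measurable]: "g \<in> borel_measurable borel" and s\<nu>: "sets \<nu> = sets borel"
    and eq: "\<And>A. A \<in> sets borel \<Longrightarrow> emeasure \<rho> A = (\<integral>\<^sup>+x\<in>A. ennreal (g x) \<partial>lborel) + emeasure \<nu> A"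
    by (auto simp: lebesgue_decomposition_def)
  from d obtain N where N: "N \<in> null_sets lborel" "emeasure \<nu> (- N) = 0"
    by (auto simp: lebesgue_decomposition_def)
  then have [measurable]: "N \<in> sets borel" by (auto simp: null_sets_def)
  have \<nu>0: "emeasure \<nu> (A - N) = 0" if "A \<in> sets borel" for A
  proof -
    have "emeasure \<nu> (A - N) \<le> emeasure \<nu> (- N)"
      by (rule emeasure_mono) (auto simp: s\<nu>)
    then show ?thesis using N by simp
  qed
  have nullint: "(\<integral>\<^sup>+x\<in>A \<inter> N. ennreal (g x) \<partial>lborel) = 0" if "A \<in> sets borel" for A
  proof -
    have "(\<integral>\<^sup>+x\<in>A \<inter> N. ennreal (g x) \<partial>lborel) = (\<integral>\<^sup>+x. 0 \<partial>(lborel :: 'a measure))"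
      using AE_not_in[OF N(1)] by (intro nn_integral_cong_AE) (auto elim!: eventually_mono)
    then show ?thesis by simp
  qed
  show thesis
  proof (rule that[OF N(1)])
    show "density \<rho> (indicator (- N)) = density lborel (\<lambda>x. ennreal (g x))"
    proof (rule measure_eqI)
      fix A assume "A \<in> sets (density \<rho> (indicator (- N)))"
      then have A[measurable]: "A \<in> sets borel" by (simp add: s)
      have "emeasure (density \<rho> (indicator (- N))) A = emeasure \<rho> (A - N)"
        by (simp add: emeasure_restricted s Diff_eq Int_commute)
      also have "\<dots> = (\<integral>\<^sup>+x\<in>A - N. ennreal (g x) \<partial>lborel)"
        by (simp add: eq \<nu>0)
      also have "\<dots> = (\<integral>\<^sup>+x\<in>A. ennreal (g x) \<partial>lborel)"
        using AE_not_in[OF N(1)] by (intro nn_integral_cong_AE) (auto elim!: eventually_mono simp: indicator_def)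
      finally show "emeasure (density \<rho> (indicator (- N))) A = emeasure (density lborel (\<lambda>x. ennreal (g x))) A"
        by (simp add: emeasure_density)
    qed (simp add: s)
    fix A :: "'a set" assume A[measurable]: "A \<in> sets borel"
    have "emeasure \<nu> A = emeasure \<nu> (A \<inter> N) + emeasure \<nu> (A - N)"
      by (subst plus_emeasure) (auto simp: s\<nu> intro!: arg_cong[where f="emeasure \<nu>"])
    also have "\<dots> = emeasure \<rho> (A \<inter> N)"
      using eq[of "A \<inter> N"] nullint[OF A] \<nu>0[OF A] by simp
    finally show "emeasure \<nu> A = emeasure \<rho> (A \<inter> N)" .
  qed simp
qed

text \<open>Away from the union of the two carriers both densities represent \<open>\<rho>\<close>,
  and that union is Lebesgue-null. This identifies the chosen representative with an explicit
  density of a competitor.\<close>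

lemma ac_density_unique:
  fixes \<rho> :: "'a::euclidean_space measure"
  assumes \<rho>: "finite_measure \<rho>" "sets \<rho> = sets borel" and d: "lebesgue_decomposition \<rho> g \<nu>"
  shows "AE x in lborel. ac_density \<rho> x = g x"
proof -
  let ?h = "ac_density \<rho>"
  note [measurable_cong] = \<rho>(2)
  have d': "lebesgue_decomposition \<rho> ?h (sing_part \<rho>)"
    by (rule lebesgue_decomposition_ac_sing[OF \<rho>])
  have [measurable]: "g \<in> borel_measurable borel" "?h \<in> borel_measurable borel"
    and nn: "\<And>x. 0 \<le> g x" "\<And>x. 0 \<le> ?h x"
    using d d' by (auto simp: lebesgue_decomposition_def)
  obtain N where N: "N \<in> null_sets lborel" and [measurable]: "N \<in> sets borel"
    and dN: "density \<rho> (indicator (- N)) = density lborel (\<lambda>x. ennreal (g x))"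
    using lebesgue_decompositionE[OF d \<rho>(2)] by metis
  obtain N' where N': "N' \<in> null_sets lborel" and [measurable]: "N' \<in> sets borel"
    and dN': "density \<rho> (indicator (- N')) = density lborel (\<lambda>x. ennreal (?h x))"
    using lebesgue_decompositionE[OF d' \<rho>(2)] by metis
  have split: "emeasure (density lborel (\<lambda>x. ennreal (f x))) A = emeasure \<rho> (A - (N \<union> N'))"
    if [measurable]: "A \<in> sets borel" "f \<in> borel_measurable borel" "M \<in> sets borel" and M: "M \<subseteq> N \<union> N'"
      and dM: "density \<rho> (indicator (- M)) = density lborel (\<lambda>x. ennreal (f x))" for A f M
  proof -
    have "emeasure (density lborel (\<lambda>x. ennreal (f x))) A = emeasure (density lborel (\<lambda>x. ennreal (f x))) (A - (N \<union> N'))"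
      using AE_not_in[OF N] AE_not_in[OF N']
      by (subst (1 2) emeasure_density) (auto intro!: nn_integral_cong_AE elim!: eventually_elim2 simp: indicator_def)
    also have "\<dots> = emeasure \<rho> (A - (N \<union> N'))"
      using M unfolding dM[symmetric]
      by (subst emeasure_restricted) (auto simp: \<rho>(2) intro!: arg_cong[where f="emeasure \<rho>"])
    finally show ?thesis .
  qed
  have "density lborel (\<lambda>x. ennreal (?h x)) = density lborel (\<lambda>x. ennreal (g x))"
  proof (rule measure_eqI)
    fix A assume "A \<in> sets (density lborel (\<lambda>x. ennreal (?h x)))"
    then have [measurable]: "A \<in> sets borel" by simp
    show "emeasure (density lborel (\<lambda>x. ennreal (?h x))) A = emeasure (density lborel (\<lambda>x. ennreal (g x))) A"
      using split[OF _ _ _ _ dN', of A] split[OF _ _ _ _ dN, of A] by simp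
  qed simp
  then have "AE x in lborel. ennreal (?h x) = ennreal (g x)"
    by (subst (asm) sigma_finite_measure.density_unique_iff[OF sigma_finite_lborel]) auto
  then show ?thesis
    by eventually_elim (use nn in simp)
qed

lemma ac_densityD:
  fixes \<rho> :: "'a::euclidean_space measure"
  assumes "\<rho> \<in> P1"
  shows "ac_density \<rho> \<in> borel_measurable borel" "0 \<le> ac_density \<rho> x"
    "lebesgue_decomposition \<rho> (ac_density \<rho>) (sing_part \<rho>)"
proof -
  interpret prob_space \<rho> using P1D[OF assms] by simp
  show "lebesgue_decomposition \<rho> (ac_density \<rho>) (sing_part \<rho>)"
    using lebesgue_decomposition_ac_sing[OF finite_measure_axioms P1D(2)[OF assms]] .
  then show "ac_density \<rho> \<in> borel_measurable borel" "0 \<le> ac_density \<rho> x"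
    by (auto simp: lebesgue_decomposition_def)
qed

lemma nn_integral_ac_density_le:
  fixes \<rho> :: "'a::euclidean_space measure"
  assumes \<rho>: "\<rho> \<in> P1" and [measurable]: "f \<in> borel_measurable borel"
  shows "(\<integral>\<^sup>+x. ennreal (ac_density \<rho> x) * f x \<partial>lborel) \<le> (\<integral>\<^sup>+x. f x \<partial>\<rho>)"
proof -
  note [measurable] = ac_densityD(1)[OF \<rho>]
  note [measurable_cong] = P1D(2)[OF \<rho>]
  obtain N where [measurable]: "N \<in> sets borel"
    and d: "density \<rho> (indicator (- N)) = density lborel (\<lambda>x. ennreal (ac_density \<rho> x))"
    using lebesgue_decompositionE[OF ac_densityD(3)[OF \<rho>] P1D(2)[OF \<rho>]] by metis
  have "(\<integral>\<^sup>+x. ennreal (ac_density \<rho> x) * f x \<partial>lborel) = (\<integral>\<^sup>+x. f x \<partial>density lborel (\<lambda>x. ennreal (ac_density \<rho> x)))"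
    by (simp add: nn_integral_density)
  also have "\<dots> = (\<integral>\<^sup>+x. indicator (- N) x * f x \<partial>\<rho>)"
    unfolding d[symmetric] by (subst nn_integral_density) auto
  also have "\<dots> \<le> (\<integral>\<^sup>+x. f x \<partial>\<rho>)"
    by (intro nn_integral_mono) (auto simp: indicator_def)
  finally show ?thesis .
qed

text \<open>Dyadic shells: where \<open>1 + norm x\<close> lies between \<open>2 ^ k\<close> and
  \<open>2 ^ Suc k\<close> the integrand is at most \<open>2 powr (- s * k)\<close>, while the
  enclosing ball has volume of order \<open>2 ^ (n * k)\<close>. The resulting geometric ratio is
  \<open>2 powr (n - s) < 1\<close>.\<close>

lemma nn_integral_inverse_power_finite:
  assumes s: "s > real DIM('a::euclidean_space)"
  shows "(\<integral>\<^sup>+(x::'a). ennreal ((1 + norm x) powr (- s)) \<partial>lborel) < \<infinity>"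
proof -
  define n where "n = DIM('a)"
  define V where "V = unit_ball_vol (real DIM('a))"
  define a where "a k = (2 powr (- s)) ^ k" for k :: nat
  have pw: "ennreal ((1 + norm x) powr (- s)) \<le> (\<Sum>k. ennreal (a k) * indicator (cball 0 (2 ^ Suc k)) x)" for x :: 'a
  proof -
    define k where "k = nat \<lfloor>log 2 (1 + norm x)\<rfloor>"
    have l0: "0 \<le> log 2 (1 + norm x)"
      by (subst zero_le_log_cancel_iff) (auto simp: add_pos_nonneg)
    have k: "real k \<le> log 2 (1 + norm x)" "log 2 (1 + norm x) < real k + 1"
      unfolding k_def using l0 by linarith+
    have lo: "2 powr real k \<le> 1 + norm x"
      using k(1) by (simp add: le_log_iff add_pos_nonneg)
    have hi: "1 + norm x \<le> 2 powr (real k + 1)"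
      using k(2) by (simp add: log_le_iff[symmetric] add_pos_nonneg)
    have "(1 + norm x) powr (- s) \<le> (2 powr real k) powr (- s)"
      using lo s by (intro powr_mono2') auto
    also have "\<dots> = a k" by (simp add: a_def powr_powr powr_realpow[symmetric] mult.commute)
    finally have 1: "(1 + norm x) powr (- s) \<le> a k" .
    have "x \<in> cball 0 (2 ^ Suc k)"
      using hi by (simp add: powr_add powr_realpow)
    with 1 have "ennreal ((1 + norm x) powr (- s)) \<le> ennreal (a k) * indicator (cball 0 (2 ^ Suc k)) x"
      by (simp add: ennreal_leI)
    also have "\<dots> \<le> (\<Sum>k. ennreal (a k) * indicator (cball 0 (2 ^ Suc k)) x)"
    proof -
      define F where "F = (\<lambda>k. ennreal (a k) * indicator (cball 0 (2 ^ Suc k)) x)"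
      have "F k \<le> suminf F" using sum_le_suminf[of F "{k}"] by simp
      then show ?thesis by (simp only: F_def)
    qed
    finally show ?thesis .
  qed
  define r where "r = 2 powr (real n - s)"
  have r: "0 < r" "r < 1" unfolding r_def n_def using s by (auto simp: powr_less_one)
  have "(\<integral>\<^sup>+(x::'a). ennreal ((1 + norm x) powr (- s)) \<partial>lborel) \<le>
     (\<integral>\<^sup>+(x::'a). (\<Sum>k. ennreal (a k) * indicator (cball 0 (2 ^ Suc k)) x) \<partial>lborel)"
    by (intro nn_integral_mono pw)
  also have "\<dots> = (\<Sum>k. ennreal (a k) * emeasure lborel (cball (0::'a) (2 ^ Suc k)))"
    by (subst nn_integral_suminf)
      (auto simp: nn_integral_cmult_indicator intro!: borel_measurable_times_ennreal borel_measurable_indicator)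
  also have "\<dots> = (\<Sum>k. ennreal (V * 2 ^ n * r ^ k))"
  proof (rule suminf_cong)
    fix k
    have "2 powr (- s) * 2 ^ n = r"
      by (simp add: r_def powr_diff powr_minus powr_realpow divide_simps)
    moreover have "a k * (V * (2 ^ Suc k) ^ n) = V * 2 ^ n * (2 powr (- s) * 2 ^ n) ^ k"
      by (simp add: a_def power_mult_distrib power_mult[symmetric] mult.commute)
    ultimately have e: "a k * (V * (2 ^ Suc k) ^ n) = V * 2 ^ n * r ^ k" by simp
    have "ennreal (a k) * emeasure lborel (cball (0::'a) (2 ^ Suc k)) = ennreal (a k * (V * (2 ^ Suc k) ^ n))"
      by (simp add: emeasure_cball V_def n_def a_def ennreal_mult[symmetric] del: power_Suc)
    then show "ennreal (a k) * emeasure lborel (cball (0::'a) (2 ^ Suc k)) = ennreal (V * 2 ^ n * r ^ k)"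
      unfolding e .
  qed
  also have "\<dots> < \<infinity>"
  proof -
    have "summable (\<lambda>k. V * 2 ^ n * r ^ k)"
      using r by (intro summable_mult summable_geometric) auto
    moreover have "0 \<le> V * 2 ^ n * r ^ k" for k
      using r by (simp add: V_def)
    ultimately show ?thesis by (simp add: suminf_ennreal2)
  qed
  finally show ?thesis .
qed

text \<open>Since \<open>\<alpha> - 1 = - (1 / p)\<close>, raising to the power \<open>- p\<close>
  undoes raising to the power \<open>\<alpha> - 1\<close> on positive numbers; this turns
  \<open>u - c\<close> back into a density.\<close>

lemma alpha_facts:
  fixes n :: nat
  assumes "q > 1" "p = real n + q"
  shows "0 < alpha n q" "alpha n q < 1" "alpha n q - 1 = - (1 / p)" "alpha n q * p = p - 1" "1 < p"
proof -
  show p: "1 < p" using assms by simp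
  show "0 < alpha n q" "alpha n q < 1" "alpha n q - 1 = - (1 / p)" "alpha n q * p = p - 1"
    using p unfolding alpha_def assms(2)[symmetric] by (auto simp: field_simps)
qed

text \<open>Compare \<open>g\<close> with \<open>(1 + norm x) powr (- p)\<close>. Where
  \<open>g\<close> is larger, \<open>g powr \<alpha>\<close> is at most
  \<open>g * (1 + norm x)\<close>, controlled by the first moment; elsewhere it is at most
  \<open>(1 + norm x) powr (- (p - 1))\<close>, integrable because
  \<open>p - 1 = n + q - 1 > n\<close>.\<close>

lemma integrable_ac_density_powr:
  fixes \<rho> :: "'a::euclidean_space measure"
  assumes \<rho>: "\<rho> \<in> P1" and q: "q > 1"
  shows "integrable lborel (\<lambda>x. ac_density \<rho> x powr alpha DIM('a) q)"
proof -
  define g where "g = ac_density \<rho>"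
  define p where "p = real DIM('a) + q"
  define \<alpha> where "\<alpha> = alpha DIM('a) q"
  note \<alpha> = alpha_facts[OF q p_def, folded \<alpha>_def]
  have [measurable]: "g \<in> borel_measurable borel" and g0: "\<And>x. 0 \<le> g x"
    using ac_densityD[OF \<rho>] by (auto simp: g_def)
  have pw: "g x powr \<alpha> \<le> g x * (1 + norm x) + (1 + norm x) powr (- (p - 1))" for x
  proof (cases "g x \<ge> (1 + norm x) powr (- p)")
    case True
    have n0: "0 < 1 + norm x" by (simp add: add_pos_nonneg)
    then have gx: "g x > 0" using True by (metis less_le_trans powr_gt_zero less_irrefl)
    have "g x powr (\<alpha> - 1) \<le> ((1 + norm x) powr (- p)) powr (\<alpha> - 1)"
      using True \<alpha> n0 by (intro powr_mono2') auto
    also have "\<dots> = 1 + norm x"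
      using \<alpha> n0 by (simp add: powr_powr)
    finally have "g x * g x powr (\<alpha> - 1) \<le> g x * (1 + norm x)"
      using g0 by (intro mult_left_mono) auto
    moreover have "g x * g x powr (\<alpha> - 1) = g x powr \<alpha>"
      using gx by (simp add: powr_mult_base)
    ultimately show ?thesis by (simp add: add_increasing2)
  next
    case False
    then have "g x powr \<alpha> \<le> ((1 + norm x) powr (- p)) powr \<alpha>"
      using g0 \<alpha> by (intro powr_mono2) auto
    also have "\<dots> = (1 + norm x) powr (- (p - 1))"
      using \<alpha> by (simp add: powr_powr mult.commute)
    finally show ?thesis using g0[of x] by (simp add: add_increasing)
  qed
  have "(\<integral>\<^sup>+x. ennreal (g x powr \<alpha>) \<partial>lborel) \<le>
      (\<integral>\<^sup>+x. ennreal (g x) * ennreal (1 + norm x) + ennreal ((1 + norm x) powr (- (p - 1))) \<partial>lborel)"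
  proof (rule nn_integral_mono)
    fix x
    have "ennreal (g x powr \<alpha>) \<le> ennreal (g x * (1 + norm x) + (1 + norm x) powr (- (p - 1)))"
      by (rule ennreal_leI[OF pw])
    also have "\<dots> = ennreal (g x) * ennreal (1 + norm x) + ennreal ((1 + norm x) powr (- (p - 1)))"
      using g0[of x] by (simp add: ennreal_mult)
    finally show "ennreal (g x powr \<alpha>) \<le> ennreal (g x) * ennreal (1 + norm x) + ennreal ((1 + norm x) powr (- (p - 1)))" .
  qed
  also have "\<dots> = (\<integral>\<^sup>+x. ennreal (g x) * ennreal (1 + norm x) \<partial>lborel) + (\<integral>\<^sup>+(x::'a). ennreal ((1 + norm x) powr (- (p - 1))) \<partial>lborel)"
    by (rule nn_integral_add) auto
  also have "\<dots> < \<infinity>"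
  proof -
    interpret prob_space \<rho> using P1D[OF \<rho>] by simp
    have "(\<integral>\<^sup>+x. ennreal (g x) * ennreal (1 + norm x) \<partial>lborel) \<le> (\<integral>\<^sup>+x. ennreal (1 + norm x) \<partial>\<rho>)"
      unfolding g_def by (rule nn_integral_ac_density_le[OF \<rho>]) simp
    also have "\<dots> < \<infinity>"
    proof -
      have "integrable \<rho> (\<lambda>x. 1 + norm x)" using P1D(3)[OF \<rho>] by simp
      then show ?thesis by (simp add: real_integrable_def less_top)
    qed
    finally show ?thesis
      using nn_integral_inverse_power_finite[of "p - 1", where 'a='a] q by (simp add: p_def)
  qed
  finally show ?thesis
    unfolding g_def[symmetric] \<alpha>_def[symmetric] by (intro integrableI_nonneg) auto
qed

lemma energy_eq:
  fixes \<rho> :: "'a::euclidean_space measure"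
  assumes "\<rho> \<in> P1" "q > 1"
  shows "energy (alpha DIM('a) q) \<rho> =
    ereal (- (1 / alpha DIM('a) q) * (\<integral>x. ac_density \<rho> x powr alpha DIM('a) q \<partial>lborel))"
  unfolding energy_def ent_def using integrable_ac_density_powr[OF assms]
  by (subst ext_integral_real[where f="\<lambda>x. - (1 / alpha DIM('a) q) * ac_density \<rho> x powr alpha DIM('a) q"]) auto

text \<open>The product coupling is admissible and its integral of \<open>x \<bullet> y\<close>
  vanishes by Fubini, because \<open>\<mu>\<close> has barycentre 0.\<close>

lemma transport_nonneg:
  fixes \<rho> \<mu> :: "'a::euclidean_space measure"
  assumes \<rho>: "\<rho> \<in> P1" and \<mu>: "\<mu> \<in> P1" and cent: "(\<integral>y. y \<partial>\<mu>) = 0"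
  shows "0 \<le> transport \<rho> \<mu>"
proof -
  interpret \<rho>: prob_space \<rho> using P1D[OF \<rho>] by simp
  interpret \<mu>: prob_space \<mu> using P1D[OF \<mu>] by simp
  interpret pair_prob_space \<rho> \<mu> ..
  note [measurable_cong] = P1D(2)[OF \<rho>] P1D(2)[OF \<mu>]
  have s: "sets (\<rho> \<Otimes>\<^sub>M \<mu>) = sets borel"
    unfolding borel_prod[symmetric] by (rule sets_pair_measure_cong) (use P1D(2)[OF \<rho>] P1D(2)[OF \<mu>] in auto)
  have "distr (\<rho> \<Otimes>\<^sub>M \<mu>) borel fst = distr (\<rho> \<Otimes>\<^sub>M \<mu>) \<rho> fst"
    by (rule distr_cong) (use P1D(2)[OF \<rho>] in auto)
  also have "\<dots> = \<rho>" by (rule \<mu>.distr_pair_fst)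
  finally have 1: "distr (\<rho> \<Otimes>\<^sub>M \<mu>) borel fst = \<rho>" .
  have "distr (\<rho> \<Otimes>\<^sub>M \<mu>) borel snd = \<mu>"
  proof (rule measure_eqI)
    fix A assume "A \<in> sets (distr (\<rho> \<Otimes>\<^sub>M \<mu>) borel snd)"
    then have [measurable]: "A \<in> sets borel" by simp
    have "emeasure (distr (\<rho> \<Otimes>\<^sub>M \<mu>) borel snd) A = emeasure (\<rho> \<Otimes>\<^sub>M \<mu>) (space \<rho> \<times> A)"
      using sets.sets_into_space[of A \<mu>] P1D(2)[OF \<mu>]
      by (subst emeasure_distr) (auto simp: space_pair_measure intro!: arg_cong[where f="emeasure _"])
    then show "emeasure (distr (\<rho> \<Otimes>\<^sub>M \<mu>) borel snd) A = emeasure \<mu> A"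
      by (simp add: \<mu>.emeasure_pair_measure_Times \<rho>.emeasure_space_1 P1D(2)[OF \<mu>])
  qed (simp add: P1D(2)[OF \<mu>])
  with 1 s have \<gamma>: "\<rho> \<Otimes>\<^sub>M \<mu> \<in> couplings \<rho> \<mu>"
    using prob_space_axioms by (simp add: couplings_def)
  have n: "integrable \<rho> norm" "integrable \<mu> norm" using P1D \<rho> \<mu> by auto
  have iy: "integrable \<mu> (\<lambda>y. y)"
    using n(2) by (rule Bochner_Integration.integrable_bound) auto
  have im: "(\<lambda>z. fst z \<bullet> snd z) \<in> borel_measurable (\<rho> \<Otimes>\<^sub>M \<mu>)"
    by (rule inner_measurable_coupling[OF \<gamma>])
  have int: "integrable (\<rho> \<Otimes>\<^sub>M \<mu>) (\<lambda>z. fst z \<bullet> snd z)"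
  proof (rule Fubini_integrable[OF im])
    show "AE x in \<rho>. integrable \<mu> (\<lambda>y. fst (x, y) \<bullet> snd (x, y))" using iy by simp
    show "integrable \<rho> (\<lambda>x. \<integral>y. norm (fst (x, y) \<bullet> snd (x, y)) \<partial>\<mu>)"
    proof (rule Bochner_Integration.integrable_bound)
      show "integrable \<rho> (\<lambda>x. norm x * (\<integral>y. norm y \<partial>\<mu>))" using n by simp
      show "AE x in \<rho>. norm (\<integral>y. norm (fst (x, y) \<bullet> snd (x, y)) \<partial>\<mu>) \<le> norm (norm x * (\<integral>y. norm y \<partial>\<mu>))"
      proof (rule AE_I2)
        fix x :: 'a
        have "(\<integral>y. norm (x \<bullet> y) \<partial>\<mu>) \<le> (\<integral>y. norm x * norm y \<partial>\<mu>)"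
          using n iy by (intro integral_mono) (auto simp: Cauchy_Schwarz_ineq2)
        then show "norm (\<integral>y. norm (fst (x, y) \<bullet> snd (x, y)) \<partial>\<mu>) \<le> norm (norm x * (\<integral>y. norm y \<partial>\<mu>))"
          by simp
      qed
    qed measurable
  qed
  have "ext_integral (\<rho> \<Otimes>\<^sub>M \<mu>) (\<lambda>z. ereal (fst z \<bullet> snd z)) = ereal (\<integral>z. fst z \<bullet> snd z \<partial>(\<rho> \<Otimes>\<^sub>M \<mu>))"
    by (rule ext_integral_real[OF int]) simp
  also have "(\<integral>z. fst z \<bullet> snd z \<partial>(\<rho> \<Otimes>\<^sub>M \<mu>)) = (\<integral>x. (\<integral>y. x \<bullet> y \<partial>\<mu>) \<partial>\<rho>)"
    using integral_fst'[OF int] by simp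
  also have "\<dots> = 0"
    using iy cent by simp
  finally have e0: "ext_integral (\<rho> \<Otimes>\<^sub>M \<mu>) (\<lambda>z. ereal (fst z \<bullet> snd z)) = 0" by simp
  have "ext_integral_meaningful (\<rho> \<Otimes>\<^sub>M \<mu>) (\<lambda>z. ereal (fst z \<bullet> snd z))"
    unfolding ext_integral_meaningful_def using int im by (simp add: real_integrable_def less_top)
  then show ?thesis
    unfolding transport_def case_prod_beta e0[symmetric] using \<gamma> by (intro SUP_upper) auto
qed

section \<open>Optimality conditions\<close>

text \<open>The convex combination \<open>(1 - \<theta>) M + \<theta> K\<close>, realised by a
  random choice between the measures, so that integrals and almost-everywhere statements follow from
  those for \<open>bind\<close>.\<close>

definition mixture :: "real \<Rightarrow> 'a measure \<Rightarrow> 'a measure \<Rightarrow> 'a measure" where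
  "mixture \<theta> M K = measure_pmf (bernoulli_pmf \<theta>) \<bind> (\<lambda>b. if b then K else M)"

context
  fixes M K :: "'a::topological_space measure" and \<theta> :: real
  assumes M: "prob_space M" "sets M = sets borel" and K: "prob_space K" "sets K = sets borel"
    and \<theta>: "0 \<le> \<theta>" "\<theta> \<le> 1"
begin

lemma sets_mixture: "sets (mixture \<theta> M K) = sets borel"
  unfolding mixture_def by (rule sets_bind) (auto simp: M K)

lemma mixture_kernel: "(\<lambda>b. if b then K else M) \<in> measurable (measure_pmf (bernoulli_pmf \<theta>)) (subprob_algebra borel)"
  using M K by (auto simp: space_subprob_algebra prob_space_imp_subprob_space)

lemma nn_integral_mixture:
  assumes f: "f \<in> borel_measurable borel"
  shows "(\<integral>\<^sup>+x. f x \<partial>mixture \<theta> M K) = ennreal \<theta> * (\<integral>\<^sup>+x. f x \<partial>K) + ennreal (1 - \<theta>) * (\<integral>\<^sup>+x. f x \<partial>M)"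
  unfolding mixture_def nn_integral_bind[OF f mixture_kernel] using \<theta> by (simp add: mult.commute)

lemma emeasure_mixture:
  assumes A: "A \<in> sets borel"
  shows "emeasure (mixture \<theta> M K) A = ennreal \<theta> * emeasure K A + ennreal (1 - \<theta>) * emeasure M A"
  using nn_integral_mixture[of "indicator A"] A by (simp add: sets_mixture M K)

lemma prob_space_mixture: "prob_space (mixture \<theta> M K)"
proof
  have "space (mixture \<theta> M K) = UNIV" using sets_eq_imp_space_eq[OF sets_mixture] by simp
  moreover have "emeasure K UNIV = 1" "emeasure M UNIV = 1"
    using prob_space.emeasure_space_1[OF K(1)] prob_space.emeasure_space_1[OF M(1)]
      sets_eq_imp_space_eq[OF K(2)] sets_eq_imp_space_eq[OF M(2)] by simp_all
  ultimately show "emeasure (mixture \<theta> M K) (space (mixture \<theta> M K)) = 1"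
    using \<theta> by (simp add: emeasure_mixture ennreal_plus[symmetric] del: ennreal_plus)
qed

lemma integral_mixture:
  fixes f :: "'a \<Rightarrow> real"
  assumes f: "integrable M f" "integrable K f"
  shows "integrable (mixture \<theta> M K) f"
    "(\<integral>x. f x \<partial>mixture \<theta> M K) = \<theta> * (\<integral>x. f x \<partial>K) + (1 - \<theta>) * (\<integral>x. f x \<partial>M)"
proof -
  have m: "f \<in> borel_measurable borel"
    using f(1) M(2) by (auto dest!: borel_measurable_integrable cong: measurable_cong_sets)
  have m': "f \<in> borel_measurable (mixture \<theta> M K)"
    by (rule measurable_from_borel[OF sets_mixture m])
  have fin: "(\<integral>\<^sup>+x. ennreal (f x) \<partial>M) \<noteq> \<infinity>" "(\<integral>\<^sup>+x. ennreal (- f x) \<partial>M) \<noteq> \<infinity>"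
    "(\<integral>\<^sup>+x. ennreal (f x) \<partial>K) \<noteq> \<infinity>" "(\<integral>\<^sup>+x. ennreal (- f x) \<partial>K) \<noteq> \<infinity>"
    using f by (auto simp: real_integrable_def)
  have eq: "(\<integral>\<^sup>+x. ennreal (f x) \<partial>mixture \<theta> M K) = ennreal \<theta> * (\<integral>\<^sup>+x. ennreal (f x) \<partial>K) + ennreal (1 - \<theta>) * (\<integral>\<^sup>+x. ennreal (f x) \<partial>M)"
    "(\<integral>\<^sup>+x. ennreal (- f x) \<partial>mixture \<theta> M K) = ennreal \<theta> * (\<integral>\<^sup>+x. ennreal (- f x) \<partial>K) + ennreal (1 - \<theta>) * (\<integral>\<^sup>+x. ennreal (- f x) \<partial>M)"
    by (rule nn_integral_mixture, use m in measurable)+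
  have fin': "ennreal \<theta> * (\<integral>\<^sup>+x. ennreal (f x) \<partial>K) < top" "ennreal (1 - \<theta>) * (\<integral>\<^sup>+x. ennreal (f x) \<partial>M) < top"
     "ennreal \<theta> * (\<integral>\<^sup>+x. ennreal (- f x) \<partial>K) < top" "ennreal (1 - \<theta>) * (\<integral>\<^sup>+x. ennreal (- f x) \<partial>M) < top"
    using fin by (auto simp: ennreal_mult_less_top less_top)
  show i: "integrable (mixture \<theta> M K) f"
    unfolding real_integrable_def eq using m' fin' by (auto simp: less_top[symmetric])
  show "(\<integral>x. f x \<partial>mixture \<theta> M K) = \<theta> * (\<integral>x. f x \<partial>K) + (1 - \<theta>) * (\<integral>x. f x \<partial>M)"
    unfolding real_lebesgue_integral_def[OF i] real_lebesgue_integral_def[OF f(1)] real_lebesgue_integral_def[OF f(2)] eq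
    using \<theta> fin' by (simp add: enn2real_plus enn2real_mult algebra_simps)
qed

lemma AE_mixture:
  assumes P: "{x. P x} \<in> sets borel" and ae: "AE x in M. P x" "AE x in K. P x"
  shows "AE x in mixture \<theta> M K. P x"
proof -
  have "Measurable.pred borel P" using P by (simp add: pred_def)
  from AE_bind[OF mixture_kernel this] show ?thesis
    unfolding mixture_def using ae by (auto intro!: AE_I2)
qed

end

text \<open>Concavity of the power: its graph lies below the tangent at \<open>x\<close>. By
  homogeneity this is Young's inequality for \<open>y / x\<close> and 1.\<close>

lemma powr_tangent:
  fixes x y :: real
  assumes \<alpha>: "0 < \<alpha>" "\<alpha> < 1" and "0 < x" "0 \<le> y"
  shows "y powr \<alpha> \<le> x powr \<alpha> + \<alpha> * x powr (\<alpha> - 1) * (y - x)"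
proof -
  have x1: "x powr \<alpha> = x * x powr (\<alpha> - 1)"
    using \<open>0 < x\<close> by (simp add: powr_mult_base)
  have "(y / x) powr \<alpha> \<le> \<alpha> * (y / x) + (1 - \<alpha>)"
  proof (cases "y = 0")
    case False
    then show ?thesis
      using Youngs_inequality_0[of \<alpha> "1 - \<alpha>" "y / x" 1] assms by simp
  qed (use \<alpha> in simp)
  then have "x powr \<alpha> * (y / x) powr \<alpha> \<le> x powr \<alpha> * (\<alpha> * (y / x) + (1 - \<alpha>))"
    by (intro mult_left_mono) auto
  also have "x powr \<alpha> * (y / x) powr \<alpha> = y powr \<alpha>"
    using assms by (simp add: powr_mult[symmetric])
  also have "x powr \<alpha> * (\<alpha> * (y / x) + (1 - \<alpha>)) = x powr \<alpha> + \<alpha> * x powr (\<alpha> - 1) * (y - x)"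
    unfolding x1 using \<open>0 < x\<close> by (simp add: field_simps)
  finally show ?thesis .
qed

lemma lebesgue_decomposition_mixture:
  fixes \<rho> :: "'a::euclidean_space measure"
  assumes \<rho>: "prob_space \<rho>" "sets \<rho> = sets borel" and d: "lebesgue_decomposition \<rho> g \<nu>"
    and k[measurable]: "k \<in> borel_measurable borel" and k0: "\<And>x. 0 \<le> k x"
    and \<sigma>: "prob_space (density lborel (\<lambda>x. ennreal (k x)))" and \<theta>: "0 \<le> \<theta>" "\<theta> \<le> 1"
  shows "lebesgue_decomposition (mixture \<theta> \<rho> (density lborel (\<lambda>x. ennreal (k x))))
    (\<lambda>x. (1 - \<theta>) * g x + \<theta> * k x) (scale_measure (ennreal (1 - \<theta>)) \<nu>)"
proof -
  from d have [measurable]: "g \<in> borel_measurable borel" and g0: "\<And>x. 0 \<le> g x"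
    and s\<nu>: "sets \<nu> = sets borel" and N: "\<exists>N\<in>null_sets lborel. emeasure \<nu> (- N) = 0"
    and eq: "\<And>A. A \<in> sets borel \<Longrightarrow> emeasure \<rho> A = (\<integral>\<^sup>+x\<in>A. ennreal (g x) \<partial>lborel) + emeasure \<nu> A"
    by (auto simp: lebesgue_decomposition_def)
  have "emeasure (mixture \<theta> \<rho> (density lborel (\<lambda>x. ennreal (k x)))) A =
      (\<integral>\<^sup>+x\<in>A. ennreal ((1 - \<theta>) * g x + \<theta> * k x) \<partial>lborel) + emeasure (scale_measure (ennreal (1 - \<theta>)) \<nu>) A"
    if [measurable]: "A \<in> sets borel" for A
  proof -
    have "(\<integral>\<^sup>+x\<in>A. ennreal ((1 - \<theta>) * g x + \<theta> * k x) \<partial>lborel) =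
        (\<integral>\<^sup>+x. ennreal (1 - \<theta>) * (ennreal (g x) * indicator A x) + ennreal \<theta> * (ennreal (k x) * indicator A x) \<partial>lborel)"
      using \<theta> g0 k0 by (intro nn_integral_cong) (simp add: indicator_def ennreal_mult ennreal_plus)
    also have "\<dots> = ennreal (1 - \<theta>) * (\<integral>\<^sup>+x\<in>A. ennreal (g x) \<partial>lborel) + ennreal \<theta> * (\<integral>\<^sup>+x\<in>A. ennreal (k x) \<partial>lborel)"
      by (subst nn_integral_add) (auto simp: nn_integral_cmult)
    finally show ?thesis
      using emeasure_mixture[OF \<rho> \<sigma> _ \<theta>, of A]
      by (simp add: eq emeasure_density distrib_left add_ac)
  qed
  then show ?thesis
    unfolding lebesgue_decomposition_def using g0 k0 \<theta> N s\<nu> by (auto simp: emeasure_scale_measure)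
qed

lemma density_mem_P1:
  fixes k :: "'a::euclidean_space \<Rightarrow> real"
  assumes k[measurable]: "k \<in> borel_measurable borel" and k0: "\<And>x. 0 \<le> k x"
    and 1: "(\<integral>\<^sup>+x. ennreal (k x) \<partial>lborel) = 1" and R: "\<And>x. k x \<noteq> 0 \<Longrightarrow> norm x \<le> R"
  shows "density lborel (\<lambda>x. ennreal (k x)) \<in> P1" (is "?\<sigma> \<in> _")
    "AE x in density lborel (\<lambda>x. ennreal (k x)). k x \<noteq> 0"
proof -
  interpret prob_space ?\<sigma>
    using 1 by (intro prob_spaceI) (simp add: emeasure_density)
  show ae: "AE x in ?\<sigma>. k x \<noteq> 0"
    by (subst AE_density) auto
  have "integrable ?\<sigma> norm"
    by (rule integrable_const_bound[where B=R]) (use ae R in \<open>auto elim!: eventually_mono\<close>)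
  then show "?\<sigma> \<in> P1" using prob_space_axioms by (simp add: P1_def)
qed

text \<open>The problem after duality: transport is linearised at the fixed potential
  \<open>u\<close>, and competitors must give \<open>u\<close> a finite integral. Assumption
  \<open>nontrivial\<close> will provide a set of positive volume on which \<open>u\<close> is
  finite.\<close>

locale entropic_minimizer =
  fixes \<rho> :: "'a::euclidean_space measure" and u :: "'a \<Rightarrow> ereal" and q :: real
  assumes \<rho>: "\<rho> \<in> P1" and q: "q > 1" and u_meas[measurable]: "u \<in> borel_measurable borel"
    and u_bot: "\<And>x. u x \<noteq> - \<infinity>" and u_convex: "convex_ereal u"
    and u_int: "integrable \<rho> (\<lambda>x. real_of_ereal (u x))"
    and u_fin: "AE x in \<rho>. u x \<noteq> \<infinity>"
    and minimal: "\<And>\<rho>'. \<rho>' \<in> P1 \<Longrightarrow> AE x in \<rho>'. u x \<noteq> \<infinity> \<Longrightarrow> integrable \<rho>' (\<lambda>x. real_of_ereal (u x)) \<Longrightarrow>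
      - (1 / alpha DIM('a) q) * (\<integral>x. ac_density \<rho> x powr alpha DIM('a) q \<partial>lborel) + (\<integral>x. real_of_ereal (u x) \<partial>\<rho>)
      \<le> - (1 / alpha DIM('a) q) * (\<integral>x. ac_density \<rho>' x powr alpha DIM('a) q \<partial>lborel) + (\<integral>x. real_of_ereal (u x) \<partial>\<rho>')"
    and nontrivial: "\<not> (AE x in lborel. ac_density \<rho> x = 0)"
begin

definition "p = real DIM('a) + q"
definition "\<alpha> = alpha DIM('a) q"
definition "g = ac_density \<rho>"
definition "v x = real_of_ereal (u x)"
definition "I = (\<integral>x. g x powr \<alpha> \<partial>lborel)"
text \<open>The multiplier of the mass constraint: the \<open>\<rho>\<close>-average of
  \<open>u + f'(g)\<close>, with \<open>f'(g)\<close> replaced by 0 on the singular part, since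
  \<open>I\<close> is the integral of \<open>g powr (\<alpha> - 1)\<close> against the absolutely
  continuous part.\<close>

definition "c = (\<integral>x. v x \<partial>\<rho>) - I"

lemmas \<alpha> = alpha_facts[OF q p_def, folded \<alpha>_def]

lemma g_meas [measurable]: "g \<in> borel_measurable borel" and g_nonneg: "0 \<le> g x"
  using ac_densityD[OF \<rho>] by (auto simp: g_def)

lemma v_meas [measurable]: "v \<in> borel_measurable borel"
  unfolding v_def by measurable

lemma u_eq_v: "u x \<noteq> \<infinity> \<Longrightarrow> u x = ereal (v x)"
  unfolding v_def using u_bot[of x] by (cases "u x") auto

lemma prob_\<rho>: "prob_space \<rho>" and sets_\<rho>: "sets \<rho> = sets borel"
  using P1D[OF \<rho>] by auto

lemma g_powr_integrable: "integrable lborel (\<lambda>x. g x powr \<alpha>)"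
  unfolding g_def \<alpha>_def by (rule integrable_ac_density_powr[OF \<rho> q])

lemma I_nonneg: "0 \<le> I"
  unfolding I_def by (rule integral_nonneg_AE) simp

text \<open>Competitor: move a fraction \<open>\<theta>\<close> of the mass to the uniform distribution on \<open>A\<close>.\<close>

lemma violation_null:
  fixes R \<eta> :: real
  assumes \<eta>: "0 < \<eta>"
  defines "A \<equiv> {x. norm x \<le> R \<and> u x \<le> ereal R \<and> ereal (- R) \<le> u x \<and> v x - c + \<eta> \<le> (g x + \<eta>) powr (\<alpha> - 1)}"
  shows "A \<in> null_sets lborel"
proof (rule ccontr)
  assume nn: "A \<notin> null_sets lborel"
  have [measurable]: "A \<in> sets borel" unfolding A_def by measurable
  have "emeasure lborel A \<le> emeasure lborel (cball (0::'a) R)"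
    by (rule emeasure_mono) (auto simp: A_def)
  also have "\<dots> < \<infinity>" using emeasure_bounded_finite[of "cball (0::'a) R"] by simp
  finally have fin: "emeasure lborel A < \<infinity>" .
  define a where "a = measure lborel A"
  have ea: "emeasure lborel A = ennreal a"
    unfolding a_def using fin by (intro emeasure_eq_ennreal_measure) auto
  then have a: "a > 0"
    using nn by (cases "a = 0") (auto simp: null_sets_def a_def less_le)
  \<comment> \<open>The bound \<open>1 / 2\<close> controls the expansion of
    \<open>(1 - \<theta>) powr \<alpha>\<close>, \<open>\<eta> * a\<close> keeps the added density
    \<open>\<theta> / a\<close> below \<open>\<eta>\<close>, and the last bound makes the
    second-order error \<open>2 * \<theta> * I\<close> smaller than \<open>\<eta>\<close>.\<close>
  define \<theta> where "\<theta> = min (1 / 2) (min (\<eta> * a) (\<eta> / (4 * (I + 1))))"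
  have \<theta>: "0 < \<theta>" "\<theta> \<le> 1 / 2" "\<theta> \<le> \<eta> * a" "\<theta> \<le> \<eta> / (4 * (I + 1))"
  proof -
    show "0 < \<theta>" using \<eta> a I_nonneg by (simp add: \<theta>_def)
    show "\<theta> \<le> 1 / 2" unfolding \<theta>_def by (rule min.cobounded1)
    show "\<theta> \<le> \<eta> * a" unfolding \<theta>_def by (rule order_trans[OF min.cobounded2 min.cobounded1])
    show "\<theta> \<le> \<eta> / (4 * (I + 1))" unfolding \<theta>_def by (rule order_trans[OF min.cobounded2 min.cobounded2])
  qed
  have \<theta>a: "\<theta> / a \<le> \<eta>" using \<theta>(3) a by (simp add: field_simps)
  define k where "k x = indicator A x / a" for x
  have [measurable]: "k \<in> borel_measurable borel" unfolding k_def by measurable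
  have k0: "0 \<le> k x" for x using a by (simp add: k_def)
  have k1: "(\<integral>\<^sup>+x. ennreal (k x) \<partial>lborel) = 1"
  proof -
    have "(\<integral>\<^sup>+x. ennreal (k x) \<partial>lborel) = (\<integral>\<^sup>+x. ennreal (1 / a) * indicator A x \<partial>lborel)"
      by (intro nn_integral_cong) (simp add: k_def indicator_def)
    also have "\<dots> = ennreal (1 / a) * ennreal a"
      by (simp add: nn_integral_cmult_indicator ea)
    also have "\<dots> = 1" using a by (simp add: ennreal_mult[symmetric])
    finally show ?thesis .
  qed
  have kA: "k x \<noteq> 0 \<Longrightarrow> x \<in> A" for x by (auto simp: k_def indicator_def)
  define \<sigma> where "\<sigma> = density lborel (\<lambda>x. ennreal (k x))"
  \<comment> \<open>The cut-offs by \<open>R\<close> in \<open>A\<close> make the competitor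
    legitimate: bounded support gives a first moment, and bounded \<open>u\<close> a finite
    integral.\<close>
  have \<sigma>: "\<sigma> \<in> P1" and aeA: "AE x in \<sigma>. x \<in> A"
    using density_mem_P1[of k R] k0 k1 kA unfolding \<sigma>_def by (auto simp: A_def elim!: eventually_mono)
  interpret \<sigma>: prob_space \<sigma> using P1D[OF \<sigma>] by simp
  interpret prob_space \<rho> by (rule prob_\<rho>)
  have s\<sigma>[measurable_cong]: "sets \<sigma> = sets borel" by (simp add: \<sigma>_def)
  note mx = prob_\<rho> sets_\<rho> \<sigma>.prob_space_axioms s\<sigma>
  have \<theta>': "0 \<le> \<theta>" "\<theta> \<le> 1" using \<theta> by auto
  define \<rho>' where "\<rho>' = mixture \<theta> \<rho> \<sigma>"
  define h where "h x = (1 - \<theta>) * g x + \<theta> * k x" for x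
  have Au: "u x \<noteq> \<infinity>" "\<bar>v x\<bar> \<le> R" if "x \<in> A" for x
    using that unfolding A_def v_def by (cases "u x"; auto)+
  have v\<sigma>: "integrable \<sigma> v"
    by (rule \<sigma>.integrable_const_bound[where B=R]) (use aeA Au in \<open>auto elim!: eventually_mono\<close>)
  have v\<rho>: "integrable \<rho> v" using u_int unfolding v_def[abs_def] .
  have P1': "\<rho>' \<in> P1"
    unfolding \<rho>'_def P1_def
    using prob_space_mixture[OF mx \<theta>'] sets_mixture[OF mx \<theta>'] integral_mixture(1)[OF mx \<theta>'] P1D(3)[OF \<rho>] P1D(3)[OF \<sigma>]
    by simp
  have d': "lebesgue_decomposition \<rho>' h (scale_measure (ennreal (1 - \<theta>)) (sing_part \<rho>))"
    unfolding \<rho>'_def \<sigma>_def h_def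
    by (rule lebesgue_decomposition_mixture)
      (use prob_\<rho> sets_\<rho> ac_densityD(3)[OF \<rho>] k0 \<theta>' \<sigma>.prob_space_axioms in \<open>auto simp: g_def \<sigma>_def\<close>)
  have h_ae: "AE x in lborel. ac_density \<rho>' x = h x"
    using P1D[OF P1'] by (intro ac_density_unique[OF _ _ d']) (auto simp: prob_space_def)
  have [measurable]: "ac_density \<rho>' \<in> borel_measurable borel" by (rule ac_densityD(1)[OF P1'])
  have [measurable]: "h \<in> borel_measurable borel" unfolding h_def by measurable
  have h_int: "integrable lborel (\<lambda>x. h x powr \<alpha>)"
  proof (rule integrable_cong_AE_imp)
    show "integrable lborel (\<lambda>x. ac_density \<rho>' x powr \<alpha>)"
      unfolding \<alpha>_def by (rule integrable_ac_density_powr[OF P1' q])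
    show "AE x in lborel. ac_density \<rho>' x powr \<alpha> = h x powr \<alpha>"
      using h_ae by eventually_elim simp
  qed measurable
  have h_eq: "(\<integral>x. ac_density \<rho>' x powr \<alpha> \<partial>lborel) = (\<integral>x. h x powr \<alpha> \<partial>lborel)"
    by (intro integral_cong_AE, measurable, use h_ae in eventually_elim) simp
  have min: "- (1 / \<alpha>) * I + (\<integral>x. v x \<partial>\<rho>) \<le> - (1 / \<alpha>) * (\<integral>x. h x powr \<alpha> \<partial>lborel) + (\<theta> * (\<integral>x. v x \<partial>\<sigma>) + (1 - \<theta>) * (\<integral>x. v x \<partial>\<rho>))"
  proof -
    have "AE x in \<rho>'. u x \<noteq> \<infinity>"
      unfolding \<rho>'_def
    proof (rule AE_mixture[OF mx \<theta>'])
      show "{x. u x \<noteq> \<infinity>} \<in> sets borel" by measurable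
      show "AE x in \<sigma>. u x \<noteq> \<infinity>" using aeA by eventually_elim (rule Au)
    qed (rule u_fin)
    from minimal[OF P1' this] integral_mixture[OF mx \<theta>' v\<rho> v\<sigma>] show ?thesis
      unfolding h_eq[symmetric] I_def \<rho>'_def[symmetric] by (simp add: v_def[abs_def] g_def \<alpha>_def)
  qed
  \<comment> \<open>A lower bound on \<open>A\<close> for \<open>h powr (\<alpha> - 1)\<close>, the
    slope at the perturbed density, which is at most \<open>g + \<theta> / a\<close>.\<close>
  define \<psi> where "\<psi> x = (g x + \<theta> / a) powr (\<alpha> - 1)" for x
  have [measurable]: "\<psi> \<in> borel_measurable borel" unfolding \<psi>_def by measurable
  have \<psi>\<sigma>: "integrable \<sigma> \<psi>"
  proof (rule \<sigma>.integrable_const_bound[where B="(\<theta> / a) powr (\<alpha> - 1)"])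
    have "\<psi> x \<le> (\<theta> / a) powr (\<alpha> - 1)" for x
      unfolding \<psi>_def using \<theta> a g_nonneg[of x] \<alpha> by (intro powr_mono2') auto
    then show "AE x in \<sigma>. norm (\<psi> x) \<le> (\<theta> / a) powr (\<alpha> - 1)"
      by (intro AE_I2) (simp add: \<psi>_def)
  qed measurable
  have k\<psi>: "integrable lborel (\<lambda>x. k x * \<psi> x)" "(\<integral>x. k x * \<psi> x \<partial>lborel) = (\<integral>x. \<psi> x \<partial>\<sigma>)"
    using \<psi>\<sigma> k0 unfolding \<sigma>_def by (simp_all add: integrable_density integral_density)
  \<comment> \<open>On \<open>A\<close> the tangent is taken at \<open>h x\<close> and evaluated at
    \<open>(1 - \<theta>) * g x\<close>; as \<open>h x > 0\<close>, this also works where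
    \<open>g x = 0\<close>.\<close>
  have pw: "(1 - \<theta>) powr \<alpha> * g x powr \<alpha> + \<alpha> * \<theta> * (k x * \<psi> x) \<le> h x powr \<alpha>" for x
  proof (cases "x \<in> A")
    case False
    then show ?thesis using \<theta> g_nonneg[of x] by (simp add: h_def k_def powr_mult)
  next
    case True
    then have kx: "k x = 1 / a" by (simp add: k_def)
    have hx: "h x = (1 - \<theta>) * g x + \<theta> / a" by (simp add: h_def kx)
    have hpos: "0 < h x" unfolding hx using \<theta> a g_nonneg[of x] by (intro add_nonneg_pos) auto
    have "((1 - \<theta>) * g x) powr \<alpha> \<le> h x powr \<alpha> + \<alpha> * h x powr (\<alpha> - 1) * ((1 - \<theta>) * g x - h x)"
      using \<alpha> hpos \<theta> g_nonneg[of x] by (intro powr_tangent) auto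
    also have "\<dots> = h x powr \<alpha> - \<alpha> * (\<theta> / a) * h x powr (\<alpha> - 1)"
      by (simp add: hx algebra_simps)
    finally have 1: "(1 - \<theta>) powr \<alpha> * g x powr \<alpha> + \<alpha> * (\<theta> / a) * h x powr (\<alpha> - 1) \<le> h x powr \<alpha>"
      using \<theta> g_nonneg[of x] by (simp add: powr_mult)
    have "h x \<le> g x + \<theta> / a"
      unfolding hx using \<theta> g_nonneg[of x] mult_right_mono[of "1 - \<theta>" 1 "g x"] by simp
    then have "\<psi> x \<le> h x powr (\<alpha> - 1)"
      unfolding \<psi>_def using hpos \<alpha> by (intro powr_mono2') auto
    then have "\<alpha> * (\<theta> / a) * \<psi> x \<le> \<alpha> * (\<theta> / a) * h x powr (\<alpha> - 1)"
      using \<alpha> \<theta> a by (intro mult_left_mono) auto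
    with 1 show ?thesis by (simp add: kx)
  qed
  have "(1 - \<theta>) powr \<alpha> * I + \<alpha> * \<theta> * (\<integral>x. \<psi> x \<partial>\<sigma>) = (\<integral>x. (1 - \<theta>) powr \<alpha> * g x powr \<alpha> + \<alpha> * \<theta> * (k x * \<psi> x) \<partial>lborel)"
    using g_powr_integrable k\<psi> by (simp add: I_def)
  also have "\<dots> \<le> (\<integral>x. h x powr \<alpha> \<partial>lborel)"
    using g_powr_integrable k\<psi>(1) h_int by (intro integral_mono pw) auto
  finally have lb: "(1 - \<theta>) powr \<alpha> * I + \<alpha> * \<theta> * (\<integral>x. \<psi> x \<partial>\<sigma>) \<le> (\<integral>x. h x powr \<alpha> \<partial>lborel)" .
  have "(\<integral>x. v x \<partial>\<sigma>) - c + \<eta> = (\<integral>x. v x + (\<eta> - c) \<partial>\<sigma>)"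
    using v\<sigma> by (simp add: \<sigma>.prob_space)
  also have "\<dots> \<le> (\<integral>x. \<psi> x \<partial>\<sigma>)"
  proof (rule integral_mono_AE)
    show "AE x in \<sigma>. v x + (\<eta> - c) \<le> \<psi> x"
      using aeA
    proof eventually_elim
      case (elim x)
      then have "v x - c + \<eta> \<le> (g x + \<eta>) powr (\<alpha> - 1)" by (simp add: A_def)
      also have "\<dots> \<le> \<psi> x"
        unfolding \<psi>_def using \<alpha> \<theta>a \<theta> a g_nonneg[of x] by (intro powr_mono2') (auto intro: add_nonneg_pos)
      finally show ?case by simp
    qed
  qed (use v\<sigma> \<psi>\<sigma> in auto)
  finally have \<psi>lb: "(\<integral>x. v x \<partial>\<sigma>) - c + \<eta> \<le> (\<integral>x. \<psi> x \<partial>\<sigma>)" .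
  have B: "1 - \<alpha> * \<theta> * (1 + 2 * \<theta>) \<le> (1 - \<theta>) powr \<alpha>"
  proof -
    have "1 powr \<alpha> \<le> (1 - \<theta>) powr \<alpha> + \<alpha> * (1 - \<theta>) powr (\<alpha> - 1) * (1 - (1 - \<theta>))"
      using \<alpha> \<theta> by (intro powr_tangent) auto
    moreover have "(1 - \<theta>) powr (\<alpha> - 1) \<le> (1 - \<theta>) powr (- 1)"
      using \<alpha> \<theta> by (intro powr_mono') auto
    moreover have "(1 - \<theta>) powr (- 1) \<le> 1 + 2 * \<theta>"
    proof -
      have "1 \<le> (1 + 2 * \<theta>) * (1 - \<theta>)" using \<theta> by (simp add: algebra_simps)
      then show ?thesis using \<theta> by (simp add: powr_minus divide_simps)
    qed
    ultimately have "(1 - \<theta>) powr (\<alpha> - 1) * (\<alpha> * \<theta>) \<le> (1 + 2 * \<theta>) * (\<alpha> * \<theta>)"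
      using \<alpha> \<theta> by (intro mult_right_mono) auto
    with \<open>1 powr \<alpha> \<le> _\<close> show ?thesis by (simp add: algebra_simps)
  qed
  define H where "H = (\<integral>x. h x powr \<alpha> \<partial>lborel)"
  define V where "V = (\<integral>x. v x \<partial>\<sigma>)"
  define U where "U = (\<integral>x. v x \<partial>\<rho>)"
  define W where "W = (1 - \<theta>) powr \<alpha>"
  have cU: "c = U - I" by (simp add: c_def U_def)
  have "\<alpha> * \<theta> * (V - c + \<eta>) \<le> \<alpha> * \<theta> * (\<integral>x. \<psi> x \<partial>\<sigma>)"
    using \<psi>lb \<alpha> \<theta> by (intro mult_left_mono) (auto simp: V_def)
  with lb have 1: "W * I + \<alpha> * \<theta> * (V - c + \<eta>) \<le> H"
    unfolding W_def H_def by linarith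
  have 2: "H - I \<le> \<alpha> * (\<theta> * (V - U))"
  proof -
    have "(1 / \<alpha>) * (H - I) \<le> \<theta> * (V - U)"
      using min unfolding H_def[symmetric] V_def[symmetric] U_def[symmetric] by (simp add: algebra_simps diff_divide_distrib)
    then have "\<alpha> * ((1 / \<alpha>) * (H - I)) \<le> \<alpha> * (\<theta> * (V - U))"
      using \<alpha> by (intro mult_left_mono) auto
    then show ?thesis using \<alpha> by simp
  qed
  \<comment> \<open>With \<open>c = U - I\<close> the first-order terms in \<open>1\<close> and
    \<open>2\<close> cancel, leaving \<open>\<eta> \<le> 2 * \<theta> * I\<close>, which the choice
    of \<open>\<theta>\<close> excludes.\<close>
  have "(1 - \<alpha> * \<theta> * (1 + 2 * \<theta>)) * I \<le> W * I"
    using B I_nonneg unfolding W_def by (intro mult_right_mono) auto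
  with 1 2 have "\<alpha> * \<theta> * (\<eta> - 2 * \<theta> * I) \<le> 0"
    unfolding cU by (simp add: algebra_simps)
  moreover have "0 < \<alpha> * \<theta>" using \<alpha> \<theta> by simp
  ultimately have "\<eta> \<le> 2 * \<theta> * I"
    using mult_pos_pos[of "\<alpha> * \<theta>" "\<eta> - 2 * \<theta> * I"] by linarith
  also have "\<dots> \<le> 2 * (\<eta> / (4 * (I + 1))) * I"
    using \<theta> I_nonneg by (intro mult_right_mono) auto
  also have "\<dots> < \<eta>"
    using \<eta> I_nonneg by (simp add: divide_simps)
  finally show False by simp
qed

end

section \<open>From the variational inequality to pointwise information\<close>

lemma emeasure_lborel_affine_image:
  fixes Z :: "'a::euclidean_space set"
  assumes Z[measurable]: "Z \<in> sets borel" and t: "0 < t"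
  shows "(\<lambda>z. a + t *\<^sub>R z) ` Z \<in> sets borel"
    "emeasure lborel ((\<lambda>z. a + t *\<^sub>R z) ` Z) = ennreal (t ^ DIM('a)) * emeasure lborel Z"
proof -
  let ?S = "(\<lambda>z. a + t *\<^sub>R z) ` Z"
  have S: "?S = (\<lambda>x. (1 / t) *\<^sub>R (x - a)) -` Z \<inter> space borel"
  proof (intro set_eqI iffI)
    fix x assume "x \<in> (\<lambda>x. (1 / t) *\<^sub>R (x - a)) -` Z \<inter> space borel"
    then show "x \<in> ?S"
      using t by (intro image_eqI[of _ _ "(1 / t) *\<^sub>R (x - a)"]) auto
  qed (use t in auto)
  show S'[measurable]: "?S \<in> sets borel"
    unfolding S by measurable
  have v: "(\<lambda>z. a + t *\<^sub>R z) -` ?S = Z"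
    using t by auto
  have "emeasure lborel ?S = emeasure (density (distr lborel borel (\<lambda>x. a + t *\<^sub>R x)) (\<lambda>_. ennreal (\<bar>t\<bar> ^ DIM('a)))) ?S"
    using lborel_affine[of t a] t by simp
  also have "\<dots> = ennreal (t ^ DIM('a)) * emeasure (distr lborel borel (\<lambda>x. a + t *\<^sub>R x)) ?S"
    using t by (subst emeasure_density) (auto simp: nn_integral_cmult_indicator)
  also have "emeasure (distr lborel borel (\<lambda>x. a + t *\<^sub>R x)) ?S = emeasure lborel Z"
    by (subst emeasure_distr) (auto simp: v)
  finally show "emeasure lborel ?S = ennreal (t ^ DIM('a)) * emeasure lborel Z" .
qed

context entropic_minimizer
begin

text \<open>Discard the null sets for \<open>R = k\<close> and \<open>\<eta> = 1 / (k + 1)\<close>,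
  then let \<open>k\<close> grow at a fixed point. If \<open>g\<close> vanished there, the power
  would blow up while \<open>v\<close> stays finite: the infinite slope of f at 0 forces positive
  density wherever \<open>u\<close> is finite.\<close>

lemma ae_lower_bound:
  "AE x in lborel. u x \<noteq> \<infinity> \<longrightarrow> 0 < g x \<and> g x powr (\<alpha> - 1) \<le> v x - c"
proof -
  have "AE x in lborel. \<forall>k::nat. \<not> (norm x \<le> real k \<and> u x \<le> ereal (real k) \<and> ereal (- real k) \<le> u x \<and>
      v x - c + 1 / (real k + 1) \<le> (g x + 1 / (real k + 1)) powr (\<alpha> - 1))"
    unfolding AE_all_countable
  proof
    fix k :: nat
    show "AE x in lborel. \<not> (norm x \<le> real k \<and> u x \<le> ereal (real k) \<and> ereal (- real k) \<le> u x \<and>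
      v x - c + 1 / (real k + 1) \<le> (g x + 1 / (real k + 1)) powr (\<alpha> - 1))"
      using AE_not_in[OF violation_null[of "1 / (real k + 1)" "real k"]] by (auto elim!: eventually_mono)
  qed
  then show ?thesis
  proof eventually_elim
    case (elim x)
    show ?case
    proof
      assume "u x \<noteq> \<infinity>"
      then have ux: "u x = ereal (v x)" by (rule u_eq_v)
      obtain K :: nat where K: "norm x + \<bar>v x\<bar> \<le> real K"
        using real_arch_simple by blast
      have lt: "(g x + 1 / (real k + 1)) powr (\<alpha> - 1) < v x - c + 1 / (real k + 1)" if "K \<le> k" for k
      proof -
        have "norm x \<le> real k \<and> u x \<le> ereal (real k) \<and> ereal (- real k) \<le> u x"
          using K that unfolding ux by simp (smt (verit) norm_ge_zero of_nat_mono)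
        then show ?thesis using elim[rule_format, of k] by auto
      qed
      have gpos: "g x > 0"
      proof (rule ccontr)
        assume "\<not> g x > 0"
        then have g0: "g x = 0" using g_nonneg[of x] by simp
        define b where "b = \<bar>v x - c\<bar> + 1"
        \<comment> \<open>Chosen so that \<open>(k + 1) powr (1 - \<alpha>)\<close> reaches
          \<open>b\<close>, which dominates \<open>v x - c + 1 / (k + 1)\<close>.\<close>
        obtain k :: nat where k: "real K + b powr (1 / (1 - \<alpha>)) \<le> real k"
          using real_arch_simple by blast
        then have "K \<le> k" by (metis add_increasing2 le_add_same_cancel1 of_nat_le_iff order_trans powr_ge_zero)
        have "b = (b powr (1 / (1 - \<alpha>))) powr (1 - \<alpha>)"
          using \<alpha> by (simp add: powr_powr b_def)
        also have "\<dots> \<le> (real k + 1) powr (1 - \<alpha>)"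
          using k \<alpha> by (intro powr_mono2) auto
        also have "\<dots> = (g x + 1 / (real k + 1)) powr (\<alpha> - 1)"
          by (simp add: g0 powr_divide powr_minus_divide[symmetric] powr_one_eq_one)
        also have "\<dots> < v x - c + 1 / (real k + 1)" by (rule lt[OF \<open>K \<le> k\<close>])
        also have "\<dots> \<le> b" unfolding b_def by (intro add_mono) auto
        finally show False by simp
      qed
      have "g x powr (\<alpha> - 1) \<le> v x - c"
      proof (rule LIMSEQ_le)
        have z: "(\<lambda>k. 1 / (real k + 1)) \<longlonglongrightarrow> 0"
          using LIMSEQ_inverse_real_of_nat by (simp add: inverse_eq_divide add.commute)
        have "(\<lambda>k. (g x + 1 / (real k + 1)) powr (\<alpha> - 1)) \<longlonglongrightarrow> (g x + 0) powr (\<alpha> - 1)"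
          using gpos by (intro tendsto_powr tendsto_add z tendsto_const) auto
        then show "(\<lambda>k. (g x + 1 / (real k + 1)) powr (\<alpha> - 1)) \<longlonglongrightarrow> g x powr (\<alpha> - 1)" by simp
        have "(\<lambda>k. v x - c + 1 / (real k + 1)) \<longlonglongrightarrow> v x - c + 0"
          by (intro tendsto_add z tendsto_const)
        then show "(\<lambda>k. v x - c + 1 / (real k + 1)) \<longlonglongrightarrow> v x - c" by simp
        show "\<exists>N. \<forall>k\<ge>N. (g x + 1 / (real k + 1)) powr (\<alpha> - 1) \<le> v x - c + 1 / (real k + 1)"
          using lt by (auto intro!: exI[of _ K] less_imp_le)
      qed
      with gpos show "0 < g x \<and> g x powr (\<alpha> - 1) \<le> v x - c" by simp
    qed
  qed
qed

lemma ae_g_zero: "AE x in lborel. u x = \<infinity> \<longrightarrow> g x = 0"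
proof -
  have m: "{x. u x = \<infinity>} \<in> sets borel" by measurable
  have "(\<integral>\<^sup>+x. ennreal (g x) * indicator {x. u x = \<infinity>} x \<partial>lborel) \<le> (\<integral>\<^sup>+x. indicator {x. u x = \<infinity>} x \<partial>\<rho>)"
    unfolding g_def using m by (intro nn_integral_ac_density_le[OF \<rho>]) simp
  also have "\<dots> = (\<integral>\<^sup>+x. 0 \<partial>\<rho>)"
    by (intro nn_integral_cong_AE) (use u_fin in \<open>auto elim!: eventually_mono\<close>)
  finally have "(\<integral>\<^sup>+x. ennreal (g x) * indicator {x. u x = \<infinity>} x \<partial>lborel) = 0" by simp
  then have "AE x in lborel. ennreal (g x) * indicator {x. u x = \<infinity>} x = 0"
    by (subst (asm) nn_integral_0_iff_AE) (use m in auto)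
  then show ?thesis
    by eventually_elim (use g_nonneg in \<open>auto simp: indicator_def order_antisym\<close>)
qed

text \<open>If all sets where \<open>x\<close> and \<open>u\<close> are bounded were null,
  \<open>u\<close> would be infinite and hence \<open>g\<close> zero almost everywhere. The set
  obtained is the base of the cones of segments used below.\<close>

lemma finite_region:
  obtains Z m where "Z \<in> sets borel" "0 < emeasure lborel Z" "emeasure lborel Z < \<infinity>"
    "\<And>z. z \<in> Z \<Longrightarrow> u z \<le> ereal m"
proof -
  define Z where "Z k = {x. norm x \<le> real k \<and> u x \<le> ereal (real k)}" for k :: nat
  have Z[measurable]: "Z k \<in> sets borel" for k unfolding Z_def by measurable
  have "\<exists>k. emeasure lborel (Z k) \<noteq> 0"
  proof (rule ccontr)
    assume "\<not> ?thesis"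
    then have "Z k \<in> null_sets lborel" for k by (auto simp: null_sets_def)
    then have "AE x in lborel. \<forall>k. x \<notin> Z k"
      unfolding AE_all_countable by (auto intro: AE_not_in)
    then have "AE x in lborel. g x = 0"
      using ae_g_zero
    proof eventually_elim
      case (elim x)
      have "u x = \<infinity>"
      proof (rule ccontr)
        assume "u x \<noteq> \<infinity>"
        then have ux: "u x = ereal (v x)" by (rule u_eq_v)
        obtain k :: nat where k: "max (norm x) (v x) \<le> real k"
          using real_arch_simple by blast
        then have "x \<in> Z k" by (simp add: Z_def ux)
        with elim show False by blast
      qed
      with elim show ?case by simp
    qed
    with nontrivial show False by (simp add: g_def)
  qed
  then obtain k where k: "emeasure lborel (Z k) \<noteq> 0" by blast
  have "emeasure lborel (Z k) \<le> emeasure lborel (cball (0::'a) (real k))"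
    by (rule emeasure_mono) (auto simp: Z_def)
  also have "\<dots> < \<infinity>" using emeasure_bounded_finite[of "cball (0::'a) (real k)"] by simp
  finally show thesis
    using k by (intro that[of "Z k" "real k"]) (auto simp: Z_def zero_less_iff_neq_zero)
qed

lemma segment_bound:
  assumes "u x = ereal a" "u z \<le> ereal m" "0 < t" "t < 1"
  shows "u ((1 - t) *\<^sub>R x + t *\<^sub>R z) \<le> ereal ((1 - t) * a + t * m)"
proof -
  have "u ((1 - t) *\<^sub>R x + t *\<^sub>R z) \<le> ereal (1 - t) * u x + ereal t * u z"
    using u_convex assms unfolding convex_ereal_def by blast
  also have "\<dots> \<le> ereal (1 - t) * ereal a + ereal t * ereal m"
    using assms by (intro add_mono ereal_mult_left_mono) auto
  finally show ?thesis by simp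
qed

text \<open>Were \<open>u x < c\<close> at one point, convexity would keep \<open>u\<close> below
  \<open>c\<close> on a copy of \<open>Z\<close> contracted towards \<open>x\<close>. That copy has
  positive volume, against the almost-everywhere bound.\<close>

lemma u_ge_c: "ereal c \<le> u x"
proof (rule ccontr)
  assume "\<not> ereal c \<le> u x"
  then have "u x \<noteq> \<infinity>" "u x < ereal c" by auto
  then have ux: "u x = ereal (v x)" by (intro u_eq_v)
  with \<open>u x < ereal c\<close> have vc: "v x < c" by simp
  obtain Z m where Z: "Z \<in> sets borel" "0 < emeasure lborel Z" "\<And>z. z \<in> Z \<Longrightarrow> u z \<le> ereal m"
    using finite_region by metis
  \<comment> \<open>Small enough that moving towards \<open>Z\<close> raises the convex bound by at
    most half of the gap \<open>c - v x\<close>.\<close>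
  define t where "t = min (1 / 2) ((c - v x) / (2 * (\<bar>m - v x\<bar> + 1)))"
  have t: "0 < t" "t < 1" "t \<le> (c - v x) / (2 * (\<bar>m - v x\<bar> + 1))"
  proof -
    have "0 < (c - v x) / (2 * (\<bar>m - v x\<bar> + 1))"
      using vc by (intro divide_pos_pos) (simp_all add: add_nonneg_pos)
    then show "0 < t" unfolding t_def by simp
    have "t \<le> 1 / 2" unfolding t_def by (rule min.cobounded1)
    then show "t < 1" by simp
    show "t \<le> (c - v x) / (2 * (\<bar>m - v x\<bar> + 1))" unfolding t_def by (rule min.cobounded2)
  qed
  let ?S = "(\<lambda>z. (1 - t) *\<^sub>R x + t *\<^sub>R z) ` Z"
  have S: "?S \<in> sets borel" "emeasure lborel ?S > 0"
    using emeasure_lborel_affine_image[OF Z(1) t(1)] Z(2) t(1) by (auto simp: ennreal_zero_less_mult_iff)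
  have "AE y in lborel. ereal c \<le> u y"
    using ae_lower_bound
  proof eventually_elim
    case (elim y)
    show ?case
    proof (cases "u y = \<infinity>")
      case False
      then have "0 \<le> v y - c" using elim by (meson order_trans powr_ge_zero)
      then show ?thesis using u_eq_v[OF False] by simp
    qed simp
  qed
  have "\<exists>y\<in>?S. ereal c \<le> u y"
  proof (rule ccontr)
    assume "\<not> ?thesis"
    then have "AE y in lborel. y \<notin> ?S"
      using \<open>AE y in lborel. ereal c \<le> u y\<close> by (auto elim!: eventually_mono)
    then have "emeasure lborel ?S = 0"
      using S(1) AE_iff_null_sets[of ?S lborel] by (auto simp: null_sets_def)
    with S(2) show False by simp
  qed
  then obtain z where z: "z \<in> Z" "ereal c \<le> u ((1 - t) *\<^sub>R x + t *\<^sub>R z)" by auto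
  then have "ereal c \<le> ereal ((1 - t) * v x + t * m)"
    using segment_bound[OF ux Z(3)[OF z(1)] t(1,2)] order_trans by blast
  then have "c - v x \<le> t * (m - v x)" by (simp add: algebra_simps)
  also have "\<dots> \<le> t * (\<bar>m - v x\<bar> + 1)"
    using t by (intro mult_left_mono) auto
  also have "\<dots> \<le> (c - v x) / (2 * (\<bar>m - v x\<bar> + 1)) * (\<bar>m - v x\<bar> + 1)"
    using t by (intro mult_right_mono) auto
  also have "\<dots> = (c - v x) / 2"
  proof -
    have "\<bar>m - v x\<bar> + 1 \<noteq> 0" by linarith
    then show ?thesis by (simp add: divide_simps)
  qed
  finally show False using vc by simp
qed

text \<open>The function \<open>v - f - c\<close> is nonnegative \<open>\<rho>\<close>-almost
  everywhere, by the density bound off \<open>N\<close> and by \<open>u_ge_c\<close> on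
  \<open>N\<close>, and its \<open>\<rho>\<close>-integral is 0 by the choice of \<open>c\<close>.
  So it vanishes, settling the absolutely continuous and the singular part at once.\<close>

lemma equality_on_support:
  obtains N where "N \<in> null_sets lborel" "N \<in> sets borel"
    "\<And>A. A \<in> sets borel \<Longrightarrow> emeasure (sing_part \<rho>) A = emeasure \<rho> (A \<inter> N)"
    "AE x in \<rho>. u x = ereal (c + (if x \<in> N then 0 else g x powr (\<alpha> - 1)))"
    "AE x in lborel. 0 < g x \<longrightarrow> u x = ereal (c + g x powr (\<alpha> - 1))"
proof -
  interpret prob_space \<rho> by (rule prob_\<rho>)
  note [measurable_cong] = sets_\<rho>
  obtain N where N: "N \<in> null_sets lborel" and Nb[measurable]: "N \<in> sets borel"
    and dN: "density \<rho> (indicator (- N)) = density lborel (\<lambda>x. ennreal (g x))"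
    and sing: "\<And>A. A \<in> sets borel \<Longrightarrow> emeasure (sing_part \<rho>) A = emeasure \<rho> (A \<inter> N)"
    using lebesgue_decompositionE[OF ac_densityD(3)[OF \<rho>] sets_\<rho>] unfolding g_def by metis
  \<comment> \<open>Off \<open>N\<close>, \<open>\<rho>\<close> is the measure with Lebesgue density
    \<open>g\<close>, so it sees only points with \<open>g x > 0\<close>.\<close>
  have transfer: "AE x in \<rho>. x \<notin> N \<longrightarrow> P x" if "AE x in lborel. 0 < g x \<longrightarrow> P x" for P
  proof -
    have "AE x in density lborel (\<lambda>x. ennreal (g x)). P x"
      using that by (subst AE_density) auto
    then have "AE x in density \<rho> (indicator (- N)). P x" unfolding dN .
    then show ?thesis by (subst (asm) AE_density) (auto simp: indicator_def elim!: eventually_mono)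
  qed
  define f where "f x = (if x \<in> N then 0 else g x powr (\<alpha> - 1))" for x
  have [measurable]: "f \<in> borel_measurable borel" unfolding f_def by measurable
  have "(\<integral>\<^sup>+x. ennreal (f x) \<partial>\<rho>) = (\<integral>\<^sup>+x. indicator (- N) x * ennreal (g x powr (\<alpha> - 1)) \<partial>\<rho>)"
    by (intro nn_integral_cong) (simp add: f_def)
  also have "\<dots> = (\<integral>\<^sup>+x. ennreal (g x powr (\<alpha> - 1)) \<partial>density \<rho> (indicator (- N)))"
    by (subst nn_integral_density) auto
  also have "\<dots> = (\<integral>\<^sup>+x. ennreal (g x) * ennreal (g x powr (\<alpha> - 1)) \<partial>lborel)"
    unfolding dN by (subst nn_integral_density) auto
  also have "\<dots> = (\<integral>\<^sup>+x. ennreal (g x powr \<alpha>) \<partial>lborel)"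
    using g_nonneg by (intro nn_integral_cong) (simp add: ennreal_mult[symmetric] powr_mult_base)
  also have "\<dots> = ennreal I"
    unfolding I_def using g_powr_integrable by (intro nn_integral_eq_integral) auto
  finally have "has_bochner_integral \<rho> f I"
    using I_nonneg by (intro has_bochner_integral_nn_integral) (auto simp: f_def)
  then have f: "integrable \<rho> f" "(\<integral>x. f x \<partial>\<rho>) = I"
    by (auto simp: has_bochner_integral_iff)
  have v: "integrable \<rho> v" using u_int unfolding v_def[abs_def] .
  have "AE x in lborel. 0 < g x \<longrightarrow> (u x \<noteq> \<infinity> \<longrightarrow> g x powr (\<alpha> - 1) \<le> v x - c)"
    using ae_lower_bound by eventually_elim auto
  from transfer[OF this] u_fin have "AE x in \<rho>. 0 \<le> v x - f x - c"
  proof eventually_elim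
    case (elim x)
    then show ?case using u_ge_c[of x] u_eq_v[of x] by (auto simp: f_def)
  qed
  moreover have "integrable \<rho> (\<lambda>x. v x - f x - c)" using v f by simp
  moreover have "(\<integral>x. v x - f x - c \<partial>\<rho>) = 0"
    using v f by (simp add: prob_space c_def)
  ultimately have "AE x in \<rho>. v x - f x - c = 0"
    by (subst integral_nonneg_eq_0_iff_AE[symmetric]) auto
  then have eq: "AE x in \<rho>. u x = ereal (c + f x)"
    using u_fin by eventually_elim (simp add: u_eq_v)
  then have "AE x in density \<rho> (indicator (- N)). u x = ereal (c + g x powr (\<alpha> - 1))"
    by (subst AE_density) (auto simp: f_def elim!: eventually_mono)
  then have "AE x in lborel. 0 < g x \<longrightarrow> u x = ereal (c + g x powr (\<alpha> - 1))"
    unfolding dN by (subst (asm) AE_density) auto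
  then show thesis
    using eq unfolding f_def by (intro that[OF N Nb sing])
qed

text \<open>If \<open>u\<close> came within \<open>t\<close> of \<open>c\<close> at some \<open>x\<close>, then on the shrunken copy \<open>(1 - t) x + t Z\<close>, of
  volume \<open>t\<^sup>n |Z|\<close>, the density would be at least a multiple of \<open>t\<^bsup>- (n + q)\<^esup>\<close>; the total mass
  bounds \<open>t\<^bsup>- q\<^esup>\<close>.\<close>

lemma u_bounded_away:
  obtains t where "0 < t" "\<And>x. ereal (c + t) < u x"
proof -
  interpret prob_space \<rho> by (rule prob_\<rho>)
  obtain Z m where Z[measurable]: "Z \<in> sets borel" and Z0: "0 < emeasure lborel Z" "emeasure lborel Z < \<infinity>"
    and um: "\<And>z. z \<in> Z \<Longrightarrow> u z \<le> ereal m"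
    using finite_region by metis
  define \<zeta> where "\<zeta> = measure lborel Z"
  have e\<zeta>: "emeasure lborel Z = ennreal \<zeta>"
    unfolding \<zeta>_def using Z0 by (intro emeasure_eq_ennreal_measure) auto
  have \<zeta>: "0 < \<zeta>" using Z0 by (simp add: e\<zeta>)
  have "Z \<noteq> {}" using Z0 by auto
  then obtain z0 where "z0 \<in> Z" by auto
  then have mc: "c \<le> m" using um[of z0] u_ge_c[of z0] by (metis ereal_less_eq(3) order_trans)
  \<comment> \<open>Convexity bounds \<open>u\<close> on the shrunken copy by
    \<open>(1 - t) * (c + t) + t * m\<close>, which is at most \<open>c + t * b\<close>.\<close>
  define b where "b = 1 + (m - c)"
  have b: "b \<ge> 1" using mc by (simp add: b_def)
  define \<kappa> where "\<kappa> = \<zeta> / b powr p"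
  have \<kappa>: "0 < \<kappa>" using \<zeta> b by (simp add: \<kappa>_def)
  \<comment> \<open>Gives \<open>t powr q \<le> \<kappa> / 2\<close>, whereas the mass bound will
    demand \<open>\<kappa> \<le> t powr q\<close>.\<close>
  define t where "t = min (1 / 2) ((\<kappa> / 2) powr (1 / q))"
  have t: "0 < t" "t < 1"
    using \<kappa> by (auto simp: t_def min_def)
  have "t \<le> (\<kappa> / 2) powr (1 / q)" unfolding t_def by (rule min.cobounded2)
  then have "t powr q \<le> ((\<kappa> / 2) powr (1 / q)) powr q"
    using t q by (intro powr_mono2) auto
  also have "\<dots> = \<kappa> / 2" using \<kappa> q by (simp add: powr_powr)
  finally have tq: "t powr q < \<kappa>" using \<kappa> by simp
  have "ereal (c + t) < u x" for x
  proof (rule ccontr)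
    assume "\<not> ereal (c + t) < u x"
    then have le: "u x \<le> ereal (c + t)" by simp
    then have "u x \<noteq> \<infinity>" by auto
    then have ux: "u x = ereal (v x)" by (rule u_eq_v)
    have vt: "v x \<le> c + t" using le unfolding ux by simp
    let ?S = "(\<lambda>z. (1 - t) *\<^sub>R x + t *\<^sub>R z) ` Z"
    have S[measurable]: "?S \<in> sets borel" and eS: "emeasure lborel ?S = ennreal (t ^ DIM('a)) * ennreal \<zeta>"
      using emeasure_lborel_affine_image[OF Z t(1)] by (auto simp: e\<zeta>)
    define d where "d = t * b"
    have d: "0 < d" using t b by (simp add: d_def)
    have uS: "u y \<le> ereal (c + d)" if "y \<in> ?S" for y
    proof -
      from that obtain z where z: "z \<in> Z" "y = (1 - t) *\<^sub>R x + t *\<^sub>R z" by auto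
      have "u y \<le> ereal ((1 - t) * v x + t * m)"
        unfolding z(2) by (rule segment_bound[OF ux um[OF z(1)] t])
      also have "(1 - t) * v x + t * m \<le> (1 - t) * (c + t) + t * m"
        using vt t by (intro add_right_mono mult_left_mono) auto
      also have "\<dots> \<le> c + d"
        using t by (simp add: d_def b_def algebra_simps)
      finally show ?thesis by simp
    qed
    have "(\<integral>\<^sup>+y. ennreal (d powr (- p)) * indicator ?S y \<partial>lborel) \<le> (\<integral>\<^sup>+y. ennreal (g y) * indicator ?S y \<partial>lborel)"
    proof (rule nn_integral_mono_AE)
      show "AE y in lborel. ennreal (d powr (- p)) * indicator ?S y \<le> ennreal (g y) * indicator ?S y"
        using ae_lower_bound
      proof eventually_elim
        case (elim y)
        show ?case
        proof (cases "y \<in> ?S")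
          case True
          then have uy: "u y \<le> ereal (c + d)" by (rule uS)
          then have fin: "u y \<noteq> \<infinity>" by auto
          then have g: "0 < g y" "g y powr (\<alpha> - 1) \<le> v y - c" using elim by auto
          have "v y \<le> c + d" using uy unfolding u_eq_v[OF fin] by simp
          then have "g y powr (\<alpha> - 1) \<le> d" using g by simp
          then have "d powr (- p) \<le> (g y powr (\<alpha> - 1)) powr (- p)"
            using g \<alpha> by (intro powr_mono2') auto
          also have "\<dots> = g y" using g \<alpha> by (simp add: powr_powr)
          finally show ?thesis using True by (simp add: ennreal_leI)
        qed simp
      qed
    qed
    also have "\<dots> \<le> (\<integral>\<^sup>+y. indicator ?S y \<partial>\<rho>)"
      unfolding g_def by (rule nn_integral_ac_density_le[OF \<rho>]) simp
    also have "\<dots> \<le> 1"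
      using S sets_\<rho> measure_le_1 by simp
    finally have "ennreal (d powr (- p)) * (ennreal (t ^ DIM('a)) * ennreal \<zeta>) \<le> 1"
      by (simp add: nn_integral_cmult_indicator eS)
    then have "d powr (- p) * (t ^ DIM('a) * \<zeta>) \<le> 1"
      using t \<zeta> by (simp add: ennreal_mult[symmetric])
    \<comment> \<open>Since \<open>d = t * b\<close> and \<open>p = n + q\<close>, the volume factor
      \<open>t ^ n\<close> cancels and leaves the exponent \<open>q\<close>.\<close>
    then have "t ^ DIM('a) * \<zeta> \<le> d powr p"
      using d by (simp add: powr_minus divide_simps)
    also have "\<dots> = t ^ DIM('a) * (t powr q * b powr p)"
      using t b by (simp add: d_def powr_mult p_def powr_add powr_realpow)
    finally have "\<zeta> \<le> t powr q * b powr p" using t by simp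
    then have "\<kappa> \<le> t powr q" using b by (simp add: \<kappa>_def divide_simps)
    with tq show False by simp
  qed
  with t show thesis using that by blast
qed

text \<open>As \<open>u\<close> stays above \<open>c + t\<close>, its contact set with
  \<open>c\<close> is empty and the density is bounded by \<open>t powr (- p)\<close>. The singular
  part lives on \<open>N\<close>, where \<open>u = c\<close> holds \<open>\<rho>\<close>-almost
  everywhere, so it must vanish.\<close>

theorem optimality:
  shows "(\<forall>x. u x \<ge> ereal c) \<and>
    (AE x in lborel. g x > 0 \<longrightarrow> u x + ent_deriv \<alpha> (g x) = ereal c) \<and>
    (AE x in lborel. g x = 0 \<longrightarrow> u x + ent_deriv \<alpha> (g x) \<ge> ereal c) \<and>
    emeasure (sing_part \<rho>) (- {x. u x = ereal c}) = 0 \<and>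
    {x. u x = ereal c} = {} \<and>
    sing_part \<rho> = null_measure borel \<and>
    absolutely_continuous lborel \<rho> \<and>
    \<rho> = density lborel (\<lambda>x. ennreal (g x)) \<and>
    (AE x in lborel. g x = neg_power (u x - ereal c) p) \<and>
    bounded (range (\<lambda>x. neg_power (u x - ereal c) p))"
proof -
  interpret prob_space \<rho> by (rule prob_\<rho>)
  obtain N where N: "N \<in> null_sets lborel" and Nb[measurable]: "N \<in> sets borel"
    and sing: "\<And>A. A \<in> sets borel \<Longrightarrow> emeasure (sing_part \<rho>) A = emeasure \<rho> (A \<inter> N)"
    and ae\<rho>: "AE x in \<rho>. u x = ereal (c + (if x \<in> N then 0 else g x powr (\<alpha> - 1)))"
    and ae: "AE x in lborel. 0 < g x \<longrightarrow> u x = ereal (c + g x powr (\<alpha> - 1))"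
    by (rule equality_on_support) blast
  obtain t where t: "0 < t" "\<And>x. ereal (c + t) < u x" using u_bounded_away by metis
  have gt: "ereal c < u x" for x
    using t(2)[of x] by (rule le_less_trans[rotated]) (use t(1) in simp)
  then have ne: "u x \<noteq> ereal c" for x by (metis less_irrefl)
  then have empty: "{x. u x = ereal c} = {}" by simp
  have "AE x in \<rho>. x \<notin> N"
    using ae\<rho> by eventually_elim (auto simp: ne)
  then have "emeasure \<rho> N = 0"
    using AE_iff_null_sets[of N \<rho>] by (auto simp: sets_\<rho> null_sets_def)
  have sing0: "emeasure (sing_part \<rho>) A = 0" if "A \<in> sets borel" for A
  proof -
    have "emeasure \<rho> (A \<inter> N) \<le> emeasure \<rho> N" by (rule emeasure_mono) (auto simp: sets_\<rho>)
    then show ?thesis using sing[OF that] \<open>emeasure \<rho> N = 0\<close> by simp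
  qed
  have d: "lebesgue_decomposition \<rho> g (sing_part \<rho>)"
    unfolding g_def by (rule ac_densityD(3)[OF \<rho>])
  have null: "sing_part \<rho> = null_measure borel"
    by (rule measure_eqI) (use d sing0 in \<open>auto simp: lebesgue_decomposition_def\<close>)
  have dens: "\<rho> = density lborel (\<lambda>x. ennreal (g x))"
  proof (rule measure_eqI)
    fix A assume "A \<in> sets \<rho>"
    then have "A \<in> sets borel" by (simp add: sets_\<rho>)
    then show "emeasure \<rho> A = emeasure (density lborel (\<lambda>x. ennreal (g x))) A"
      using d sing0 by (simp add: lebesgue_decomposition_def emeasure_density)
  qed (simp add: sets_\<rho>)
  have ac: "absolutely_continuous lborel \<rho>"
    by (subst dens, rule absolutely_continuousI_density) measurable
  have "AE x in lborel. g x > 0 \<longrightarrow> u x + ent_deriv \<alpha> (g x) = ereal c"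
    using ae by eventually_elim (auto simp: ent_deriv_def)
  \<comment> \<open>Zero density forces \<open>u x = \<infinity>\<close>, and then the convention
    \<open>\<infinity> + (- \<infinity>) = \<infinity>\<close> gives the inequality.\<close>
  moreover have "AE x in lborel. g x = 0 \<longrightarrow> u x + ent_deriv \<alpha> (g x) \<ge> ereal c"
    using ae_lower_bound by eventually_elim (auto simp: ent_deriv_def)
  moreover have "AE x in lborel. g x = neg_power (u x - ereal c) p"
    using ae ae_lower_bound
  proof eventually_elim
    case (elim x)
    show ?case
    proof (cases "g x = 0")
      case True
      then have "u x = \<infinity>" using elim(2) by auto
      then show ?thesis using True by (simp add: neg_power_def)
    next
      case False
      then have g: "0 < g x" using g_nonneg[of x] by simp
      then have "u x = ereal (c + g x powr (\<alpha> - 1))" using elim(1) by blast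
      then have "neg_power (u x - ereal c) p = (g x powr (\<alpha> - 1)) powr (- p)"
        by (simp add: neg_power_def)
      also have "\<dots> = g x" using g \<alpha> by (simp add: powr_powr)
      finally show ?thesis by simp
    qed
  qed
  moreover have "bounded (range (\<lambda>x. neg_power (u x - ereal c) p))"
  proof (rule boundedI)
    fix y assume "y \<in> range (\<lambda>x. neg_power (u x - ereal c) p)"
    then obtain x where y: "y = neg_power (u x - ereal c) p" by auto
    show "norm y \<le> t powr (- p)"
    proof (cases "u x = \<infinity>")
      case True
      then show ?thesis by (simp add: y neg_power_def)
    next
      case False
      then have ux: "u x = ereal (v x)" by (rule u_eq_v)
      have "t \<le> v x - c" using t(2)[of x] unfolding ux by simp
      then have "(v x - c) powr (- p) \<le> t powr (- p)"
        using t \<alpha> by (intro powr_mono2') auto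
      then show ?thesis by (simp add: y neg_power_def ux)
    qed
  qed
  moreover have "emeasure (sing_part \<rho>) (- {x. u x = ereal c}) = 0"
    unfolding empty null by simp
  ultimately show ?thesis
    using u_ge_c empty null ac dens by blast
qed

end

section \<open>Reduction of the original problem to the linearised one\<close>

lemma J_functional_eq:
  fixes \<rho> :: "'a::euclidean_space measure"
  assumes "\<rho> \<in> P1" "q > 1"
  shows "J_functional (alpha DIM('a) q) \<mu> \<rho> =
    ereal (- (1 / alpha DIM('a) q) * (\<integral>x. ac_density \<rho> x powr alpha DIM('a) q \<partial>lborel)) + transport \<rho> \<mu>"
  unfolding J_functional_def energy_eq[OF assms] ..

text \<open>On the ball of radius \<open>r\<close> the energy gain is of order \<open>r\<^bsup>n / (n + q)\<^esup>\<close>, while the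
  transport term is at most of order \<open>r\<close>.\<close>

lemma J_functional_negative:
  fixes \<mu> :: "'a::euclidean_space measure"
  assumes \<mu>: "\<mu> \<in> P1" and q: "q > 1"
  shows "\<exists>\<rho>\<in>P1. J_functional (alpha DIM('a) q) \<mu> \<rho> < 0"
proof -
  define p where "p = real DIM('a) + q"
  define \<alpha> where "\<alpha> = alpha DIM('a) q"
  note \<alpha> = alpha_facts[OF q p_def, folded \<alpha>_def]
  define M where "M = (\<integral>y. norm y \<partial>\<mu>)"
  have M: "0 \<le> M" unfolding M_def by simp
  define \<omega> where "\<omega> = unit_ball_vol (real DIM('a))"
  have \<omega>: "0 < \<omega>" by (simp add: \<omega>_def)
  define \<kappa> where "\<kappa> = \<omega> powr (1 / p)"
  have \<kappa>: "0 < \<kappa>" using \<omega> by (simp add: \<kappa>_def)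
  \<comment> \<open>Solves \<open>r powr (q / p) = \<kappa> / (2 * (M + 1))\<close>. Since
    \<open>r = r powr (n / p) * r powr (q / p)\<close>, the transport bound \<open>r * M\<close> is
    then less than the energy gain.\<close>
  define r where "r = (\<kappa> / (2 * (M + 1))) powr (p / q)"
  have r: "0 < r" using \<kappa> M by (simp add: r_def)
  have rq: "r powr (q / p) = \<kappa> / (2 * (M + 1))"
    using \<kappa> M q \<alpha> by (simp add: r_def powr_powr)
  define B where "B = cball (0::'a) r"
  have [measurable]: "B \<in> sets borel" by (simp add: B_def)
  define V where "V = \<omega> * r ^ DIM('a)"
  have V: "0 < V" using \<omega> r by (simp add: V_def)
  have eB: "emeasure lborel B = ennreal V"
    using r by (simp add: B_def V_def \<omega>_def emeasure_cball)
  have mB: "measure lborel B = V" using V by (simp add: measure_def eB)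
  define k where "k x = indicator B x / V" for x
  have [measurable]: "k \<in> borel_measurable borel" unfolding k_def by measurable
  have k0: "0 \<le> k x" for x using V by (simp add: k_def)
  have k1: "(\<integral>\<^sup>+x. ennreal (k x) \<partial>lborel) = 1"
  proof -
    have "(\<integral>\<^sup>+x. ennreal (k x) \<partial>lborel) = (\<integral>\<^sup>+x. ennreal (1 / V) * indicator B x \<partial>lborel)"
      by (intro nn_integral_cong) (simp add: k_def indicator_def)
    also have "\<dots> = ennreal (1 / V) * ennreal V"
      by (simp add: nn_integral_cmult_indicator eB)
    also have "\<dots> = 1" using V by (simp add: ennreal_mult[symmetric])
    finally show ?thesis .
  qed
  define \<sigma> where "\<sigma> = density lborel (\<lambda>x. ennreal (k x))"
  have kB: "k x \<noteq> 0 \<Longrightarrow> x \<in> B" for x by (auto simp: k_def indicator_def)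
  have \<sigma>: "\<sigma> \<in> P1" and aeB: "AE x in \<sigma>. x \<in> B"
    using density_mem_P1[of k r] k0 k1 kB unfolding \<sigma>_def by (auto simp: B_def elim!: eventually_mono)
  interpret \<sigma>: prob_space \<sigma> using P1D[OF \<sigma>] by simp
  have "lebesgue_decomposition \<sigma> k (null_measure borel)"
    unfolding lebesgue_decomposition_def \<sigma>_def using k0
    by (auto simp: emeasure_density intro!: bexI[of _ "{}"])
  then have ac: "AE x in lborel. ac_density \<sigma> x = k x"
    by (rule ac_density_unique[OF \<sigma>.finite_measure_axioms P1D(2)[OF \<sigma>]])
  have [measurable]: "ac_density \<sigma> \<in> borel_measurable borel" by (rule ac_densityD(1)[OF \<sigma>])
  have "(\<integral>x. ac_density \<sigma> x powr \<alpha> \<partial>lborel) = (\<integral>x. V powr (- \<alpha>) * indicator B x \<partial>lborel)"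
  proof (intro integral_cong_AE, measurable, use ac in eventually_elim)
    fix x assume eq: "ac_density \<sigma> x = k x"
    show "ac_density \<sigma> x powr \<alpha> = V powr (- \<alpha>) * indicator B x"
      unfolding eq using V by (cases "x \<in> B") (simp_all add: k_def powr_divide powr_minus divide_simps)
  qed
  also have "\<dots> = V powr (- \<alpha>) * V"
    using V by (simp add: mB)
  also have "\<dots> = V powr (1 / p)"
  proof -
    have "V powr (- \<alpha>) * V = V powr (1 + (- \<alpha>))"
      using V by (simp only: powr_add powr_one mult.commute)
    also have "1 + (- \<alpha>) = 1 / p" using \<alpha> by simp
    finally show ?thesis .
  qed
  also have "\<dots> = \<kappa> * r powr (real DIM('a) / p)"
    using \<omega> r by (simp add: V_def \<kappa>_def powr_mult powr_realpow[symmetric] powr_powr)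
  finally have en: "(\<integral>x. ac_density \<sigma> x powr \<alpha> \<partial>lborel) = \<kappa> * r powr (real DIM('a) / p)" .
  \<comment> \<open>Weak duality with the pair \<open>0\<close> and \<open>r * norm y\<close>, valid
    on the ball by Cauchy-Schwarz.\<close>
  have "transport \<sigma> \<mu> \<le> ereal ((\<integral>x. 0 \<partial>\<sigma>) + (\<integral>y. r * norm y \<partial>\<mu>))"
  proof (rule transport_le[where X=B and Y=UNIV])
    show "sets \<sigma> = sets borel" "sets \<mu> = sets borel" using P1D \<sigma> \<mu> by auto
    show "integrable \<mu> (\<lambda>y. r * norm y)" using P1D(3)[OF \<mu>] by simp
    fix x y assume "x \<in> B"
    have "x \<bullet> y \<le> norm x * norm y" by (rule norm_cauchy_schwarz)
    also have "\<dots> \<le> r * norm y" using \<open>x \<in> B\<close> by (intro mult_right_mono) (auto simp: B_def)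
    finally show "x \<bullet> y \<le> 0 + r * norm y" by simp
  qed (use aeB in auto)
  then have T: "transport \<sigma> \<mu> \<le> ereal (r * M)" by (simp add: M_def)
  have "J_functional \<alpha> \<mu> \<sigma> \<le> ereal (- (1 / \<alpha>) * (\<kappa> * r powr (real DIM('a) / p))) + ereal (r * M)"
    unfolding \<alpha>_def J_functional_eq[OF \<sigma> q] unfolding \<alpha>_def[symmetric] en
    using T by (rule add_left_mono)
  also have "\<dots> < 0"
  proof -
    have "r = r powr (real DIM('a) / p) * r powr (q / p)"
    proof -
      have "real DIM('a) / p + q / p = 1" using \<alpha> by (simp add: p_def add_divide_distrib[symmetric])
      then show ?thesis using r by (simp add: powr_add[symmetric])
    qed
    then have "r * M = r powr (real DIM('a) / p) * (\<kappa> / (2 * (M + 1))) * M"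
      unfolding rq by (rule arg_cong[where f="\<lambda>s. s * M"])
    also have "\<dots> = r powr (real DIM('a) / p) * (\<kappa> * (M / (2 * (M + 1))))"
      by simp
    also have "\<dots> < r powr (real DIM('a) / p) * (\<kappa> * 1)"
      using r \<kappa> M by (intro mult_strict_left_mono) (auto simp: divide_simps)
    also have "\<dots> \<le> (1 / \<alpha>) * (\<kappa> * r powr (real DIM('a) / p))"
    proof -
      have "1 * (\<kappa> * r powr (real DIM('a) / p)) \<le> (1 / \<alpha>) * (\<kappa> * r powr (real DIM('a) / p))"
        using \<alpha> \<kappa> by (intro mult_right_mono) (auto simp: divide_simps)
      then show ?thesis by (simp add: mult.commute)
    qed
    finally show ?thesis by simp
  qed
  finally show ?thesis using \<sigma> unfolding \<alpha>_def by blast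
qed

text \<open>A negative minimum makes the transport term finite, hence also the dual cost of
  \<open>u\<close>; with nonnegative transport it excludes a density vanishing almost everywhere.
  Minimality for the linearised functional follows by using strong duality at \<open>\<rho>\<close>
  and weak duality at the competitor.\<close>

lemma minimizers_entropic:
  fixes \<mu> \<rho> :: "'a::euclidean_space measure"
  assumes q: "q > 1" and \<mu>: "\<mu> \<in> P1" and cent: "(\<integral>y. y \<partial>\<mu>) = 0"
    and \<rho>min: "is_arg_min (J_functional (alpha DIM('a) q) \<mu>) (\<lambda>\<rho>'. \<rho>' \<in> P1) \<rho>"
    and umin: "is_arg_min (dual_cost \<rho> \<mu>) admissible u"
  shows "entropic_minimizer \<rho> u q"
proof -
  let ?\<alpha> = "alpha DIM('a) q"
  have \<alpha>: "0 < ?\<alpha>" using alpha_facts[OF q refl] by simp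
  have \<rho>: "\<rho> \<in> P1" and Jmin: "\<And>\<rho>'. \<rho>' \<in> P1 \<Longrightarrow> J_functional ?\<alpha> \<mu> \<rho> \<le> J_functional ?\<alpha> \<mu> \<rho>'"
    using \<rho>min by (auto simp: is_arg_min_def not_less)
  have u: "admissible u" and dmin: "\<And>w. admissible w \<Longrightarrow> dual_cost \<rho> \<mu> u \<le> dual_cost \<rho> \<mu> w"
    using umin by (auto simp: is_arg_min_def not_less)
  define e where "e = (\<lambda>\<rho>' :: 'a measure. - (1 / ?\<alpha>) * (\<integral>x. ac_density \<rho>' x powr ?\<alpha> \<partial>lborel))"
  have J: "J_functional ?\<alpha> \<mu> \<rho>' = ereal (e \<rho>') + transport \<rho>' \<mu>" if "\<rho>' \<in> P1" for \<rho>'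
    unfolding e_def by (rule J_functional_eq[OF that q])
  have Jneg: "J_functional ?\<alpha> \<mu> \<rho> < 0"
    using J_functional_negative[OF \<mu> q] Jmin by (meson le_less_trans)
  have T0: "0 \<le> transport \<rho> \<mu>" by (rule transport_nonneg[OF \<rho> \<mu> cent])
  have Tfin: "transport \<rho> \<mu> < \<infinity>"
    using Jneg unfolding J[OF \<rho>] by (cases "transport \<rho> \<mu>") auto
  have "dual_cost \<rho> \<mu> u \<le> transport \<rho> \<mu>"
    using kantorovich_duality[OF \<rho> \<mu>] dmin order_trans by blast
  with Tfin have "dual_cost \<rho> \<mu> u < \<infinity>" by (rule le_less_trans[rotated])
  note D = dual_cost_finite[OF \<rho> \<mu> u this]
  define b where "b = (\<integral>y. real_of_ereal (legendre u y) \<partial>\<mu>)"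
  have Tge: "ereal ((\<integral>x. real_of_ereal (u x) \<partial>\<rho>) + b) \<le> transport \<rho> \<mu>"
    using \<open>dual_cost \<rho> \<mu> u \<le> transport \<rho> \<mu>\<close> unfolding D(5) b_def .
  have ubot: "u x \<noteq> - \<infinity>" for x using u by (simp add: admissible_def)
  show ?thesis
  proof
    show "\<rho> \<in> P1" "q > 1" by fact+
    show "u \<in> borel_measurable borel" "u x \<noteq> - \<infinity>" "convex_ereal u" for x
      using u by (auto simp: admissible_def intro: borel_measurable_lsc)
    show "integrable \<rho> (\<lambda>x. real_of_ereal (u x))" by (rule D(1))
    show "AE x in \<rho>. u x \<noteq> \<infinity>" using D(2) by eventually_elim (metis PInfty_neq_ereal(1))
    show "\<not> (AE x in lborel. ac_density \<rho> x = 0)"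
    proof
      assume "AE x in lborel. ac_density \<rho> x = 0"
      then have "(\<integral>x. ac_density \<rho> x powr ?\<alpha> \<partial>lborel) = (\<integral>x. 0 \<partial>(lborel :: 'a measure))"
        using ac_densityD(1)[OF \<rho>] by (intro integral_cong_AE) (auto elim!: eventually_mono)
      then have "e \<rho> = 0" by (simp add: e_def)
      with Jneg T0 show False unfolding J[OF \<rho>] by simp
    qed
    fix \<rho>' :: "'a measure"
    assume \<rho>': "\<rho>' \<in> P1" "AE x in \<rho>'. u x \<noteq> \<infinity>" "integrable \<rho>' (\<lambda>x. real_of_ereal (u x))"
    have "transport \<rho>' \<mu> \<le> ereal ((\<integral>x. real_of_ereal (u x) \<partial>\<rho>') + (\<integral>y. real_of_ereal (legendre u y) \<partial>\<mu>))"
    proof (rule transport_le[where X="{x. u x \<noteq> \<infinity>}" and Y="{y. legendre u y = ereal (real_of_ereal (legendre u y))}"])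
      show "sets \<rho>' = sets borel" "sets \<mu> = sets borel" using P1D \<rho>'(1) \<mu> by auto
      fix x y assume x: "x \<in> {x. u x \<noteq> \<infinity>}" and y: "y \<in> {y. legendre u y = ereal (real_of_ereal (legendre u y))}"
      obtain r where r: "u x = ereal r" using x ubot[of x] by (cases "u x") auto
      define s where "s = real_of_ereal (legendre u y)"
      have s: "legendre u y = ereal s" using y unfolding s_def mem_Collect_eq .
      show "x \<bullet> y \<le> real_of_ereal (u x) + real_of_ereal (legendre u y)"
        using legendre_ge[of x y u] unfolding r s by simp
    qed (use \<rho>' D in auto)
    then have T': "transport \<rho>' \<mu> \<le> ereal ((\<integral>x. real_of_ereal (u x) \<partial>\<rho>') + b)"
      by (simp add: b_def)
    \<comment> \<open>The constant \<open>b\<close>, the integral of \<open>legendre u\<close>, is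
      the same for all competitors and cancels at the end.\<close>
    have "ereal (e \<rho>) + ereal ((\<integral>x. real_of_ereal (u x) \<partial>\<rho>) + b) \<le> ereal (e \<rho>) + transport \<rho> \<mu>"
      using Tge by (rule add_left_mono)
    also have "\<dots> \<le> ereal (e \<rho>') + transport \<rho>' \<mu>"
      using Jmin[OF \<rho>'(1)] unfolding J[OF \<rho>] J[OF \<rho>'(1)] .
    also have "\<dots> \<le> ereal (e \<rho>') + ereal ((\<integral>x. real_of_ereal (u x) \<partial>\<rho>') + b)"
      using T' by (rule add_left_mono)
    finally show "- (1 / ?\<alpha>) * (\<integral>x. ac_density \<rho> x powr ?\<alpha> \<partial>lborel) + (\<integral>x. real_of_ereal (u x) \<partial>\<rho>)
      \<le> - (1 / ?\<alpha>) * (\<integral>x. ac_density \<rho>' x powr ?\<alpha> \<partial>lborel) + (\<integral>x. real_of_ereal (u x) \<partial>\<rho>')"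
      unfolding e_def by simp
  qed
qed

theorem theorem3p2:
  fixes \<mu> \<rho> :: "(real ^ 'n) measure"
    and u :: "real ^ 'n \<Rightarrow> ereal"
    and q :: real
  assumes "q > 1"
    and "\<mu> \<in> P1"
    and "(\<integral>y. y \<partial>\<mu>) = 0"
    and "\<not> supported_on_hyperplane \<mu>"
    and "is_arg_min (J_functional (alpha CARD('n) q) \<mu>) (\<lambda>\<rho>'. \<rho>' \<in> P1) \<rho>"
    and "is_arg_min (dual_cost \<rho> \<mu>) admissible u"
  shows "\<exists>c::real.
    (\<forall>x. u x \<ge> ereal c) \<and>
    (AE x in lborel. ac_density \<rho> x > 0 \<longrightarrow>
       u x + ent_deriv (alpha CARD('n) q) (ac_density \<rho> x) = ereal c) \<and>
    (AE x in lborel. ac_density \<rho> x = 0 \<longrightarrow>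
       u x + ent_deriv (alpha CARD('n) q) (ac_density \<rho> x) \<ge> ereal c) \<and>
    emeasure (sing_part \<rho>) (- {x. u x = ereal c}) = 0 \<and>
    {x. u x = ereal c} = {} \<and>
    sing_part \<rho> = null_measure borel \<and>
    absolutely_continuous lborel \<rho> \<and>
    \<rho> = density lborel (\<lambda>x. ennreal (ac_density \<rho> x)) \<and>
    (AE x in lborel. ac_density \<rho> x = neg_power (u x - ereal c) (real CARD('n) + q)) \<and>
    bounded (range (\<lambda>x. neg_power (u x - ereal c) (real CARD('n) + q)))"
proof -
  have D: "DIM(real ^ 'n) = CARD('n)" by simp
  have "is_arg_min (J_functional (alpha DIM(real ^ 'n) q) \<mu>) (\<lambda>\<rho>'. \<rho>' \<in> P1) \<rho>"
    unfolding D by (rule assms(5))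
  then interpret entropic_minimizer \<rho> u q
    by (rule minimizers_entropic[OF assms(1-3) _ assms(6)])
  show ?thesis
    by (rule exI[of _ c]) (rule optimality[unfolded p_def \<alpha>_def g_def D])
qed

end
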